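(* Let $\mathscr{T} \in \mathcal{S}'(\mathbb{R}^{1,3})$ be a tempered distribution with support in the closed forward light cone $\overline{V}^{+}$, and let $N \in \mathbb{Z}_{\geq 0}$ be the order of $\mathscr{T}$. Then $$N = 0 \iff \mathscr{T} \text{ defines a finite measure.}$$
   Context: $\mathbb{R}^{1,3}$ is $\mathbb{R}^{4}$ with coordinates $p=(p_0,p_1,p_2,p_3)$ and the Minkowski form $p^2 = p_0^2-p_1^2-p_2^2-p_3^2$; $\overline{V}^{+}=\{p : p^2\ge 0,\ p_0\geq 0\}$. $\mathcal{S}(\mathbb{R}^{1,3})$ is the (complex) Schwartz space and $\mathcal{S}'(\mathbb{R}^{1,3})$ the space of tempered distributions. Order: for a tempered distribution $\mathscr{T}$ with support in $\overline{V}^{+}$, there exist $N\in\mathbb{Z}_{\ge 0}$ and a finite constant $C>0$ such that $$|\mathscr{T}(f)| \leq C \sum_{|\alpha| \leq N} \ \sup_{p \in\mathbb{R}^{1,3}} \left( 1+ \|p\| \right)^{N}|D^{\alpha}f(p)| \quad \forall f\in \mathcal{S}(\mathbb{R}^{1,3}),$$ where $\|p\|^{2} = \sum_{\mu=0}^{3} |p_{\mu}|^{2}$, $\alpha$ is a multi-index and $D^{\alpha} = \frac{\partial^{|\alpha|}}{ (\partial p_{0})^{\alpha_{0}} \cdots (\partial p_{3})^{\alpha_{3}}}$. The order $N$ of $\mathscr{T}$ is the minimal non-negative integer for which such a bound holds for some finite $C$. "$\mathscr{T}$ defines a finite measure" means that there is a finite complex regular Borel measure $\mu$ on $\mathbb{R}^{1,3}$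 such that $\mathscr{T}(f)=\int_{\mathbb{R}^{1,3}} f\, d\mu$ for all $f\in C_c^\infty(\mathbb{R}^{1,3})$. *)

theory Defs
  imports "HOL-Analysis.Analysis"
begin

section \<open>Minkowski space\<close>

text \<open>
  The index type \<^typ>\<open>4\<close> consists of the residues 0, 1, 2, 3, so the coordinates of \<open>p\<close> are
  \<open>p $ 0, p $ 1, p $ 2, p $ 3\<close>. The norm of \<^typ>\<open>real^4\<close> is the Euclidean one.
\<close>

type_synonym mink = "real^4"

definition mink_sq :: "mink \<Rightarrow> real" where
  "mink_sq p = (p $ 0)\<^sup>2 - (p $ 1)\<^sup>2 - (p $ 2)\<^sup>2 - (p $ 3)\<^sup>2"

definition forward_cone :: "mink set" where
  "forward_cone = {p. mink_sq p \<ge> 0 \<and> p $ 0 \<ge> 0}"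


section \<open>Smooth functions and Schwartz space\<close>

definition partial :: "4 \<Rightarrow> (mink \<Rightarrow> complex) \<Rightarrow> mink \<Rightarrow> complex" where
  "partial i f = (\<lambda>p. vector_derivative (\<lambda>t. f (p + t *\<^sub>R axis i 1)) (at 0))"

text \<open>
  All iterated partial derivatives, in any order of differentiation, exist and are continuous.
  Existence has to be demanded separately, since \<^const>\<open>vector_derivative\<close> is total.
\<close>

definition smooth :: "(mink \<Rightarrow> complex) \<Rightarrow> bool" where
  "smooth f \<longleftrightarrow> (\<forall>is. continuous_on UNIV (foldr partial is f) \<and>
     (\<forall>i p. (\<lambda>t::real. foldr partial is f (p + t *\<^sub>R axis i 1)) differentiable (at 0)))"

definition multi_deriv :: "(4 \<Rightarrow> nat) \<Rightarrow> (mink \<Rightarrow> complex) \<Rightarrow> mink \<Rightarrow> complex" where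
  "multi_deriv \<alpha> f =
     (partial 0 ^^ \<alpha> 0) ((partial 1 ^^ \<alpha> 1) ((partial 2 ^^ \<alpha> 2) ((partial 3 ^^ \<alpha> 3) f)))"

definition schwartz :: "(mink \<Rightarrow> complex) set" where
  "schwartz = {f. smooth f \<and>
     (\<forall>k \<alpha>. bdd_above (range (\<lambda>p. (1 + norm p) ^ k * cmod (multi_deriv \<alpha> f p))))}"

definition schwartz_seminorm :: "nat \<Rightarrow> (4 \<Rightarrow> nat) \<Rightarrow> (mink \<Rightarrow> complex) \<Rightarrow> real" where
  "schwartz_seminorm k \<alpha> f = (SUP p. (1 + norm p) ^ k * cmod (multi_deriv \<alpha> f p))"

text \<open>The locally convex topology of the Schwartz space; its \<^const>\<open>topspace\<close> is \<open>schwartz\<close>.\<close>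

definition schwartz_topology :: "(mink \<Rightarrow> complex) topology" where
  "schwartz_topology = topology_generated_by
     {{g \<in> schwartz. schwartz_seminorm k \<alpha> (\<lambda>p. g p - f p) < \<epsilon>} | k \<alpha> f \<epsilon>. f \<in> schwartz \<and> \<epsilon> > 0}"

definition test_functions :: "(mink \<Rightarrow> complex) set" where
  "test_functions = {f. smooth f \<and> compact (closure (support_on UNIV f))}"


section \<open>Tempered distributions\<close>

text \<open>A functional on the Schwartz space; its values outside \<^const>\<open>schwartz\<close> are irrelevant.\<close>

definition tempered_distribution :: "((mink \<Rightarrow> complex) \<Rightarrow> complex) \<Rightarrow> bool" where
  "tempered_distribution T \<longleftrightarrow>
     (\<forall>f\<in>schwartz. \<forall>g\<in>schwartz. T (\<lambda>p. f p + g p) = T f + T g) \<and>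
     (\<forall>c. \<forall>f\<in>schwartz. T (\<lambda>p. c * f p) = c * T f) \<and>
     continuous_map schwartz_topology euclidean T"

definition distribution_support :: "((mink \<Rightarrow> complex) \<Rightarrow> complex) \<Rightarrow> mink set" where
  "distribution_support T =
     - \<Union>{U. open U \<and> (\<forall>f\<in>test_functions. closure (support_on UNIV f) \<subseteq> U \<longrightarrow> T f = 0)}"

definition order_bound :: "((mink \<Rightarrow> complex) \<Rightarrow> complex) \<Rightarrow> nat \<Rightarrow> bool" where
  "order_bound T N \<longleftrightarrow> (\<exists>C>0. \<forall>f\<in>schwartz.
     cmod (T f) \<le> C * (\<Sum>\<alpha> | (\<Sum>i\<in>UNIV. \<alpha> i) \<le> N. schwartz_seminorm N \<alpha> f))"

text \<open>For a tempered distribution, continuity guarantees that some bound holds.\<close>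

definition distribution_order :: "((mink \<Rightarrow> complex) \<Rightarrow> complex) \<Rightarrow> nat" where
  "distribution_order T = (LEAST N. order_bound T N)"


section \<open>Complex measures\<close>

definition complex_measure :: "'a measure \<Rightarrow> ('a set \<Rightarrow> complex) \<Rightarrow> bool" where
  "complex_measure M \<mu> \<longleftrightarrow>
     (\<forall>A::nat \<Rightarrow> 'a set. range A \<subseteq> sets M \<longrightarrow> disjoint_family A \<longrightarrow>
        (\<lambda>i. \<mu> (A i)) sums \<mu> (\<Union>i. A i))"

definition total_variation :: "'a measure \<Rightarrow> ('a set \<Rightarrow> complex) \<Rightarrow> 'a set \<Rightarrow> ennreal" where
  "total_variation M \<mu> E =
     (SUP A\<in>{A::nat \<Rightarrow> 'a set. range A \<subseteq> sets M \<and> disjoint_family A \<and> (\<Union>i. A i) = E}.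
        \<Sum>i. ennreal (cmod (\<mu> (A i))))"

definition finite_regular_complex_borel_measure ::
    "('a::topological_space set \<Rightarrow> complex) \<Rightarrow> bool" where
  "finite_regular_complex_borel_measure \<mu> \<longleftrightarrow>
     complex_measure borel \<mu> \<and>
     total_variation borel \<mu> UNIV < \<infinity> \<and>
     (\<forall>E\<in>sets borel.
        total_variation borel \<mu> E = (INF U\<in>{U. open U \<and> E \<subseteq> U}. total_variation borel \<mu> U) \<and>
        total_variation borel \<mu> E = (SUP K\<in>{K. compact K \<and> K \<subseteq> E}. total_variation borel \<mu> K))"

text \<open>
  The positive part \<open>\<nu>\<^sup>+(E) = sup {\<nu>(F) | F \<subseteq> E measurable}\<close> of the Jordan decomposition of a finite
  signed measure \<open>\<nu>\<close>; the negative part is the positive part of \<open>-\<nu>\<close>. The cut-off of negative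
  values by \<^const>\<open>ennreal\<close> is harmless because \<open>F = {}\<close> contributes the value 0.
\<close>

definition positive_part :: "'a measure \<Rightarrow> ('a set \<Rightarrow> real) \<Rightarrow> 'a measure" where
  "positive_part M \<nu> =
     measure_of (space M) (sets M) (\<lambda>E. SUP F\<in>{F\<in>sets M. F \<subseteq> E}. ennreal (\<nu> F))"

definition complex_measure_integral ::
    "'a measure \<Rightarrow> ('a set \<Rightarrow> complex) \<Rightarrow> ('a \<Rightarrow> complex) \<Rightarrow> complex" where
  "complex_measure_integral M \<mu> f =
     integral\<^sup>L (positive_part M (\<lambda>E. Re (\<mu> E))) f - integral\<^sup>L (positive_part M (\<lambda>E. - Re (\<mu> E))) f
     + \<i> * (integral\<^sup>L (positive_part M (\<lambda>E. Im (\<mu> E))) f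
          - integral\<^sup>L (positive_part M (\<lambda>E. - Im (\<mu> E))) f)"

definition defines_finite_measure :: "((mink \<Rightarrow> complex) \<Rightarrow> complex) \<Rightarrow> bool" where
  "defines_finite_measure T \<longleftrightarrow>
     (\<exists>\<mu>. finite_regular_complex_borel_measure \<mu> \<and>
        (\<forall>f\<in>test_functions. T f = complex_measure_integral borel \<mu> f))"

end

(*
  Order zero means that T is bounded by the supremum norm. Such a T extends by density to the
  continuous functions of compact support, where the Riesz representation theorem applies: the real
  and imaginary parts are differences of positive functionals, and a positive functional P is
  represented by extending the assignment P(g - f) for the region {(x, t). f x <= t < g x} between two
  graphs to a measure on the product with the line (Caratheodory, with countable additivity from
  Dini's theorem), then restricting it to the strip 0 <= t < 1 and projecting.

  Conversely, a finite complex measure bounds T on test functions by the supremum norm. The bound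
  passes to a Schwartz function f by multiplying with dilated bump functions: the error tends to 0
  in every Schwartz seminorm, and T is continuous.
*)
theory Submission
  imports Defs "HOL-Library.Sublist"
begin

section \<open>Continuous functions of compact support\<close>

text \<open>The seminorm of order zero contains neither derivatives nor a weight in
  \<open>p\<close>, so the bound on \<open>T\<close> is uniform over all supports. This makes the
  representing measures finite and not only locally finite. Regions between graphs enter because
  \<open>P (g - f)\<close> is the value that the product of the sought measure with Lebesgue measure
  must give to such a region. Each vertical slice is a half-open interval, so questions about
  regions reduce to Lebesgue measure on the line. Two definitions shape the rest. Integration
  against a complex measure uses the Jordan parts of its components, while the Riesz argument
  supplies pairs of finite measures that are not shown to be mutually singular. A Hahn set computes
  the Jordan parts, and an identity of sums of measures, free of subtraction, transfers the
  integrals. Moreover, \<open>multi_deriv\<close> fixes the order of differentiation, so the product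
  rule for the cut-off is arranged to create only derivatives of \<open>f\<close> in that order. A
  bound of some finite order, obtained from continuity by scaling, gives the \<open>LEAST\<close>
  its meaning and also controls the cut-off error.\<close>

definition Cc :: "('a::euclidean_space \<Rightarrow> real) set" where
  "Cc = {f. continuous_on UNIV f \<and> (\<exists>R. \<forall>x. R < norm x \<longrightarrow> f x = 0)}"

definition Cc_nonneg :: "('a::euclidean_space \<Rightarrow> real) set" where
  "Cc_nonneg = {f \<in> Cc. \<forall>x. 0 \<le> f x}"

lemma CcI: "continuous_on UNIV f \<Longrightarrow> (\<And>x. R < norm x \<Longrightarrow> f x = 0) \<Longrightarrow> f \<in> Cc"
  unfolding Cc_def by blast

lemma Cc_nonnegI: "f \<in> Cc \<Longrightarrow> (\<And>x. 0 \<le> f x) \<Longrightarrow> f \<in> Cc_nonneg"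
  unfolding Cc_nonneg_def by blast

lemma Cc_nonnegD: "f \<in> Cc_nonneg \<Longrightarrow> f \<in> Cc" "f \<in> Cc_nonneg \<Longrightarrow> 0 \<le> f x"
  unfolding Cc_nonneg_def by auto

lemma Cc_continuous: "f \<in> Cc \<Longrightarrow> continuous_on UNIV f"
  unfolding Cc_def by auto

lemma Cc_supportE:
  assumes "f \<in> Cc" obtains R where "0 < R" "\<And>x. R < norm x \<Longrightarrow> f x = 0"
proof -
  obtain R where R: "\<And>x. R < norm x \<Longrightarrow> f x = 0" using assms unfolding Cc_def by auto
  have "\<And>x. max R 1 < norm x \<Longrightarrow> f x = 0" using R by simp
  then show ?thesis using that[of "max R 1"] by auto
qed

lemma Cc_map2:
  assumes "f \<in> Cc" "g \<in> Cc" "continuous_on UNIV (\<lambda>x. h (f x) (g x))" "h 0 0 = (0::real)"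
  shows "(\<lambda>x. h (f x) (g x)) \<in> Cc"
proof -
  obtain R where R: "\<And>x. R < norm x \<Longrightarrow> f x = 0" using Cc_supportE[OF assms(1)] by blast
  obtain S where S: "\<And>x. S < norm x \<Longrightarrow> g x = 0" using Cc_supportE[OF assms(2)] by blast
  show ?thesis
    using assms(3,4) R S by (intro CcI[where R = "max R S"]) auto
qed

lemma Cc_zero: "(\<lambda>x. 0) \<in> Cc"
  by (rule CcI[where R=0]) auto

lemma Cc_add: "f \<in> Cc \<Longrightarrow> g \<in> Cc \<Longrightarrow> (\<lambda>x. f x + g x) \<in> Cc"
  by (rule Cc_map2) (auto intro!: continuous_intros dest: Cc_continuous)

lemma Cc_diff: "f \<in> Cc \<Longrightarrow> g \<in> Cc \<Longrightarrow> (\<lambda>x. f x - g x) \<in> Cc"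
  by (rule Cc_map2) (auto intro!: continuous_intros dest: Cc_continuous)

lemma Cc_max: "f \<in> Cc \<Longrightarrow> g \<in> Cc \<Longrightarrow> (\<lambda>x. max (f x) (g x)) \<in> Cc"
  by (rule Cc_map2) (auto intro!: continuous_intros dest: Cc_continuous)

lemma Cc_min: "f \<in> Cc \<Longrightarrow> g \<in> Cc \<Longrightarrow> (\<lambda>x. min (f x) (g x)) \<in> Cc"
  by (rule Cc_map2) (auto intro!: continuous_intros dest: Cc_continuous)

lemma Cc_scale: "f \<in> Cc \<Longrightarrow> (\<lambda>x. c * f x) \<in> Cc"
  by (rule Cc_map2[of f f "\<lambda>a b. c * a"]) (auto intro!: continuous_intros dest: Cc_continuous)

lemma Cc_nonneg_scale: "f \<in> Cc_nonneg \<Longrightarrow> 0 \<le> c \<Longrightarrow> (\<lambda>x. c * f x) \<in> Cc_nonneg"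
  by (intro Cc_nonnegI Cc_scale mult_nonneg_nonneg) (auto dest: Cc_nonnegD)

lemma Cc_min_const: "f \<in> Cc \<Longrightarrow> 0 \<le> c \<Longrightarrow> (\<lambda>x. min (f x) c) \<in> Cc"
  by (rule Cc_map2[of f f "\<lambda>a b. min a c"]) (auto intro!: continuous_intros dest: Cc_continuous)

lemma Cc_sum: "(\<And>i. i \<in> I \<Longrightarrow> f i \<in> Cc) \<Longrightarrow> (\<lambda>x. \<Sum>i\<in>I. f i x) \<in> Cc"
  by (induction I rule: infinite_finite_induct) (auto intro: Cc_zero Cc_add)

lemma Cc_bounded:
  assumes "f \<in> Cc" obtains B where "0 \<le> B" "\<And>x. \<bar>f x\<bar> \<le> B"
proof -
  obtain R where R: "0 < R" "\<And>x. R < norm x \<Longrightarrow> f x = 0" using Cc_supportE[OF assms] by blast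
  have "compact (f ` cball 0 R)"
    using Cc_continuous[OF assms] by (intro compact_continuous_image) (auto intro: continuous_on_subset)
  then obtain B where B: "\<And>y. y \<in> f ` cball 0 R \<Longrightarrow> \<bar>y\<bar> \<le> B"
    using compact_imp_bounded bounded_iff by (metis real_norm_def)
  have "\<bar>f x\<bar> \<le> max B 0" for x
    using B[of "f x"] R(2)[of x] by (cases "R < norm x") (auto simp: max_def)
  then show ?thesis using that[of "max B 0"] by auto
qed

text \<open>The points with gap at least \<open>e\<close> form a decreasing sequence of compact
  sets. If none were empty, a common point would contradict pointwise convergence. Nonnegativity of
  \<open>s n\<close> keeps these points in a ball carrying \<open>f\<close>, since outside it the
  gap is at most 0.\<close>

lemma Dini_Cc:
  fixes f :: "'a::euclidean_space \<Rightarrow> real"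
  assumes f: "f \<in> Cc" and s: "\<And>n. s n \<in> Cc" and mono: "\<And>n x. s n x \<le> s (Suc n) x"
    and nonneg: "\<And>n x. 0 \<le> s n x" and lim: "\<And>x. (\<lambda>n. s n x) \<longlonglongrightarrow> f x" and "0 < e"
  shows "\<exists>n. \<forall>x. f x - s n x < e"
proof (rule ccontr)
  assume neg: "\<not> ?thesis"
  obtain R where R: "0 < R" "\<And>x. R < norm x \<Longrightarrow> f x = 0" using Cc_supportE[OF f] by blast
  define F where "F n = cball 0 R \<inter> {x. e \<le> f x - s n x}" for n
  have inc: "incseq (\<lambda>n. s n x)" for x using mono by (auto intro: incseq_SucI)
  have "compact (F n)" for n
    unfolding F_def using Cc_continuous[OF f] Cc_continuous[OF s[of n]]
    by (intro compact_Int_closed closed_Collect_le) (auto intro!: continuous_intros)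
  moreover have "F n \<noteq> {}" for n
  proof -
    obtain x where x: "e \<le> f x - s n x" using neg by (meson not_le)
    then have "\<not> R < norm x" using R(2)[of x] nonneg[of n x] \<open>0 < e\<close> by auto
    then have "x \<in> F n" using x unfolding F_def by simp
    then show ?thesis by blast
  qed
  moreover have "F n \<subseteq> F m" if "m \<le> n" for m n
    unfolding F_def using inc[THEN incseqD, OF that] by (auto simp: le_diff_eq) (smt (verit))
  ultimately have "\<Inter>(range F) \<noteq> {}" by (rule compact_nest)
  then obtain x where x: "\<And>n. e \<le> f x - s n x" unfolding F_def by auto
  have "(\<lambda>n. f x - s n x) \<longlonglongrightarrow> f x - f x" by (intro tendsto_intros lim)
  then have "e \<le> 0" using x by (intro LIMSEQ_le_const[where X="\<lambda>n. f x - s n x"]) auto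
  then show False using \<open>0 < e\<close> by simp
qed

definition cutoff :: "nat \<Rightarrow> 'a::euclidean_space \<Rightarrow> real" where
  "cutoff k x = min 1 (max 0 (real k - norm x))"

lemma cutoff_Cc: "cutoff k \<in> Cc_nonneg"
  unfolding cutoff_def[abs_def]
  by (intro Cc_nonnegI CcI[where R = k]) (auto intro!: continuous_intros)

lemma cutoff_mono: "k \<le> l \<Longrightarrow> cutoff k x \<le> cutoff l x"
  unfolding cutoff_def by auto

lemma cutoff_le_1: "cutoff k x \<le> 1"
  unfolding cutoff_def by auto

lemma cutoff_eq_1: "norm x + 1 \<le> k \<Longrightarrow> cutoff k x = 1"
  unfolding cutoff_def by auto

text \<open>Needed to write \<open>U \<times> {0..<1}\<close> as a countable union of regions below
  graphs. The value 1 must be attained exactly, so that every height \<open>t < 1\<close> over a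
  point of \<open>U\<close> is eventually covered.\<close>

lemma open_exhaustion_Cc:
  fixes U :: "'a::euclidean_space set"
  assumes "open U"
  shows "\<exists>h. (\<forall>k::nat. h k \<in> Cc_nonneg) \<and> (\<forall>k x. h k x \<le> 1) \<and> (\<forall>k x. x \<notin> U \<longrightarrow> h k x = 0)
     \<and> (\<forall>x\<in>U. \<exists>k. h k x = 1)"
proof -
  \<comment> \<open>\<open>infdist\<close> to the empty set is 0, so the case
    \<open>U = UNIV\<close> gets its own positive value.\<close>
  define d where "d x = (if U = UNIV then 1 else infdist x (-U))" for x
  have d: "continuous_on UNIV d"
    unfolding d_def[abs_def] by (cases "U = UNIV") (auto intro!: continuous_intros)
  have d0: "0 \<le> d x" for x unfolding d_def by (auto simp: infdist_nonneg)
  have d1: "d x > 0" if "x \<in> U" for x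
  proof (cases "U = UNIV")
    case False
    then have "closed (-U)" "-U \<noteq> {}" using \<open>open U\<close> by auto
    then have "infdist x (-U) \<noteq> 0" using in_closed_iff_infdist_zero[of "-U" x] that by auto
    then show ?thesis using False infdist_nonneg[of x "-U"] unfolding d_def by auto
  qed (auto simp: d_def)
  have d2: "d x = 0" if "x \<notin> U" for x
    using that unfolding d_def by auto
  define h where "h k x = min (real k * d x) 1 * cutoff k x" for k x
  have "h k \<in> Cc_nonneg" for k
  proof (intro Cc_nonnegI CcI[where R = k])
    show "continuous_on UNIV (h k)"
      unfolding h_def[abs_def] using d Cc_continuous[OF Cc_nonnegD(1)[OF cutoff_Cc[of k]]]
      by (auto intro!: continuous_intros)
    show "h k x = 0" if "k < norm x" for x using that unfolding h_def cutoff_def by auto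
    show "0 \<le> h k x" for x unfolding h_def using d0[of x] Cc_nonnegD(2)[OF cutoff_Cc] by (intro mult_nonneg_nonneg) auto
  qed
  moreover have "h k x \<le> 1" for k x
    unfolding h_def using d0[of x] Cc_nonnegD(2)[OF cutoff_Cc] cutoff_le_1[of k x]
    by (intro mult_le_one) auto
  moreover have "h k x = 0" if "x \<notin> U" for k x using d2[OF that] unfolding h_def by auto
  moreover have "\<exists>k. h k x = 1" if "x \<in> U" for x
  proof -
    obtain k :: nat where k: "max (1 / d x) (norm x + 1) < real k" using reals_Archimedean2 by blast
    then have "1 \<le> k * d x" using d1[OF that] by (auto simp: field_simps)
    then show ?thesis using cutoff_eq_1[of x k] k unfolding h_def by (intro exI[of _ k]) auto
  qed
  ultimately show ?thesis by blast
qed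


section \<open>Riesz representation of positive functionals\<close>

text \<open>Closed below and open above, so that regions can be cut along a graph without overlap or
  gap.\<close>

definition region :: "('a \<Rightarrow> real) \<Rightarrow> ('a \<Rightarrow> real) \<Rightarrow> ('a \<times> real) set" where
  "region f g = {(x, t). f x \<le> t \<and> t < g x}"

abbreviation region_pair :: "('a::euclidean_space \<Rightarrow> real) \<Rightarrow> ('a \<Rightarrow> real) \<Rightarrow> bool" where
  "region_pair f g \<equiv> f \<in> Cc \<and> g \<in> Cc \<and> (\<forall>x. f x \<le> g x)"

text \<open>Removing the second region from the first leaves a piece below \<open>f'\<close> and a
  piece above \<open>g'\<close>. The nested \<open>min\<close> and \<open>max\<close> clamp the new
  boundaries to the old ones, so that lower and upper graph stay ordered even over points where a
  slice is empty.\<close>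

lemma semiring_regions:
  "semiring_of_sets UNIV {region f g | f g :: 'a::euclidean_space \<Rightarrow> real. region_pair f g}"
proof
  show "{} \<in> {region f g | f g :: 'a \<Rightarrow> real. region_pair f g}"
    by (intro CollectI exI[of _ "\<lambda>x. 0"]) (auto simp: region_def Cc_zero)
next
  fix a b :: "('a \<times> real) set"
  assume "a \<in> {region f g | f g. region_pair f g}" "b \<in> {region f g | f g. region_pair f g}"
  then obtain f g f' g' where *: "a = region f g" "b = region f' g'" "region_pair f g" "region_pair f' g'"
    by auto
  have "a \<inter> b = region (\<lambda>x. min (max (f x) (f' x)) (min (g x) (g' x))) (\<lambda>x. min (g x) (g' x))"
    unfolding * region_def by auto
  moreover have "region_pair (\<lambda>x. min (max (f x) (f' x)) (min (g x) (g' x))) (\<lambda>x. min (g x) (g' x))"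
    using * by (auto intro!: Cc_min Cc_max)
  ultimately show "a \<inter> b \<in> {region f g | f g. region_pair f g}" by blast
  define c where "c = region f (\<lambda>x. max (f x) (min (g x) (f' x)))"
  define d where "d = region (\<lambda>x. min (g x) (max (f x) (g' x))) g"
  have "region_pair f (\<lambda>x. max (f x) (min (g x) (f' x)))" "region_pair (\<lambda>x. min (g x) (max (f x) (g' x))) g"
    using * by (auto intro!: Cc_min Cc_max)
  then have "c \<in> {region f g | f g. region_pair f g}" "d \<in> {region f g | f g. region_pair f g}"
    unfolding c_def d_def by blast+
  moreover have "disjoint {c, d}"
  proof -
    have "c \<inter> d = {}" unfolding c_def d_def region_def
      using * by (auto simp: max_def min_def split: if_splits) (smt (verit))+
    then show ?thesis unfolding disjoint_def by auto
  qed
  moreover have "a - b = \<Union>{c, d}"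
  proof -
    have "f x \<le> g x" "f' x \<le> g' x" for x using * by auto
    then show ?thesis unfolding * c_def d_def region_def
      by (auto simp: max_def min_def split: if_splits)
  qed
  ultimately show "\<exists>C\<subseteq>{region f g | f g. region_pair f g}. finite C \<and> disjoint C \<and> a - b = \<Union>C"
    by (intro exI[of _ "{c, d}"]) auto
qed auto

lemma region_slice: "Pair x -` region f g = {f x ..< g x}"
  unfolding region_def by auto

text \<open>Where a slice is empty the region does not determine \<open>f\<close> and
  \<open>g\<close>, but the length of the slice always determines \<open>g - f\<close>. Hence
  \<open>P (g - f)\<close> depends on the region alone.\<close>

lemma region_eq_imp_diff_eq:
  assumes "region f g = region f' g'" "\<And>x. f x \<le> g x" "\<And>x. f' x \<le> g' x"
  shows "g x - f x = g' x - f' x"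
proof -
  have "{f x ..< g x} = {f' x ..< g' x}" using assms(1) region_slice by metis
  then have "measure lborel {f x ..< g x} = measure lborel {f' x ..< g' x}" by simp
  then show ?thesis using assms(2)[of x] assms(3)[of x] by simp
qed

text \<open>Countable additivity of Lebesgue measure on each vertical slice.\<close>

lemma region_disjoint_union_sums:
  assumes "\<And>n x. f n x \<le> g n x" "\<And>x. f' x \<le> g' x"
    and "disjoint_family (\<lambda>n. region (f n) (g n))" "(\<Union>n. region (f n) (g n)) = region f' g'"
  shows "(\<lambda>n. g n x - f n x) sums (g' x - f' x)"
proof -
  have "disjoint_family (\<lambda>n::nat. {f n x ..< g n x})"
    using assms(3) unfolding disjoint_family_on_def region_slice[symmetric] by blast
  then have "(\<Sum>n. emeasure lborel {f n x ..< g n x}) = emeasure lborel (\<Union>n. {f n x ..< g n x})"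
    by (intro suminf_emeasure) auto
  moreover have "(\<Union>n. {f n x ..< g n x}) = {f' x ..< g' x}"
    unfolding region_slice[symmetric] assms(4)[symmetric] by auto
  ultimately have "(\<Sum>n. ennreal (g n x - f n x)) = ennreal (g' x - f' x)"
    using assms(1,2) by simp
  then have "(\<lambda>n. ennreal (g n x - f n x)) sums ennreal (g' x - f' x)"
    by (metis summable_sums summableI)
  then show ?thesis using assms(1,2) by (subst (asm) sums_ennreal) auto
qed

text \<open>Linearity is required on the nonnegative cone only, because the positive part of a
  functional is first defined there as a supremum. The constant \<open>C\<close> bounds the total
  mass of the measure to be found.\<close>

locale positive_functional =
  fixes P :: "('a::euclidean_space \<Rightarrow> real) \<Rightarrow> real" and C :: real
  assumes P_add: "f \<in> Cc_nonneg \<Longrightarrow> g \<in> Cc_nonneg \<Longrightarrow> P (\<lambda>x. f x + g x) = P f + P g"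
    and P_scale: "f \<in> Cc_nonneg \<Longrightarrow> 0 < c \<Longrightarrow> P (\<lambda>x. c * f x) = c * P f"
    and P_nonneg: "f \<in> Cc_nonneg \<Longrightarrow> 0 \<le> P f"
    and P_bound: "f \<in> Cc_nonneg \<Longrightarrow> (\<And>x. f x \<le> r) \<Longrightarrow> P f \<le> C * r"
begin

lemma P_zero: "P (\<lambda>x. 0) = 0"
  using P_add[of "\<lambda>x. 0" "\<lambda>x. 0"] by (simp add: Cc_nonnegI Cc_zero)

lemma P_sum: "(\<And>i. i \<in> I \<Longrightarrow> f i \<in> Cc_nonneg) \<Longrightarrow> P (\<lambda>x. \<Sum>i\<in>I. f i x) = (\<Sum>i\<in>I. P (f i))"
proof (induction I rule: infinite_finite_induct)
  case (insert i I)
  have "(\<lambda>x. \<Sum>i\<in>I. f i x) \<in> Cc_nonneg"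
    using insert by (intro Cc_nonnegI Cc_sum sum_nonneg) (auto dest: Cc_nonnegD)
  then show ?case using insert P_add[of "f i" "\<lambda>x. \<Sum>i\<in>I. f i x"] by auto
qed (auto simp: P_zero)

lemma C_nonneg: "0 \<le> C"
proof -
  have "0 \<le> P (cutoff 0)" by (intro P_nonneg cutoff_Cc)
  also have "\<dots> \<le> C * 1" by (intro P_bound cutoff_Cc cutoff_le_1)
  finally show ?thesis by simp
qed

text \<open>If \<open>P\<close> were integration against a measure, its product with Lebesgue
  measure would give the region exactly the mass \<open>P (g - f)\<close>. The construction starts
  from this value.\<close>

definition strip_measure :: "('a \<times> real) measure" where
  "strip_measure = extend_measure UNIV {(f, g). region_pair f g} (\<lambda>(f, g). region f g)
     (\<lambda>(f, g). ennreal (P (\<lambda>x. g x - f x)))"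

lemma diff_nonneg: "region_pair f g \<Longrightarrow> (\<lambda>x. g x - f x) \<in> Cc_nonneg"
  by (intro Cc_nonnegI Cc_diff) auto

text \<open>The substance is countable additivity: the heights of the pieces sum pointwise to
  \<open>h\<close>, Dini makes the convergence uniform, and \<open>P_bound\<close> turns uniform
  smallness of the remainder into smallness of its value under \<open>P\<close>.\<close>

lemma emeasure_region:
  assumes "region_pair f g"
  shows "emeasure strip_measure (region f g) = ennreal (P (\<lambda>x. g x - f x))"
proof (rule extend_measure_caratheodory_pair[where P = region_pair, OF strip_measure_def])
  show "region_pair f g" by fact
  show "semiring_of_sets UNIV {region f g | f g. region_pair f g}" by (rule semiring_regions)
next
  fix f g :: "'a \<Rightarrow> real" assume fg: "region_pair f g" and "region f g = {}"
  then have "region f g = region (\<lambda>x. 0) (\<lambda>x. 0)" by (auto simp: region_def)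
  then have "g x - f x = 0" for x using region_eq_imp_diff_eq[of f g "\<lambda>x. 0" "\<lambda>x. 0"] fg by auto
  then show "ennreal (P (\<lambda>x. g x - f x)) = 0" by (simp add: P_zero)
next
  fix f g f' g' :: "'a \<Rightarrow> real"
  assume "region_pair f g" "region_pair f' g'" "region f g = region f' g'"
  then have "(\<lambda>x. g x - f x) = (\<lambda>x. g' x - f' x)"
    using region_eq_imp_diff_eq[of f g f' g'] by auto
  then show "ennreal (P (\<lambda>x. g x - f x)) = ennreal (P (\<lambda>x. g' x - f' x))" by simp
next
  fix f g :: "nat \<Rightarrow> 'a \<Rightarrow> real" and f' g' :: "'a \<Rightarrow> real"
  assume fg: "\<And>n. region_pair (f n) (g n)" and fg': "region_pair f' g'"
    and disj: "disjoint_family (\<lambda>n. region (f n) (g n))" and Un: "(\<Union>n. region (f n) (g n)) = region f' g'"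
  have sums: "(\<lambda>n. g n x - f n x) sums (g' x - f' x)" for x
    using region_disjoint_union_sums[of f g f' g'] fg fg' disj Un by auto
  define s where "s n x = (\<Sum>k<n. g k x - f k x)" for n x
  have sC: "s n \<in> Cc_nonneg" for n
    unfolding s_def[abs_def] using fg by (intro Cc_nonnegI Cc_sum Cc_diff sum_nonneg) auto
  have Ps: "P (s n) = (\<Sum>k<n. P (\<lambda>x. g k x - f k x))" for n
    unfolding s_def[abs_def] using diff_nonneg[OF fg] by (intro P_sum) auto
  define h where "h x = g' x - f' x" for x
  have hC: "h \<in> Cc_nonneg" unfolding h_def[abs_def] by (rule diff_nonneg[OF fg'])
  have slim: "(\<lambda>n. s n x) \<longlonglongrightarrow> h x" for x
    using sums[of x] unfolding sums_def s_def h_def .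
  have smono: "s n x \<le> s (Suc n) x" for n x unfolding s_def using fg by simp
  have sle: "s n x \<le> h x" for n x
    by (rule incseq_le[OF incseq_SucI slim]) (rule smono)
  have hs: "(\<lambda>x. h x - s n x) \<in> Cc_nonneg" for n
    using hC sC[of n] sle by (intro Cc_nonnegI Cc_diff) (auto dest: Cc_nonnegD)
  have Ph: "P h = P (s n) + P (\<lambda>x. h x - s n x)" for n
    using P_add[OF sC[of n] hs[of n]] by simp
  have Ple: "P (s n) \<le> P (s m)" if "n \<le> m" for n m
    unfolding Ps using that P_nonneg[OF diff_nonneg[OF fg]] by (intro sum_mono2) auto
  have "(\<lambda>n. P (s n)) \<longlonglongrightarrow> P h"
  proof (rule LIMSEQ_I)
    fix r :: real assume "0 < r"
    \<comment> \<open>The summand 1 keeps the denominator positive when \<open>C = 0\<close>; the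
      choice yields \<open>C * e < r\<close>.\<close>
    define e where "e = r / (2 * (C + 1))"
    have "e > 0" unfolding e_def using C_nonneg \<open>0 < r\<close> by auto
    moreover have "C * e < (C + 1) * e * 2" using mult_nonneg_nonneg[OF C_nonneg, of e] \<open>e > 0\<close> by (simp add: algebra_simps)
    moreover have "(C + 1) * e * 2 = r" unfolding e_def using C_nonneg by (simp add: field_simps)
    ultimately have "e > 0" "C * e < r" by auto
    obtain n where n: "\<And>x. h x - s n x < e"
      using Dini_Cc[of h s e] hC sC smono slim \<open>e > 0\<close> by (auto dest: Cc_nonnegD)
    have "P (\<lambda>x. h x - s n x) \<le> C * e"
      using n by (intro P_bound hs) (auto intro: less_imp_le)
    then have "norm (P (s m) - P h) < r" if "m \<ge> n" for m
      using Ph[of m] Ph[of n] Ple[OF that] P_nonneg[OF hs[of m]] \<open>C * e < r\<close> by auto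
    then show "\<exists>no. \<forall>n\<ge>no. norm (P (s n) - P h) < r" by blast
  qed
  then have "(\<lambda>n. P (\<lambda>x. g n x - f n x)) sums P h" unfolding Ps sums_def .
  then show "(\<Sum>n. ennreal (P (\<lambda>x. g n x - f n x))) = ennreal (P (\<lambda>x. g' x - f' x))"
    using P_nonneg[OF diff_nonneg[OF fg]] P_nonneg[OF hC] unfolding h_def[abs_def]
    by (intro sums_unique[symmetric]) (subst sums_ennreal, auto)
qed auto

section \<open>Projection of the strip to the base space\<close>

lemma space_strip_measure [simp]: "space strip_measure = UNIV"
  unfolding strip_measure_def by (rule space_extend_measure) auto

lemma sets_region [measurable]: "region_pair f g \<Longrightarrow> region f g \<in> sets strip_measure"
  unfolding strip_measure_def by (subst sets_extend_measure) auto

text \<open>The strip has height one, so a product with Lebesgue measure gives the cylinder over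
  \<open>A\<close> precisely the mass of \<open>A\<close>.\<close>

definition representing_measure :: "'a measure" where
  "representing_measure = distr (restrict_space strip_measure (UNIV \<times> {0..<1})) borel fst"

text \<open>The sigma-algebra of \<open>strip_measure\<close> is generated by regions, so
  measurability of open cylinders, and with it of the projection, has to come from a countable union
  of regions.\<close>

lemma open_strip_sets:
  assumes "open U" shows "U \<times> {0..<1} \<in> sets strip_measure"
proof -
  obtain h where h: "\<And>k::nat. h k \<in> Cc_nonneg" "\<And>k x. h k x \<le> 1" "\<And>k x. x \<notin> U \<Longrightarrow> h k x = 0"
     "\<And>x. x\<in>U \<Longrightarrow> \<exists>k. h k x = 1"
    using open_exhaustion_Cc[OF assms] by metis
  have "U \<times> {0..<1} = (\<Union>k. region (\<lambda>x. 0) (h k))"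
  proof (intro set_eqI iffI)
    fix z assume "z \<in> U \<times> {0..<1::real}"
    then obtain x t where z: "z = (x, t)" "x \<in> U" "0 \<le> t" "t < 1" by auto
    then obtain k where "h k x = 1" using h(4) by blast
    then show "z \<in> (\<Union>k. region (\<lambda>x. 0) (h k))" using z unfolding region_def by (auto intro!: exI[of _ k])
  next
    fix z assume "z \<in> (\<Union>k. region (\<lambda>x. 0) (h k))"
    then obtain x t k where z: "z = (x, t)" "0 \<le> t" "t < h k x" unfolding region_def by auto
    then have "h k x \<noteq> 0" by auto
    then have "x \<in> U" using h(3) by blast
    then show "z \<in> U \<times> {0..<1}" using z less_le_trans[OF z(3) h(2)] by auto
  qed
  moreover have "region (\<lambda>x. 0) (h k) \<in> sets strip_measure" for k
    using h(1)[of k] by (intro sets_region) (auto dest: Cc_nonnegD intro: Cc_zero)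
  ultimately show ?thesis by auto
qed

lemma fst_measurable [measurable]:
  "fst \<in> measurable (restrict_space strip_measure (UNIV \<times> {0..<1})) borel"
proof (rule borel_measurableI)
  fix U :: "'a set" assume "open U"
  have "UNIV \<times> {0..<1} \<in> sets strip_measure" using open_strip_sets[of UNIV] by simp
  moreover have "fst -` U \<inter> space (restrict_space strip_measure (UNIV \<times> {0..<1})) = U \<times> {0..<1}"
    by (auto simp: space_restrict_space)
  ultimately show "fst -` U \<inter> space (restrict_space strip_measure (UNIV \<times> {0..<1}))
      \<in> sets (restrict_space strip_measure (UNIV \<times> {0..<1}))"
    using open_strip_sets[OF \<open>open U\<close>] by (auto simp: sets_restrict_space_iff)
qed

lemma sets_representing_measure [simp, measurable_cong]: "sets representing_measure = sets borel"
  unfolding representing_measure_def by simp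

lemma space_representing_measure [simp]: "space representing_measure = UNIV"
  unfolding representing_measure_def by simp

lemma emeasure_representing_measure:
  assumes "A \<in> sets borel"
  shows "emeasure representing_measure A = emeasure strip_measure (A \<times> {0..<1})"
    and "A \<times> {0..<1} \<in> sets strip_measure"
proof -
  have S: "UNIV \<times> {0..<1} \<in> sets strip_measure" using open_strip_sets[of UNIV] by simp
  have eq': "fst -` A \<inter> UNIV \<times> {0..<1} = A \<times> {0..<1::real}" by auto
  then have eq: "fst -` A \<inter> space (restrict_space strip_measure (UNIV \<times> {0..<1})) = A \<times> {0..<1}"
    by (auto simp: space_restrict_space)
  show "A \<times> {0..<1} \<in> sets strip_measure"
    using measurable_sets[OF fst_measurable assms] S unfolding eq by (simp add: sets_restrict_space_iff)
  show "emeasure representing_measure A = emeasure strip_measure (A \<times> {0..<1})"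
    unfolding representing_measure_def using assms S
    by (subst emeasure_distr) (auto simp: eq' intro!: emeasure_restrict_space)
qed

lemma emeasure_representing_UNIV: "emeasure representing_measure UNIV \<le> ennreal C"
proof -
  have pair: "region_pair (\<lambda>x. 0) (cutoff k)" for k
    using cutoff_Cc[of k] by (auto dest: Cc_nonnegD intro: Cc_zero)
  have "(UNIV :: 'a set) \<times> {0..<1} = (\<Union>k. region (\<lambda>x. 0) (cutoff k))" (is "?L = ?R")
  proof
    show "?R \<subseteq> ?L" unfolding region_def using less_le_trans[OF _ cutoff_le_1] by auto
    have "(x, t) \<in> ?R" if t: "0 \<le> t" "t < 1" for x :: 'a and t
    proof -
      obtain k where "cutoff k x = 1"
        using cutoff_eq_1 real_arch_simple[of "norm x + 1"] by blast
      then show ?thesis using t unfolding region_def by (auto intro!: exI[of _ k])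
    qed
    then show "?L \<subseteq> ?R" by auto
  qed
  then have "emeasure representing_measure UNIV = (SUP k. emeasure strip_measure (region (\<lambda>x. 0) (cutoff k)))"
    unfolding emeasure_representing_measure(1)[of UNIV, simplified]
    by (subst SUP_emeasure_incseq)
       (auto intro: sets_region[OF pair] simp: incseq_def, auto simp: region_def intro: less_le_trans cutoff_mono)
  also have "\<dots> \<le> ennreal C"
  proof (rule SUP_least)
    fix k show "emeasure strip_measure (region (\<lambda>x. 0) (cutoff k)) \<le> ennreal C"
      using P_bound[OF cutoff_Cc[of k] cutoff_le_1] C_nonneg
      by (subst emeasure_region[OF pair]) (auto intro!: ennreal_leI)
  qed
  finally show ?thesis .
qed

sublocale representing: finite_measure representing_measure
  using emeasure_representing_UNIV by (intro finite_measureI) (auto simp: top_unique)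

text \<open>Regions have mass \<open>P (g - f)\<close> and cylinders over \<open>A\<close> have the
  mass of \<open>A\<close>, both under \<open>strip_measure\<close>. Monotonicity therefore converts
  inclusions into comparisons between \<open>P\<close> and the measure.\<close>

lemma region_subset_measure:
  assumes "region_pair f g" "A \<in> sets borel"
  shows "region f g \<subseteq> A \<times> {0..<1} \<Longrightarrow> P (\<lambda>x. g x - f x) \<le> measure representing_measure A"
    and "A \<times> {0..<1} \<subseteq> region f g \<Longrightarrow> measure representing_measure A \<le> P (\<lambda>x. g x - f x)"
proof -
  have P0: "0 \<le> P (\<lambda>x. g x - f x)" using assms by (intro P_nonneg diff_nonneg)
  have eq: "ennreal (measure representing_measure A) = emeasure strip_measure (A \<times> {0..<1})"
    using representing.emeasure_eq_measure[of A] emeasure_representing_measure(1)[OF assms(2)] by simp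
  have s: "A \<times> {0..<1} \<in> sets strip_measure" using emeasure_representing_measure(2)[OF assms(2)] .
  { assume "region f g \<subseteq> A \<times> {0..<1}"
    then have "ennreal (P (\<lambda>x. g x - f x)) \<le> ennreal (measure representing_measure A)"
      unfolding eq emeasure_region[OF assms(1), symmetric] by (rule emeasure_mono) (rule s)
    then show "P (\<lambda>x. g x - f x) \<le> measure representing_measure A" by simp }
  { assume "A \<times> {0..<1} \<subseteq> region f g"
    then have "ennreal (measure representing_measure A) \<le> ennreal (P (\<lambda>x. g x - f x))"
      unfolding eq emeasure_region[OF assms(1), symmetric]
      by (rule emeasure_mono) (rule sets_region[OF assms(1)])
    then show "measure representing_measure A \<le> P (\<lambda>x. g x - f x)" using P0 by simp }
qed

lemma P_le_measure:
  assumes "f \<in> Cc_nonneg" "0 < d" "\<And>x. f x \<le> d" "A \<in> sets borel" "\<And>x. x \<notin> A \<Longrightarrow> f x = 0"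
  shows "P f \<le> d * measure representing_measure A"
proof -
  define g where "g x = (1 / d) * f x" for x
  have g: "g \<in> Cc_nonneg" unfolding g_def[abs_def] using assms(1,2)
    by (intro Cc_nonneg_scale) auto
  have "region (\<lambda>x. 0) g \<subseteq> A \<times> {0..<1}"
  proof
    fix z assume "z \<in> region (\<lambda>x. 0) g"
    then obtain x t where z: "z = (x, t)" "0 \<le> t" "t < g x" unfolding region_def by auto
    have "g x \<le> 1" unfolding g_def using assms(2,3) by simp
    moreover have "f x \<noteq> 0" using z unfolding g_def by auto
    ultimately show "z \<in> A \<times> {0..<1}" using z assms(5)[of x] by auto
  qed
  then have "P (\<lambda>x. g x - 0) \<le> measure representing_measure A"
    using g assms(4) by (intro region_subset_measure) (auto dest: Cc_nonnegD intro: Cc_zero)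
  then have "P g \<le> measure representing_measure A" by simp
  moreover have "P g = (1 / d) * P f" unfolding g_def[abs_def] using assms by (intro P_scale) auto
  ultimately show ?thesis using assms(2) by (simp add: field_simps)
qed

lemma measure_le_P:
  assumes "f \<in> Cc_nonneg" "0 < d" "A \<in> sets borel" "\<And>x. x \<in> A \<Longrightarrow> d \<le> f x"
  shows "d * measure representing_measure A \<le> P f"
proof -
  define g where "g x = (1 / d) * f x" for x
  have g: "g \<in> Cc_nonneg" unfolding g_def[abs_def] using assms(1,2)
    by (intro Cc_nonneg_scale) auto
  have "1 \<le> g x" if "x \<in> A" for x using assms(2) assms(4)[OF that] by (simp add: g_def)
  then have "A \<times> {0..<1} \<subseteq> region (\<lambda>x. 0) g"
    unfolding region_def by (auto intro: less_le_trans)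
  then have "measure representing_measure A \<le> P (\<lambda>x. g x - 0)"
    using g assms(3) by (intro region_subset_measure) (auto dest: Cc_nonnegD intro: Cc_zero)
  then have "measure representing_measure A \<le> P g" by simp
  moreover have "P g = (1 / d) * P f" unfolding g_def[abs_def] using assms by (intro P_scale) auto
  ultimately show ?thesis using assms(2) by (simp add: field_simps)
qed

section \<open>Comparison of the functional with the integral\<close>

lemma integrable_Cc: "f \<in> Cc \<Longrightarrow> integrable representing_measure f"
proof -
  assume f: "f \<in> Cc"
  then obtain B where "\<And>x. \<bar>f x\<bar> \<le> B" using Cc_bounded by blast
  moreover have "f \<in> borel_measurable borel" using Cc_continuous[OF f] by (rule borel_measurable_continuous_onI)
  ultimately show ?thesis
    by (intro representing.integrable_const_bound[of _ B])
       (auto cong: measurable_cong_sets)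
qed

lemma integral_slice_bounds:
  assumes "f \<in> Cc_nonneg" "0 < d" "\<And>x. f x \<le> d" "A \<in> sets borel" "B \<in> sets borel"
    "\<And>x. x \<notin> A \<Longrightarrow> f x = 0" "\<And>x. x \<in> B \<Longrightarrow> d \<le> f x"
  shows "integral\<^sup>L representing_measure f \<le> d * measure representing_measure A"
    and "d * measure representing_measure B \<le> integral\<^sup>L representing_measure f"
proof -
  have [measurable]: "A \<in> sets representing_measure" "B \<in> sets representing_measure" using assms by auto
  have f: "integrable representing_measure f" using assms by (auto intro: integrable_Cc dest: Cc_nonnegD)
  have i: "integrable representing_measure (\<lambda>x. d * indicator A x)" "integrable representing_measure (\<lambda>x. d * indicator B x)"
    using assms(4,5)
    by (auto simp: representing.emeasure_finite less_top[symmetric] intro!: integrable_real_indicator)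
  have "integral\<^sup>L representing_measure f \<le> (\<integral>x. d * indicator A x \<partial>representing_measure)"
    using assms by (intro integral_mono f i) (auto split: split_indicator)
  then show "integral\<^sup>L representing_measure f \<le> d * measure representing_measure A" by simp
  have "(\<integral>x. d * indicator B x \<partial>representing_measure) \<le> integral\<^sup>L representing_measure f"
    using assms by (intro integral_mono f i) (auto split: split_indicator dest: Cc_nonnegD)
  then show "d * measure representing_measure B \<le> integral\<^sup>L representing_measure f" by simp
qed

text \<open>
  Cut \<open>f\<close> into horizontal slices of height \<open>d\<close>: on each slice both functionals lie between \<open>d\<close> times the
  measures of two consecutive superlevel sets, so the errors telescope.
\<close>

lemma P_integral_dist:
  assumes f: "f \<in> Cc_nonneg" and "0 < d"
  shows "\<bar>P f - integral\<^sup>L representing_measure f\<bar> \<le> d * measure representing_measure UNIV"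
proof -
  define s where "s k x = min (f x) (real (Suc k) * d) - min (f x) (real k * d)" for k x
  define U where "U k = {x. real k * d < f x}" for k :: nat
  define a where "a k = measure representing_measure (U k)" for k
  have fc: "continuous_on UNIV f" using f by (auto dest: Cc_nonnegD Cc_continuous)
  have U: "U k \<in> sets borel" for k
    unfolding U_def using fc by (intro borel_open open_Collect_less) auto
  have kd: "real (Suc k) * d = real k * d + d" for k by (simp add: algebra_simps)
  have s: "s k \<in> Cc_nonneg" for k
  proof (rule Cc_nonnegI)
    show "s k \<in> Cc" unfolding s_def[abs_def] using f \<open>0 < d\<close>
      by (intro Cc_diff Cc_min_const) (auto dest: Cc_nonnegD)
    show "0 \<le> s k x" for x unfolding s_def kd using \<open>0 < d\<close> by linarith
  qed
  have s_le: "s k x \<le> d" for k x unfolding s_def kd using \<open>0 < d\<close> by (auto simp: min_def)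
  have s_out: "s k x = 0" if "x \<notin> U k" for k x
    using that \<open>0 < d\<close> unfolding s_def kd U_def by (auto simp: min_def)
  have s_in: "d \<le> s k x" if "x \<in> U (Suc k)" for k x
    using that \<open>0 < d\<close> unfolding s_def U_def kd by (auto simp: min_def)
  have slice: "\<bar>P (s k) - integral\<^sup>L representing_measure (s k)\<bar> \<le> d * a k - d * a (Suc k)" for k
    using P_le_measure[OF s \<open>0 < d\<close> s_le U s_out] measure_le_P[OF s \<open>0 < d\<close> U s_in]
      integral_slice_bounds[OF s \<open>0 < d\<close> s_le U U s_out s_in]
    unfolding a_def by (smt (verit))
  obtain B where B: "\<And>x. \<bar>f x\<bar> \<le> B" using Cc_bounded[OF Cc_nonnegD(1)[OF f]] by blast
  obtain m :: nat where m: "B / d < m" using reals_Archimedean2 by blast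
  then have "B \<le> m * d" using \<open>0 < d\<close> by (simp add: field_simps)
  then have fm: "f x \<le> m * d" for x using B[of x] by linarith
  have "(\<Sum>k<n. s k x) = min (f x) (real n * d)" for n x
    using Cc_nonnegD(2)[OF f, of x] unfolding s_def by (subst sum_lessThan_telescope) (simp add: min_def)
  then have fsum: "f = (\<lambda>x. \<Sum>k<m. s k x)" using fm by (auto simp: min_def)
  have "P f = (\<Sum>k<m. P (s k))" by (subst fsum) (rule P_sum[OF s])
  moreover have "integral\<^sup>L representing_measure f = (\<Sum>k<m. integral\<^sup>L representing_measure (s k))"
    by (subst fsum) (intro Bochner_Integration.integral_sum integrable_Cc Cc_nonnegD(1)[OF s])
  ultimately have "\<bar>P f - integral\<^sup>L representing_measure f\<bar>
      = \<bar>\<Sum>k<m. P (s k) - integral\<^sup>L representing_measure (s k)\<bar>"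
    by (simp add: sum_subtractf)
  also have "\<dots> \<le> (\<Sum>k<m. d * a k - d * a (Suc k))"
    by (rule order_trans[OF sum_abs sum_mono]) (rule slice)
  also have "\<dots> = d * a 0 - d * a m" by (rule sum_lessThan_telescope')
  also have "\<dots> \<le> d * a 0" using \<open>0 < d\<close> unfolding a_def by simp
  also have "\<dots> \<le> d * measure representing_measure UNIV"
    unfolding a_def using \<open>0 < d\<close> by (intro mult_left_mono representing.finite_measure_mono) auto
  finally show ?thesis .
qed

text \<open>The total mass is finite, so the slicing error \<open>d\<close> times the total mass
  vanishes as the slices get thinner.\<close>

theorem P_eq_integral:
  assumes "f \<in> Cc_nonneg"
  shows "P f = integral\<^sup>L representing_measure f"
proof -
  define b where "b = measure representing_measure UNIV"
  have "\<bar>P f - integral\<^sup>L representing_measure f\<bar> \<le> e" if "0 < e" for e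
  proof -
    have "\<bar>P f - integral\<^sup>L representing_measure f\<bar> \<le> e / (b + 1) * b"
      using P_integral_dist[OF assms, of "e / (b + 1)"] that unfolding b_def
      by (auto simp: divide_pos_pos add_nonneg_pos)
    also have "\<dots> \<le> e"
      using that measure_nonneg[of representing_measure UNIV] unfolding b_def[symmetric]
      by (simp add: field_simps)
    finally show ?thesis .
  qed
  then have "\<bar>P f - integral\<^sup>L representing_measure f\<bar> \<le> 0" by (rule field_le_epsilon) simp
  then show ?thesis by simp
qed

end

section \<open>Riesz representation of bounded functionals\<close>

locale bounded_functional =
  fixes E :: "('a::euclidean_space \<Rightarrow> real) \<Rightarrow> real" and C :: real
  assumes E_add: "f \<in> Cc \<Longrightarrow> g \<in> Cc \<Longrightarrow> E (\<lambda>x. f x + g x) = E f + E g"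
    and E_scale: "f \<in> Cc \<Longrightarrow> E (\<lambda>x. c * f x) = c * E f"
    and E_bound: "f \<in> Cc \<Longrightarrow> (\<And>x. \<bar>f x\<bar> \<le> r) \<Longrightarrow> \<bar>E f\<bar> \<le> C * r"
begin

lemma E_zero: "E (\<lambda>x. 0) = 0"
  using E_scale[of "\<lambda>x. 0" 0] by (simp add: Cc_zero)

lemma E_diff: "f \<in> Cc \<Longrightarrow> g \<in> Cc \<Longrightarrow> E (\<lambda>x. f x - g x) = E f - E g"
  using E_add[of f "\<lambda>x. -1 * g x"] E_scale[of g "-1"] Cc_scale[of g "-1"] by simp

definition minorants :: "('a \<Rightarrow> real) \<Rightarrow> ('a \<Rightarrow> real) set" where
  "minorants f = {g \<in> Cc_nonneg. \<forall>x. g x \<le> f x}"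

text \<open>The Riesz formula for the positive part of a functional on a vector lattice.\<close>

definition pos :: "('a \<Rightarrow> real) \<Rightarrow> real" where
  "pos f = (SUP g\<in>minorants f. E g)"

lemma minorant_bound:
  assumes "g \<in> minorants f" "\<And>x. f x \<le> r"
  shows "E g \<le> C * r"
proof -
  have "\<bar>g x\<bar> \<le> r" for x
    using assms(1) assms(2)[of x] unfolding minorants_def Cc_nonneg_def by (auto intro: order_trans)
  then show ?thesis
    using E_bound[of g r] assms(1) unfolding minorants_def by (auto dest: Cc_nonnegD)
qed

lemma zero_minorant: "f \<in> Cc_nonneg \<Longrightarrow> (\<lambda>x. 0) \<in> minorants f"
  unfolding minorants_def by (auto intro: Cc_nonnegI Cc_zero dest: Cc_nonnegD)

lemma pos_upper: "f \<in> Cc_nonneg \<Longrightarrow> g \<in> minorants f \<Longrightarrow> E g \<le> pos f"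
proof -
  assume f: "f \<in> Cc_nonneg" and g: "g \<in> minorants f"
  obtain B where B: "\<And>x. \<bar>f x\<bar> \<le> B" using Cc_bounded[OF Cc_nonnegD(1)[OF f]] by blast
  then have "f x \<le> B" for x using abs_le_D1 by blast
  then have "bdd_above (E ` minorants f)"
    by (intro bdd_aboveI[of _ "C * B"]) (auto intro: minorant_bound)
  then show ?thesis unfolding pos_def using g by (rule cSUP_upper2) simp
qed

lemma pos_least: "f \<in> Cc_nonneg \<Longrightarrow> (\<And>g. g \<in> minorants f \<Longrightarrow> E g \<le> b) \<Longrightarrow> pos f \<le> b"
  unfolding pos_def using zero_minorant by (intro cSUP_least) auto

text \<open>Superadditivity comes from adding minorants. Subadditivity is the Riesz decomposition
  property: a minorant \<open>g\<close> of \<open>f + f'\<close> splits into \<open>min g f\<close>,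
  a minorant of \<open>f\<close>, and the rest, which is a minorant of \<open>f'\<close>.\<close>

lemma pos_add:
  assumes f: "f \<in> Cc_nonneg" and f': "f' \<in> Cc_nonneg"
  shows "pos (\<lambda>x. f x + f' x) = pos f + pos f'"
proof (rule antisym)
  have ff: "(\<lambda>x. f x + f' x) \<in> Cc_nonneg"
    using f f' by (auto simp: Cc_nonneg_def intro: Cc_add)
  show "pos (\<lambda>x. f x + f' x) \<le> pos f + pos f'"
  proof (rule pos_least[OF ff])
    fix g assume "g \<in> minorants (\<lambda>x. f x + f' x)"
    then have g: "g \<in> Cc" "\<And>x. 0 \<le> g x" "\<And>x. g x \<le> f x + f' x"
      unfolding minorants_def by (auto dest: Cc_nonnegD)
    define h where "h x = min (g x) (f x)" for x
    define k where "k x = g x - h x" for x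
    have h: "h \<in> Cc" unfolding h_def[abs_def] using g f by (intro Cc_min) (auto dest: Cc_nonnegD)
    have k: "k \<in> Cc" unfolding k_def[abs_def] using g h by (intro Cc_diff)
    have "0 \<le> h x" "h x \<le> f x" "0 \<le> k x" "k x \<le> f' x" for x
      using g(2,3)[of x] Cc_nonnegD(2)[OF f, of x] Cc_nonnegD(2)[OF f', of x]
      unfolding h_def k_def by auto
    then have "h \<in> minorants f" "k \<in> minorants f'"
      unfolding minorants_def using h k by (auto intro: Cc_nonnegI)
    moreover have "E g = E h + E k" using E_add[OF h k] by (simp add: k_def)
    ultimately show "E g \<le> pos f + pos f'" using pos_upper[OF f] pos_upper[OF f'] by (smt (verit))
  qed
  have "E h \<le> pos (\<lambda>x. f x + f' x) - E k" if "h \<in> minorants f" "k \<in> minorants f'" for h k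
  proof -
    have "(\<lambda>x. h x + k x) \<in> minorants (\<lambda>x. f x + f' x)"
      using that unfolding minorants_def by (auto intro!: Cc_add add_mono simp: Cc_nonneg_def)
    then have "E (\<lambda>x. h x + k x) \<le> pos (\<lambda>x. f x + f' x)" by (rule pos_upper[OF ff])
    moreover have "E (\<lambda>x. h x + k x) = E h + E k"
      using that unfolding minorants_def by (intro E_add) (auto dest: Cc_nonnegD)
    ultimately show ?thesis by simp
  qed
  then have "pos f \<le> pos (\<lambda>x. f x + f' x) - E k" if "k \<in> minorants f'" for k
    using that by (intro pos_least[OF f])
  then have "E k \<le> pos (\<lambda>x. f x + f' x) - pos f" if "k \<in> minorants f'" for k
    using that by (simp add: algebra_simps)
  then have "pos f' \<le> pos (\<lambda>x. f x + f' x) - pos f" by (intro pos_least[OF f'])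
  then show "pos f + pos f' \<le> pos (\<lambda>x. f x + f' x)" by simp
qed

lemma pos_scale:
  assumes f: "f \<in> Cc_nonneg" and c: "0 < c"
  shows "pos (\<lambda>x. c * f x) = c * pos f"
proof -
  \<comment> \<open>Proved for all \<open>c\<close> and \<open>f\<close>, so that the reverse
    inequality follows by applying it to \<open>1 / c\<close> and \<open>c * f\<close>.\<close>
  have le: "c * pos f \<le> pos (\<lambda>x. c * f x)" if f: "f \<in> Cc_nonneg" and c: "0 < c" for c f
  proof -
    have "E g \<le> pos (\<lambda>x. c * f x) / c" if "g \<in> minorants f" for g
    proof -
      have "(\<lambda>x. c * g x) \<in> minorants (\<lambda>x. c * f x)"
        using that c unfolding minorants_def by (auto intro!: Cc_nonneg_scale mult_left_mono)
      then have "E (\<lambda>x. c * g x) \<le> pos (\<lambda>x. c * f x)"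
        using f c by (intro pos_upper Cc_nonneg_scale) auto
      moreover have "E (\<lambda>x. c * g x) = c * E g"
        using that unfolding minorants_def by (intro E_scale) (auto dest: Cc_nonnegD)
      ultimately show ?thesis using c by (simp add: field_simps)
    qed
    then have "pos f \<le> pos (\<lambda>x. c * f x) / c" by (intro pos_least[OF f])
    then show ?thesis using c by (simp add: field_simps)
  qed
  have "(1 / c) * pos (\<lambda>x. c * f x) \<le> pos (\<lambda>x. (1 / c) * (c * f x))"
    using f c by (intro le Cc_nonneg_scale) auto
  also have "(\<lambda>x. (1 / c) * (c * f x)) = f" using c by auto
  finally show ?thesis using le[OF f c] c by (simp add: field_simps)
qed

sublocale pos: positive_functional pos C
proof
  show "0 \<le> pos f" if "f \<in> Cc_nonneg" for f
    using pos_upper[OF that zero_minorant[OF that]] E_zero by simp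
  show "pos f \<le> C * r" if "f \<in> Cc_nonneg" "\<And>x. f x \<le> r" for f r
    using that by (intro pos_least minorant_bound) auto
qed (fact pos_add pos_scale)+

text \<open>Positivity holds because \<open>f\<close> is one of its own minorants. The constant
  doubles since \<open>pos f\<close> and \<open>E f\<close> each contribute
  \<open>C\<close>.\<close>

sublocale neg: positive_functional "\<lambda>f. pos f - E f" "2 * C"
proof
  show "pos (\<lambda>x. f x + g x) - E (\<lambda>x. f x + g x) = (pos f - E f) + (pos g - E g)"
    if "f \<in> Cc_nonneg" "g \<in> Cc_nonneg" for f g
    using pos_add[OF that] E_add[of f g] that by (auto simp: Cc_nonneg_def)
  show "pos (\<lambda>x. c * f x) - E (\<lambda>x. c * f x) = c * (pos f - E f)" if "f \<in> Cc_nonneg" "0 < c" for f c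
    using pos_scale[OF that] E_scale[of f c] that by (auto dest: Cc_nonnegD simp: algebra_simps)
  show "0 \<le> pos f - E f" if "f \<in> Cc_nonneg" for f
    using pos_upper[OF that, of f] that unfolding minorants_def by simp
  show "pos f - E f \<le> 2 * C * r" if f: "f \<in> Cc_nonneg" and r: "\<And>x. f x \<le> r" for f r
  proof -
    have "\<bar>E f\<bar> \<le> C * r" using f r by (intro E_bound) (auto simp: Cc_nonneg_def)
    then show ?thesis using pos.P_bound[OF f r] by linarith
  qed
qed

theorem representation:
  "\<exists>M N. finite_measure M \<and> finite_measure N \<and> sets M = sets borel \<and> sets N = sets borel \<and>
     (\<forall>f\<in>Cc. E f = integral\<^sup>L M f - integral\<^sup>L N f)"
proof (intro exI conjI ballI)
  show "finite_measure pos.representing_measure" "finite_measure neg.representing_measure"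
    by unfold_locales
  show "sets pos.representing_measure = sets borel" "sets neg.representing_measure = sets borel"
    by simp_all
  fix f :: "'a \<Rightarrow> real" assume f: "f \<in> Cc"
  define g where "g x = max (f x) 0" for x
  define h where "h x = max (- 1 * f x) 0" for x
  have gh: "g \<in> Cc_nonneg" "h \<in> Cc_nonneg"
    unfolding g_def[abs_def] h_def[abs_def] using f
    by (auto intro!: Cc_nonnegI Cc_max Cc_zero Cc_scale[of f "-1", simplified])
  have fgh: "f = (\<lambda>x. g x - h x)" unfolding g_def h_def by auto
  have *: "E k = integral\<^sup>L pos.representing_measure k - integral\<^sup>L neg.representing_measure k"
    if "k \<in> Cc_nonneg" for k
    using pos.P_eq_integral[OF that] neg.P_eq_integral[OF that] by simp
  have gh': "g \<in> Cc" "h \<in> Cc" using gh by (auto dest: Cc_nonnegD)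
  show "E f = integral\<^sup>L pos.representing_measure f - integral\<^sup>L neg.representing_measure f"
    unfolding fgh E_diff[OF gh'] *[OF gh(1)] *[OF gh(2)]
    by (simp add: Bochner_Integration.integral_diff pos.integrable_Cc neg.integrable_Cc gh')
qed

end

text \<open>
  The extension of \<open>L\<close> from a dense subspace is characterised by \<open>\<bar>E f - L g\<bar> \<le> C * r\<close> whenever
  \<open>g \<in> D\<close> is uniformly within \<open>r\<close> of \<open>f\<close>; such a value exists because these intervals intersect pairwise.
\<close>

theorem riesz_representation_dense:
  fixes L :: "('a::euclidean_space \<Rightarrow> real) \<Rightarrow> real"
  assumes D: "D \<subseteq> Cc"
    and D_add: "\<And>f g. f \<in> D \<Longrightarrow> g \<in> D \<Longrightarrow> (\<lambda>x. f x + g x) \<in> D"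
    and D_scale: "\<And>f c. f \<in> D \<Longrightarrow> (\<lambda>x. c * f x) \<in> D"
    and L_add: "\<And>f g. f \<in> D \<Longrightarrow> g \<in> D \<Longrightarrow> L (\<lambda>x. f x + g x) = L f + L g"
    and L_scale: "\<And>f c. f \<in> D \<Longrightarrow> L (\<lambda>x. c * f x) = c * L f"
    and L_bound: "\<And>f r. f \<in> D \<Longrightarrow> (\<And>x. \<bar>f x\<bar> \<le> r) \<Longrightarrow> \<bar>L f\<bar> \<le> C * r"
    and dense: "\<And>f e. f \<in> Cc \<Longrightarrow> 0 < e \<Longrightarrow> \<exists>g\<in>D. \<forall>x. \<bar>f x - g x\<bar> \<le> e"
    and "0 \<le> C"
  shows "\<exists>M N. finite_measure M \<and> finite_measure N \<and> sets M = sets borel \<and> sets N = sets borel \<and>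
     (\<forall>f\<in>D. L f = integral\<^sup>L M f - integral\<^sup>L N f)"
proof -
  define Q where "Q f = {(g, r). g \<in> D \<and> (\<forall>x. \<bar>f x - g x\<bar> \<le> r)}" for f :: "'a \<Rightarrow> real"
  \<comment> \<open>The supremum of the lower ends of the intervals of radius \<open>C * r\<close>
    about \<open>L g\<close>.\<close>
  define E where "E f = (SUP (g, r)\<in>Q f. L g - C * r)" for f
  have L_diff: "L (\<lambda>x. f x - g x) = L f - L g" "(\<lambda>x. f x - g x) \<in> D" if "f \<in> D" "g \<in> D" for f g
    using L_add[OF that(1) D_scale[OF that(2)], of "-1"] L_scale[OF that(2), of "-1"]
      D_add[OF that(1) D_scale[OF that(2)], of "-1"] by auto
  have cross: "L g - C * r \<le> L g' + C * r'" if "(g, r) \<in> Q f" "(g', r') \<in> Q f" for f g g' r r'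
  proof -
    have "\<bar>g x - g' x\<bar> \<le> r + r'" for x
    proof -
      have "\<bar>f x - g x\<bar> \<le> r" "\<bar>f x - g' x\<bar> \<le> r'" using that unfolding Q_def by auto
      then show ?thesis by linarith
    qed
    then have "\<bar>L g - L g'\<bar> \<le> C * (r + r')"
      using L_bound[of "\<lambda>x. g x - g' x" "r + r'"] L_diff[of g g'] that unfolding Q_def by auto
    then show ?thesis by (simp add: algebra_simps)
  qed
  have E: "\<bar>E f - L g\<bar> \<le> C * r" if "(g, r) \<in> Q f" for f g r
  proof -
    have "bdd_above ((\<lambda>(g, r). L g - C * r) ` Q f)"
      using cross[OF _ that] by (intro bdd_aboveI[of _ "L g + C * r"]) auto
    then have "L g - C * r \<le> E f" unfolding E_def using that by (intro cSUP_upper2[of _ _ "(g, r)"]) auto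
    moreover have "E f \<le> L g + C * r"
      unfolding E_def using that cross[OF _ that] by (intro cSUP_least) auto
    ultimately show ?thesis by linarith
  qed
  have near: "\<exists>g. (g, e) \<in> Q f" if "f \<in> Cc" "0 < e" for f e
    using dense[OF that] unfolding Q_def by auto
  have zeroI: "a = 0" if "\<And>e. 0 < e \<Longrightarrow> \<bar>a\<bar> \<le> C * (k * e)" for a k :: real
  proof -
    have "\<bar>a\<bar> \<le> e" if "0 < e" for e
    proof -
      have "\<bar>a\<bar> \<le> C * (k * (e / (\<bar>C * k\<bar> + 1)))" using that by (intro \<open>\<And>e. 0 < e \<Longrightarrow> \<bar>a\<bar> \<le> C * (k * e)\<close>) (auto intro: divide_pos_pos)
      also have "\<dots> = e * ((C * k) / (\<bar>C * k\<bar> + 1))" by simp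
      also have "\<dots> \<le> e * 1" using that by (intro mult_left_mono) (auto simp: divide_le_eq)
      finally show ?thesis by simp
    qed
    then have "\<bar>a\<bar> \<le> 0" by (rule field_le_epsilon) simp
    then show ?thesis by simp
  qed
  interpret bounded_functional E C
  proof
    fix f g :: "'a \<Rightarrow> real" assume fg: "f \<in> Cc" "g \<in> Cc"
    \<comment> \<open>The 4 counts errors: \<open>2 * e\<close> for the approximant of the sum and
      \<open>e\<close> for each summand.\<close>
    have "\<bar>E (\<lambda>x. f x + g x) - (E f + E g)\<bar> \<le> C * (4 * e)" if "0 < e" for e
    proof -
      obtain f' g' where *: "(f', e) \<in> Q f" "(g', e) \<in> Q g"
        using near[OF fg(1) \<open>0 < e\<close>] near[OF fg(2) \<open>0 < e\<close>] by blast
      then have D': "f' \<in> D" "g' \<in> D" unfolding Q_def by auto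
      have "((\<lambda>x. f' x + g' x), e + e) \<in> Q (\<lambda>x. f x + g x)"
      proof -
        have "\<bar>f x + g x - (f' x + g' x)\<bar> \<le> e + e" for x
        proof -
          have "\<bar>f x - f' x\<bar> \<le> e" "\<bar>g x - g' x\<bar> \<le> e" using * unfolding Q_def by auto
          then show ?thesis by linarith
        qed
        then show ?thesis using D_add[OF D'] unfolding Q_def by auto
      qed
      from E[OF this] E[OF *(1)] E[OF *(2)] L_add[OF D'] show ?thesis
        by (simp add: algebra_simps)
    qed
    then show "E (\<lambda>x. f x + g x) = E f + E g" using zeroI[of _ 4] by (metis eq_iff_diff_eq_0)
  next
    fix f :: "'a \<Rightarrow> real" and c :: real assume f: "f \<in> Cc"
    have "\<bar>E (\<lambda>x. c * f x) - c * E f\<bar> \<le> C * ((2 * \<bar>c\<bar>) * e)" if "0 < e" for e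
    proof -
      obtain f' where *: "(f', e) \<in> Q f" using near[OF f \<open>0 < e\<close>] by blast
      then have D': "f' \<in> D" unfolding Q_def by auto
      have "((\<lambda>x. c * f' x), \<bar>c\<bar> * e) \<in> Q (\<lambda>x. c * f x)"
        using * D_scale[OF D'] unfolding Q_def
        by (auto simp: abs_mult right_diff_distrib[symmetric] intro!: mult_left_mono)
      from E[OF this] L_scale[OF D'] have "\<bar>E (\<lambda>x. c * f x) - c * L f'\<bar> \<le> C * (\<bar>c\<bar> * e)" by simp
      moreover have "\<bar>c * E f - c * L f'\<bar> \<le> \<bar>c\<bar> * (C * e)"
        unfolding right_diff_distrib[symmetric] abs_mult by (intro mult_left_mono E[OF *]) auto
      ultimately show ?thesis by (simp add: algebra_simps)
    qed
    then show "E (\<lambda>x. c * f x) = c * E f" using zeroI[of _ "2 * \<bar>c\<bar>"] by (metis eq_iff_diff_eq_0)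
  next
    fix f :: "'a \<Rightarrow> real" and r assume f: "f \<in> Cc" "\<And>x. \<bar>f x\<bar> \<le> r"
    obtain g where "g \<in> D" using dense[OF Cc_zero, of 1] by auto
    then have 0: "(\<lambda>x. 0) \<in> D" using D_scale[of g 0] by simp
    then have "((\<lambda>x. 0), r) \<in> Q f" using f unfolding Q_def by auto
    from E[OF this] L_scale[OF 0, of 0] show "\<bar>E f\<bar> \<le> C * r" by simp
  qed
  \<comment> \<open>A member of \<open>D\<close> approximates itself with error 0, which forces the
    extension to agree with \<open>L\<close>.\<close>
  have "E f = L f" if "f \<in> D" for f
    using E[of f 0 f] that unfolding Q_def by auto
  then show ?thesis using representation D by (metis subsetD)
qed


section \<open>Smooth functions\<close>

text \<open>Unlike the total function \<open>partial\<close>, this relation asserts that the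
  derivative exists, so the differentiation rules can be stated for it.\<close>

definition has_partial :: "4 \<Rightarrow> (mink \<Rightarrow> complex) \<Rightarrow> complex \<Rightarrow> mink \<Rightarrow> bool" where
  "has_partial i f d p \<longleftrightarrow> ((\<lambda>t. f (p + t *\<^sub>R axis i 1)) has_vector_derivative d) (at 0)"

lemma has_partial_imp_partial: "has_partial i f d p \<Longrightarrow> partial i f p = d"
  unfolding has_partial_def partial_def by (rule vector_derivative_at)

lemma has_partial_add: "has_partial i f d p \<Longrightarrow> has_partial i g e p \<Longrightarrow> has_partial i (\<lambda>p. f p + g p) (d + e) p"
  unfolding has_partial_def by (rule has_vector_derivative_add)

lemma has_partial_mult:
  "has_partial i f d p \<Longrightarrow> has_partial i g e p \<Longrightarrow> has_partial i (\<lambda>p. f p * g p) (d * g p + f p * e) p"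
  unfolding has_partial_def
  using has_vector_derivative_mult[of "\<lambda>t. f (p + t *\<^sub>R axis i 1)" d 0 UNIV "\<lambda>t. g (p + t *\<^sub>R axis i 1)" e]
  by (simp add: add.commute)

lemma has_partial_const: "has_partial i (\<lambda>p. c) 0 p"
  unfolding has_partial_def by simp

lemma has_partial_coord: "has_partial i (\<lambda>p. of_real (p $ j)) (if i = j then 1 else 0) p"
proof -
  have "((\<lambda>t. of_real (p $ j + t * (if i = j then 1 else 0))) has_vector_derivative
      (of_real (if i = j then 1 else 0) :: complex)) (at 0)"
    by (intro has_vector_derivative_of_real) (auto intro!: derivative_eq_intros)
  moreover have "(p + t *\<^sub>R axis i 1) $ j = p $ j + t * (if i = j then 1 else 0)" for t
    by (simp add: axis_def)
  ultimately show ?thesis unfolding has_partial_def by (simp only: if_distrib[of of_real] of_real_1 of_real_0)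
qed

lemma smooth_continuous: "smooth f \<Longrightarrow> continuous_on UNIV f"
  unfolding smooth_def by (metis foldr_Nil id_apply)

lemma smooth_has_partial: "smooth f \<Longrightarrow> has_partial i f (partial i f p) p"
proof -
  assume "smooth f"
  then have "(\<lambda>t::real. foldr partial [] f (p + t *\<^sub>R axis i 1)) differentiable (at 0)"
    unfolding smooth_def by blast
  then show ?thesis unfolding has_partial_def partial_def by (simp add: vector_derivative_works)
qed

lemma smooth_partial: "smooth f \<Longrightarrow> smooth (partial i f)"
proof -
  assume f: "smooth f"
  have "foldr partial is (partial i f) = foldr partial (is @ [i]) f" for "is" by simp
  then show ?thesis using f unfolding smooth_def by metis
qed

lemma smooth_foldr_partial: "smooth f \<Longrightarrow> smooth (foldr partial is f)"
  by (induction "is") (auto intro: smooth_partial)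

text \<open>Smoothness is the largest property that implies continuity and is preserved by partial
  derivatives. Hence an invariant family of continuous functions suffices, and no formula for
  iterated derivatives has to be found.\<close>

lemma smooth_coinduct:
  assumes "f \<in> S" and "\<And>g. g \<in> S \<Longrightarrow> continuous_on UNIV g"
    and step: "\<And>g i. g \<in> S \<Longrightarrow> \<exists>g'\<in>S. \<forall>p. has_partial i g (g' p) p"
  shows "smooth f"
proof -
  have S: "foldr partial is f \<in> S" for "is"
  proof (induction "is")
    case (Cons i "is")
    obtain g' where "g' \<in> S" "\<And>p. has_partial i (foldr partial is f) (g' p) p"
      using step[OF Cons] by blast
    then have "foldr partial (i # is) f = g'"
      by (simp add: fun_eq_iff has_partial_imp_partial)
    then show ?case using \<open>g' \<in> S\<close> by simp
  qed (use assms in simp)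
  show ?thesis unfolding smooth_def
  proof (intro allI conjI)
    show "continuous_on UNIV (foldr partial is f)" for "is" using S assms(2) by blast
    show "(\<lambda>t::real. foldr partial is f (p + t *\<^sub>R axis i 1)) differentiable (at 0)" for "is" i p
      using step[OF S, of i "is"] unfolding has_partial_def
      by (metis differentiableI_vector)
  qed
qed

section \<open>Closure properties of smooth functions\<close>

lemma smooth_add: "smooth f \<Longrightarrow> smooth g \<Longrightarrow> smooth (\<lambda>p. f p + g p)"
proof (rule smooth_coinduct[where S = "{\<lambda>p. f p + g p | f g. smooth f \<and> smooth g}"])
  fix h i assume "h \<in> {\<lambda>p. f p + g p | f g. smooth f \<and> smooth g}"
  then obtain f g where h: "h = (\<lambda>p. f p + g p)" "smooth f" "smooth g" by auto
  show "\<exists>h'\<in>{\<lambda>p. f p + g p | f g. smooth f \<and> smooth g}. \<forall>p. has_partial i h (h' p) p"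
    using h has_partial_add[OF smooth_has_partial smooth_has_partial, of f g i]
    by (intro bexI[of _ "\<lambda>p. partial i f p + partial i g p"]) (auto intro: smooth_partial)
qed (auto intro: continuous_on_add smooth_continuous)

lemma smooth_const: "smooth (\<lambda>p. c)"
  by (rule smooth_coinduct[where S = "range (\<lambda>c p. c)"]) (auto intro: has_partial_const)

lemma smooth_coord: "smooth (\<lambda>p. of_real (p $ j))"
proof (rule smooth_coinduct[where S = "insert (\<lambda>p. of_real (p $ j)) (Collect smooth)"])
  fix h :: "mink \<Rightarrow> complex" and i
  assume "h \<in> insert (\<lambda>p. of_real (p $ j)) (Collect smooth)"
  then show "\<exists>h'\<in>insert (\<lambda>p. of_real (p $ j)) (Collect smooth). \<forall>p. has_partial i h (h' p) p"
  proof
    assume "h = (\<lambda>p. of_real (p $ j))"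
    then show ?thesis using has_partial_coord[of i j] smooth_const
      by (intro bexI[of _ "\<lambda>p. if i = j then 1 else 0"]) simp_all
  next
    assume "h \<in> Collect smooth"
    then show ?thesis using smooth_partial smooth_has_partial by blast
  qed
qed (auto intro: smooth_continuous intro!: continuous_intros)

text \<open>The product and chain rules turn one product into a sum of products. Closing under such
  sums yields the invariant family for the coinduction.\<close>

inductive_set sum_products :: "(mink \<Rightarrow> complex) set \<Rightarrow> (mink \<Rightarrow> complex) set" for H where
  prod: "h \<in> H \<Longrightarrow> smooth g \<Longrightarrow> k = (\<lambda>p. h p * g p) \<Longrightarrow> k \<in> sum_products H"
| add: "f \<in> sum_products H \<Longrightarrow> g \<in> sum_products H \<Longrightarrow> k = (\<lambda>p. f p + g p) \<Longrightarrow> k \<in> sum_products H"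

text \<open>Differentiation is additive, so invariance needs checking only on a single
  product.\<close>

lemma smooth_sum_products:
  assumes cont: "\<And>h. h \<in> H \<Longrightarrow> continuous_on UNIV h"
    and step: "\<And>h g i. h \<in> H \<Longrightarrow> smooth g \<Longrightarrow>
       \<exists>f\<in>sum_products H. \<forall>p. has_partial i (\<lambda>p. h p * g p) (f p) p"
    and "f \<in> sum_products H"
  shows "smooth f"
proof (rule smooth_coinduct[where S = "sum_products H"])
  fix g i assume "g \<in> sum_products H"
  then show "\<exists>g'\<in>sum_products H. \<forall>p. has_partial i g (g' p) p"
  proof induction
    case (prod h g k)
    then show ?case using step by simp
  next
    case (add f g k)
    obtain f' where f': "f' \<in> sum_products H" "\<forall>p. has_partial i f (f' p) p" using add.IH(1) ..
    obtain g' where g': "g' \<in> sum_products H" "\<forall>p. has_partial i g (g' p) p" using add.IH(2) ..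
    have "\<forall>p. has_partial i k (f' p + g' p) p"
      unfolding add.hyps(3) using f'(2) g'(2) has_partial_add by simp
    then show ?case using sum_products.add[OF f'(1) g'(1) refl] by (rule bexI)
  qed
next
  fix g assume "g \<in> sum_products H"
  then show "continuous_on UNIV g"
    by induction (auto intro: continuous_on_mult continuous_on_add cont smooth_continuous)
qed fact

lemma smooth_mult: "smooth f \<Longrightarrow> smooth g \<Longrightarrow> smooth (\<lambda>p. f p * g p)"
proof (rule smooth_sum_products[where H = "Collect smooth"])
  fix h g i assume hg: "h \<in> Collect smooth" "smooth g"
  then show "\<exists>f\<in>sum_products (Collect smooth). \<forall>p. has_partial i (\<lambda>p. h p * g p) (f p) p"
    by (intro bexI[of _ "\<lambda>p. partial i h p * g p + h p * partial i g p"])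
       (auto intro: has_partial_mult smooth_has_partial smooth_partial
         intro!: sum_products.add[OF sum_products.prod[of "partial i h" _ g] sum_products.prod[of h _ "partial i g"]])
qed (auto intro: smooth_continuous sum_products.prod)

lemma smooth_sum: "(\<And>i. i \<in> I \<Longrightarrow> smooth (f i)) \<Longrightarrow> smooth (\<lambda>p. \<Sum>i\<in>I. f i p)"
  by (induction I rule: infinite_finite_induct) (auto intro: smooth_const smooth_add)

section \<open>Rules for first and iterated partial derivatives\<close>

lemma partial_add: "smooth f \<Longrightarrow> smooth g \<Longrightarrow> partial i (\<lambda>p. f p + g p) = (\<lambda>p. partial i f p + partial i g p)"
  by (rule ext) (intro has_partial_imp_partial has_partial_add smooth_has_partial)

lemma partial_mult:
  "smooth f \<Longrightarrow> smooth g \<Longrightarrow> partial i (\<lambda>p. f p * g p) = (\<lambda>p. partial i f p * g p + f p * partial i g p)"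
  by (rule ext) (intro has_partial_imp_partial has_partial_mult smooth_has_partial)

lemma partial_const: "partial i (\<lambda>p. c) = (\<lambda>p. 0)"
  by (rule ext) (intro has_partial_imp_partial has_partial_const)

lemma partial_cmult: "smooth f \<Longrightarrow> partial i (\<lambda>p. c * f p) = (\<lambda>p. c * partial i f p)"
  by (simp add: partial_mult[OF smooth_const] partial_const)

lemma foldr_partial_add:
  "smooth f \<Longrightarrow> smooth g \<Longrightarrow>
   foldr partial is (\<lambda>p. f p + g p) = (\<lambda>p. foldr partial is f p + foldr partial is g p)"
  by (induction "is") (auto simp: partial_add smooth_foldr_partial)

lemma foldr_partial_cmult:
  "smooth f \<Longrightarrow> foldr partial is (\<lambda>p. c * f p) = (\<lambda>p. c * foldr partial is f p)"
  by (induction "is") (auto simp: partial_cmult smooth_foldr_partial)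

lemma foldr_partial_const: "is \<noteq> [] \<Longrightarrow> foldr partial is (\<lambda>p. c) = (\<lambda>p. 0)"
proof (induction "is")
  case (Cons i "is")
  then show ?case by (cases "is = []") (auto simp: partial_const)
qed simp

lemma has_partial_dilate:
  assumes "smooth f"
  shows "has_partial i (\<lambda>p. f (c *\<^sub>R p)) (of_real c * partial i f (c *\<^sub>R p)) p"
proof -
  have "((\<lambda>t. f (c *\<^sub>R p + t *\<^sub>R axis i 1)) has_vector_derivative partial i f (c *\<^sub>R p)) (at (c * 0))"
    using smooth_has_partial[OF assms] unfolding has_partial_def by simp
  then have "((\<lambda>t. f (c *\<^sub>R p + t *\<^sub>R axis i 1)) \<circ> (\<lambda>t. c * t) has_vector_derivative c *\<^sub>R partial i f (c *\<^sub>R p)) (at 0)"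
    by (intro vector_diff_chain_at) (auto intro!: derivative_eq_intros)
  then show ?thesis unfolding has_partial_def by (simp add: comp_def scaleR_conv_of_real algebra_simps)
qed

lemma smooth_dilate: "smooth f \<Longrightarrow> smooth (\<lambda>p. f (c *\<^sub>R p))"
\<comment> \<open>The free constant \<open>d\<close> absorbs the factor \<open>c\<close> that every
  differentiation produces.\<close>
proof (rule smooth_coinduct[where S = "{\<lambda>p. d * f (c *\<^sub>R p) | f d. smooth f}"])
  fix g i assume "g \<in> {\<lambda>p. d * f (c *\<^sub>R p) | f d. smooth f}"
  then obtain f d where g: "g = (\<lambda>p. d * f (c *\<^sub>R p))" "smooth f" by auto
  have "has_partial i g ((d * of_real c) * partial i f (c *\<^sub>R p)) p" for p
    unfolding g using has_partial_mult[OF has_partial_const[of i d] has_partial_dilate[OF g(2)]]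
    by (simp add: mult.assoc)
  moreover have "(\<lambda>p. (d * of_real c) * partial i f (c *\<^sub>R p)) \<in> {\<lambda>p. d * f (c *\<^sub>R p) | f d. smooth f}"
    using smooth_partial[OF g(2)] by blast
  ultimately show "\<exists>g'\<in>{\<lambda>p. d * f (c *\<^sub>R p) | f d. smooth f}. \<forall>p. has_partial i g (g' p) p"
    by (intro bexI) auto
next
  fix g assume "g \<in> {\<lambda>p. d * f (c *\<^sub>R p) | f d. smooth f}"
  then show "continuous_on UNIV g"
    by (auto intro!: continuous_intros continuous_on_compose2[OF smooth_continuous])
next
  assume "smooth f"
  then show "(\<lambda>p. f (c *\<^sub>R p)) \<in> {\<lambda>p. d * f (c *\<^sub>R p) | f d. smooth f}"
    by (intro CollectI exI[of _ f] exI[of _ 1]) auto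
qed

lemma foldr_partial_dilate:
  "smooth f \<Longrightarrow>
   foldr partial is (\<lambda>p. f (c *\<^sub>R p)) = (\<lambda>p. of_real c ^ length is * foldr partial is f (c *\<^sub>R p))"
proof (induction "is")
  case (Cons i "is")
  let ?g = "foldr partial is f"
  have g: "smooth ?g" using Cons by (intro smooth_foldr_partial)
  have "foldr partial (i # is) (\<lambda>p. f (c *\<^sub>R p)) = partial i (\<lambda>p. of_real c ^ length is * ?g (c *\<^sub>R p))"
    using Cons by simp
  also have "\<dots> = (\<lambda>p. of_real c ^ length is * partial i (\<lambda>p. ?g (c *\<^sub>R p)) p)"
    using g by (intro partial_cmult smooth_dilate)
  also have "partial i (\<lambda>p. ?g (c *\<^sub>R p)) = (\<lambda>p. of_real c * partial i ?g (c *\<^sub>R p))"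
    by (rule ext) (intro has_partial_imp_partial has_partial_dilate g)
  finally show ?case by (simp add: mult_ac)
qed simp

text \<open>Brings a real-valued function back to real derivatives, where the one-dimensional chain
  rule applies.\<close>

lemma smooth_of_real_partial:
  assumes "smooth (\<lambda>p. of_real (u p))"
  shows "((\<lambda>t. u (p + t *\<^sub>R axis i 1)) has_real_derivative Re (partial i (\<lambda>p. of_real (u p)) p)) (at 0)"
    and "partial i (\<lambda>p. of_real (u p)) p = of_real (Re (partial i (\<lambda>p. of_real (u p)) p))"
proof -
  let ?d = "partial i (\<lambda>p. of_real (u p)) p"
  have "((\<lambda>t. complex_of_real (u (p + t *\<^sub>R axis i 1))) has_vector_derivative ?d) (at 0)"
    using smooth_has_partial[OF assms] unfolding has_partial_def .
  from bounded_linear.has_vector_derivative[OF bounded_linear_Re this]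
  show *: "((\<lambda>t. u (p + t *\<^sub>R axis i 1)) has_real_derivative Re ?d) (at 0)"
    by (simp add: has_real_derivative_iff_has_vector_derivative)
  have "has_partial i (\<lambda>p. of_real (u p)) (of_real (Re ?d)) p"
    unfolding has_partial_def by (rule has_vector_derivative_of_real) (use * in auto)
  then show "?d = of_real (Re ?d)" by (rule has_partial_imp_partial)
qed

text \<open>The sequence \<open>h\<close> lists the successive derivatives of \<open>h 0\<close>,
  and differentiability is asked only at values of \<open>u\<close>; this admits functions such as
  the reciprocal away from 0. Sums of products of some \<open>h n\<close> composed with
  \<open>u\<close> and a smooth factor are invariant under partial derivatives.\<close>

lemma smooth_compose:
  fixes h :: "nat \<Rightarrow> real \<Rightarrow> real"
  assumes u: "smooth (\<lambda>p. of_real (u p))"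
    and h: "\<And>n p. (h n has_real_derivative h (Suc n) (u p)) (at (u p))"
  shows "smooth (\<lambda>p. of_real (h 0 (u p)))"
proof -
  define H where "H = range (\<lambda>n p. complex_of_real (h n (u p)))"
  define U where "U p = complex_of_real (u p)" for p
  have U: "smooth U" unfolding U_def[abs_def] by (rule u)
  have "continuous_on UNIV (\<lambda>p. Re (U p))" by (intro continuous_on_Re smooth_continuous U)
  then have cu: "continuous_on UNIV u" unfolding U_def by simp
  have "(\<lambda>p. of_real (h 0 (u p)) * 1) \<in> sum_products H"
    by (rule sum_products.prod[OF _ smooth_const refl]) (simp add: H_def)
  then have "smooth (\<lambda>p. of_real (h 0 (u p)) * 1)"
  proof (rule smooth_sum_products[rotated -1])
    fix g assume "g \<in> H"
    then obtain n where g: "g = (\<lambda>p. of_real (h n (u p)))" unfolding H_def by blast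
    have "isCont u p" for p using cu by (simp add: continuous_on_eq_continuous_at)
    then have "isCont (\<lambda>p. h n (u p)) p" for p
      by (rule isCont_o2[where f = u and g = "h n"]) (rule DERIV_isCont[OF h])
    then have "continuous_on UNIV (\<lambda>p. h n (u p))" by (simp add: continuous_on_eq_continuous_at)
    then show "continuous_on UNIV g" unfolding g by (rule continuous_on_of_real)
  next
    fix k g i assume "k \<in> H" and g: "smooth g"
    then obtain n where k: "k = (\<lambda>p. of_real (h n (u p)))" unfolding H_def by blast
    have "has_partial i k (of_real (h (Suc n) (u p)) * partial i U p) p" for p
    proof -
      let ?d = "Re (partial i U p)"
      note * = smooth_of_real_partial[OF u, where i = i and p = p, folded U_def[abs_def]]
      have "(h n has_real_derivative h (Suc n) (u p)) (at (u (p + 0 *\<^sub>R axis i 1)))" using h by simp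
      from DERIV_chain2[OF this *(1)]
      have "((\<lambda>t. h n (u (p + t *\<^sub>R axis i 1))) has_real_derivative h (Suc n) (u p) * ?d) (at 0)" .
      then have "((\<lambda>t. complex_of_real (h n (u (p + t *\<^sub>R axis i 1)))) has_vector_derivative
          of_real (h (Suc n) (u p) * ?d)) (at 0)"
        by (intro has_vector_derivative_of_real)
      then show ?thesis unfolding has_partial_def k using *(2) by (simp add: of_real_mult)
    qed
    from has_partial_mult[OF this smooth_has_partial[OF g]]
    have "has_partial i (\<lambda>p. k p * g p)
       (of_real (h (Suc n) (u p)) * (partial i U p * g p) + k p * partial i g p) p" for p
      by (simp add: mult.assoc)
    moreover have "(\<lambda>p. of_real (h (Suc n) (u p)) * (partial i U p * g p) + k p * partial i g p) \<in> sum_products H"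
      using g U \<open>k \<in> H\<close>
      by (intro sum_products.add[OF sum_products.prod[OF _ _ refl] sum_products.prod[OF _ _ refl] refl]
          smooth_mult smooth_partial) (simp_all add: H_def)
    ultimately show "\<exists>f\<in>sum_products H. \<forall>p. has_partial i (\<lambda>p. k p * g p) (f p) p"
      by (intro bexI) auto
  qed
  then show ?thesis by simp
qed


section \<open>A smooth bump function\<close>

text \<open>The polynomial factor makes the family closed under differentiation: with
  \<open>y = 1 / x\<close>, the derivative of \<open>q y * exp (- y)\<close> in \<open>x\<close> is
  \<open>y^2 * (q y - q' y) * exp (- y)\<close>.\<close>

definition exp_inv_poly :: "real poly \<Rightarrow> real \<Rightarrow> real" where
  "exp_inv_poly q x = (if x > 0 then poly q (1 / x) * exp (- (1 / x)) else 0)"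

lemma tendsto_poly_exp_0: "((\<lambda>y::real. poly q y * exp (- y)) \<longlongrightarrow> 0) at_top"
proof -
  have "((\<lambda>y::real. \<Sum>i\<le>degree q. coeff q i * (y ^ i / exp y)) \<longlongrightarrow> (\<Sum>i\<le>degree q. coeff q i * 0)) at_top"
    by (intro tendsto_intros tendsto_power_div_exp_0)
  moreover have "(\<lambda>y. \<Sum>i\<le>degree q. coeff q i * (y ^ i / exp y)) = (\<lambda>y. poly q y * exp (- y))"
    by (rule ext) (simp add: poly_altdef sum_distrib_left exp_minus divide_inverse mult_ac)
  ultimately show ?thesis by simp
qed

lemma exp_inv_poly_deriv:
  "(exp_inv_poly q has_real_derivative exp_inv_poly ([:0, 0, 1:] * (q - pderiv q)) x) (at x)"
proof -
  consider "x > 0" | "x < 0" | "x = 0" by linarith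
  then show ?thesis
  proof cases
    case 1
    have "((\<lambda>x. poly q (1 / x) * exp (- (1 / x))) has_real_derivative
        exp_inv_poly ([:0, 0, 1:] * (q - pderiv q)) x) (at x)"
      using 1 unfolding exp_inv_poly_def
      by (auto intro!: derivative_eq_intros DERIV_chain2[OF poly_DERIV] simp: field_simps power2_eq_square)
    moreover have "\<forall>\<^sub>F y in nhds x. exp_inv_poly q y = poly q (1 / y) * exp (- (1 / y))"
      by (rule eventually_mono[OF eventually_nhds_in_open[of "{0<..}" x]]) (use 1 in \<open>auto simp: exp_inv_poly_def\<close>)
    ultimately show ?thesis by (subst DERIV_cong_ev[OF refl _ refl]) auto
  next
    case 2
    have "\<forall>\<^sub>F y in nhds x. exp_inv_poly q y = 0"
      by (rule eventually_mono[OF eventually_nhds_in_open[of "{..<0}" x]]) (use 2 in \<open>auto simp: exp_inv_poly_def\<close>)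
    then show ?thesis using 2 by (subst DERIV_cong_ev[OF refl _ refl]) (auto simp: exp_inv_poly_def)
  next
    case 3
    have "((\<lambda>y. (exp_inv_poly q y - exp_inv_poly q 0) / (y - 0)) \<longlongrightarrow> 0) (at 0)"
    proof (rule filterlim_split_at)
      have "\<forall>\<^sub>F y in at_left 0. (exp_inv_poly q y - exp_inv_poly q 0) / (y - 0) = 0"
        by (auto simp: eventually_at_filter exp_inv_poly_def)
      then show "((\<lambda>y. (exp_inv_poly q y - exp_inv_poly q 0) / (y - 0)) \<longlongrightarrow> 0) (at_left 0)"
        by (rule tendsto_eventually)
      \<comment> \<open>The difference quotient at 0 divides by \<open>y\<close>, which multiplies
        the polynomial in \<open>1 / y\<close> by its variable; hence
        \<open>pCons 0 q\<close>.\<close>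
      have "((\<lambda>y. poly (pCons 0 q) (inverse y) * exp (- inverse y)) \<longlongrightarrow> 0) (at_right 0)"
        by (rule filterlim_compose[OF tendsto_poly_exp_0 filterlim_inverse_at_top_right])
      moreover have "\<forall>\<^sub>F y in at_right 0. poly (pCons 0 q) (inverse y) * exp (- inverse y)
          = (exp_inv_poly q y - exp_inv_poly q 0) / (y - 0)"
        by (auto simp: eventually_at_filter exp_inv_poly_def field_simps)
      ultimately show "((\<lambda>y. (exp_inv_poly q y - exp_inv_poly q 0) / (y - 0)) \<longlongrightarrow> 0) (at_right 0)"
        by (rule Lim_transform_eventually)
    qed
    then show ?thesis using 3 by (simp add: has_field_derivative_iff exp_inv_poly_def)
  qed
qed

definition exp_inv :: "real \<Rightarrow> real" where
  "exp_inv = exp_inv_poly 1"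

lemma exp_inv_nonneg: "0 \<le> exp_inv x" and exp_inv_pos: "0 < x \<Longrightarrow> 0 < exp_inv x"
  and exp_inv_zero: "x \<le> 0 \<Longrightarrow> exp_inv x = 0"
  unfolding exp_inv_def exp_inv_poly_def by auto

lemma smooth_exp_inv:
  assumes "smooth (\<lambda>p. of_real (u p))" shows "smooth (\<lambda>p. of_real (exp_inv (u p)))"
proof -
  define q where "q n = ((\<lambda>q. [:0, 0, 1:] * (q - pderiv q)) ^^ n) (1 :: real poly)" for n
  have "smooth (\<lambda>p. of_real (exp_inv_poly (q 0) (u p)))"
  proof (rule smooth_compose[OF assms])
    show "(exp_inv_poly (q n) has_real_derivative exp_inv_poly (q (Suc n)) (u p)) (at (u p))" for n p
      using exp_inv_poly_deriv[of "q n" "u p"] by (simp add: q_def)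
  qed
  then show ?thesis by (simp add: q_def exp_inv_def)
qed

lemma smooth_inverse:
  assumes "smooth (\<lambda>p. of_real (u p))" "\<And>p. u p \<noteq> 0"
  shows "smooth (\<lambda>p. of_real (inverse (u p)))"
proof -
  \<comment> \<open>The \<open>n\<close>-th derivative of the reciprocal.\<close>
  define h where "h n x = (- 1) ^ n * fact n * inverse x ^ Suc n" for n and x :: real
  have "smooth (\<lambda>p. of_real (h 0 (u p)))"
  proof (rule smooth_compose[OF assms(1)])
    fix n p
    have "u p \<noteq> 0" by (rule assms)
    then show "(h n has_real_derivative h (Suc n) (u p)) (at (u p))"
      unfolding h_def[abs_def]
      using DERIV_cmult[OF DERIV_power_Suc[OF DERIV_inverse[of "u p"]], of "(- 1) ^ n * fact n" n]
      by (simp add: algebra_simps power2_eq_square numeral_2_eq_2)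
  qed
  then show ?thesis by (simp add: h_def)
qed

text \<open>The standard quotient of flat functions in \<open>s = (norm p)\<^sup>2\<close>: the
  second summand of the denominator vanishes for \<open>s \<le> 1\<close>, the numerator for
  \<open>s \<ge> 2\<close>. The squared norm is used because it is a polynomial in the
  coordinates.\<close>

definition bump :: "mink \<Rightarrow> real" where
  "bump p = exp_inv (2 - (norm p)\<^sup>2) * inverse (exp_inv (2 - (norm p)\<^sup>2) + exp_inv ((norm p)\<^sup>2 - 1))"

lemma bump_denominator_pos: "0 < exp_inv (2 - x) + exp_inv (x - 1)"
proof (cases "x < 2")
  case True
  then show ?thesis using exp_inv_pos[of "2 - x"] exp_inv_nonneg[of "x - 1"] by (intro add_pos_nonneg) auto
next
  case False
  then show ?thesis using exp_inv_pos[of "x - 1"] exp_inv_nonneg[of "2 - x"] by (intro add_nonneg_pos) auto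
qed

lemma bump_range: "0 \<le> bump p" "bump p \<le> 1"
  unfolding bump_def
  using bump_denominator_pos[of "(norm p)\<^sup>2"] exp_inv_nonneg[of "2 - (norm p)\<^sup>2"] exp_inv_nonneg[of "(norm p)\<^sup>2 - 1"]
  by (auto simp: field_simps)

lemma bump_eq_1: "norm p \<le> 1 \<Longrightarrow> bump p = 1"
proof -
  assume "norm p \<le> 1"
  then have "(norm p)\<^sup>2 \<le> 1" by (simp add: power_le_one)
  then show ?thesis using exp_inv_pos[of "2 - (norm p)\<^sup>2"] unfolding bump_def by (simp add: exp_inv_zero)
qed

lemma bump_eq_0: "2 \<le> norm p \<Longrightarrow> bump p = 0"
proof -
  assume "2 \<le> norm p"
  then have "2\<^sup>2 \<le> (norm p)\<^sup>2" by (intro power_mono) auto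
  then show ?thesis unfolding bump_def by (simp add: exp_inv_zero)
qed

lemma smooth_bump: "smooth (\<lambda>p. of_real (bump p))"
proof -
  have *: "smooth (\<lambda>p. of_real (c + d * (norm p)\<^sup>2))" for c d :: real
  proof -
    have "smooth (\<lambda>p. of_real c + of_real d * (\<Sum>i\<in>UNIV. of_real (p $ i) * of_real (p $ i)))"
      by (intro smooth_add smooth_mult smooth_const smooth_sum smooth_coord)
    moreover have "(norm p)\<^sup>2 = (\<Sum>i\<in>UNIV. p $ i * p $ i)" for p :: mink
      by (simp add: power2_norm_eq_inner inner_vec_def)
    ultimately show ?thesis by simp
  qed
  have 1: "smooth (\<lambda>p. of_real (exp_inv (2 - (norm p)\<^sup>2)))"
    using smooth_exp_inv[OF *[of 2 "-1"]] by simp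
  have 2: "smooth (\<lambda>p. of_real (exp_inv ((norm p)\<^sup>2 - 1)))"
    using smooth_exp_inv[OF *[of "-1" 1]] by simp
  have "smooth (\<lambda>p. of_real (inverse (exp_inv (2 - (norm p)\<^sup>2) + exp_inv ((norm p)\<^sup>2 - 1))))"
    using smooth_add[OF 1 2] bump_denominator_pos by (intro smooth_inverse) (auto simp: less_imp_neq[THEN not_sym])
  from smooth_mult[OF 1 this] show ?thesis unfolding bump_def by simp
qed


section \<open>Test functions and Schwartz functions\<close>

lemma test_functions_iff: "f \<in> test_functions \<longleftrightarrow> smooth f \<and> (\<exists>R. \<forall>p. R < norm p \<longrightarrow> f p = 0)"
proof -
  have "bounded (support_on UNIV f) \<longleftrightarrow> (\<exists>R. \<forall>p. R < norm p \<longrightarrow> f p = 0)"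
    unfolding bounded_iff support_on_def by (auto simp: not_less[symmetric])
  then show ?thesis unfolding test_functions_def by (simp add: compact_closure)
qed

text \<open>The exterior of a closed ball is open, so a function vanishing there is constant near
  each of its points along every line.\<close>

lemma foldr_partial_vanishes:
  assumes "\<And>p. R < norm p \<Longrightarrow> f p = 0" "R < norm p"
  shows "foldr partial is f p = 0"
  using assms(2)
proof (induction "is" arbitrary: p)
  case (Cons i "is")
  let ?g = "foldr partial is f"
  have "open {t. R < norm (p + t *\<^sub>R axis i (1::real))}"
    by (intro open_Collect_less continuous_intros)
  then have "((\<lambda>t. ?g (p + t *\<^sub>R axis i 1)) has_vector_derivative 0) (at 0)"
    by (rule has_vector_derivative_transform_within_open[OF has_vector_derivative_const]) (use Cons in simp_all)
  then have "has_partial i ?g 0 p" unfolding has_partial_def .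
  then show ?case using has_partial_imp_partial by simp
qed (use assms in simp)

lemma continuous_bounded_support_bounded:
  fixes f :: "'a::euclidean_space \<Rightarrow> complex"
  assumes "continuous_on UNIV f" "\<And>p. R < norm p \<Longrightarrow> f p = 0"
  shows "\<exists>B. \<forall>p. (1 + norm p) ^ k * cmod (f p) \<le> B"
proof -
  let ?g = "\<lambda>p. (1 + norm p) ^ k * cmod (f p)"
  have "continuous_on (cball 0 R) ?g"
    using assms(1) by (intro continuous_intros) (auto intro: continuous_on_subset)
  then have "bounded (?g ` cball 0 R)" by (intro compact_imp_bounded compact_continuous_image) auto
  then obtain B where "\<forall>x\<in>?g ` cball 0 R. norm x \<le> B" unfolding bounded_iff by blast
  then have B: "\<bar>?g p\<bar> \<le> B" if "norm p \<le> R" for p using that by force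
  have "?g p \<le> max B 0" for p
    using B[of p] assms(2)[of p] by (cases "R < norm p") (auto simp: max_def)
  then show ?thesis by blast
qed

text \<open>The order of differentiation fixed by \<open>multi_deriv\<close>, as a list, so that
  results on \<open>foldr partial\<close> apply.\<close>

definition index_list :: "(4 \<Rightarrow> nat) \<Rightarrow> 4 list" where
  "index_list \<alpha> = replicate (\<alpha> 0) 0 @ replicate (\<alpha> 1) 1 @ replicate (\<alpha> 2) 2 @ replicate (\<alpha> 3) 3"

lemma foldr_replicate_funpow: "foldr f (replicate n x) = f x ^^ n"
  by (induction n) (auto simp: fun_eq_iff)

lemma multi_deriv_foldr: "multi_deriv \<alpha> f = foldr partial (index_list \<alpha>) f"
  unfolding multi_deriv_def index_list_def by (simp add: foldr_replicate_funpow)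

lemma subseq_replicate: "subseq xs (replicate n x) \<Longrightarrow> \<exists>m. xs = replicate m x"
proof -
  assume xs: "subseq xs (replicate n x)"
  have "y = x" if "y \<in> set xs" for y
    using list_emb_set[OF xs that] by auto
  then show ?thesis using replicate_length_same[of xs x] by metis
qed

text \<open>Deleting entries from a list sorted into blocks leaves such a list. The derivatives of a
  factor that occur in the product rule are therefore again of the form
  \<open>multi_deriv\<close>.\<close>

lemma subseq_index_list:
  assumes "subseq js (index_list \<alpha>)" shows "\<exists>\<beta>. js = index_list \<beta>"
proof -
  obtain xs0 ys0 where 0: "js = xs0 @ ys0" "subseq xs0 (replicate (\<alpha> 0) 0)"
    "subseq ys0 (replicate (\<alpha> 1) 1 @ replicate (\<alpha> 2) 2 @ replicate (\<alpha> 3) 3)"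
    using assms unfolding index_list_def by (rule subseq_appendE)
  obtain xs1 ys1 where 1: "ys0 = xs1 @ ys1" "subseq xs1 (replicate (\<alpha> 1) 1)"
    "subseq ys1 (replicate (\<alpha> 2) 2 @ replicate (\<alpha> 3) 3)"
    using 0(3) by (rule subseq_appendE)
  obtain xs2 xs3 where 2: "ys1 = xs2 @ xs3" "subseq xs2 (replicate (\<alpha> 2) 2)" "subseq xs3 (replicate (\<alpha> 3) 3)"
    using 1(3) by (rule subseq_appendE)
  obtain a b c d where "xs0 = replicate a 0" "xs1 = replicate b 1" "xs2 = replicate c 2" "xs3 = replicate d 3"
    using subseq_replicate[OF 0(2)] subseq_replicate[OF 1(2)] subseq_replicate[OF 2(2)] subseq_replicate[OF 2(3)]
    by blast
  then have "js = replicate a 0 @ replicate b 1 @ replicate c 2 @ replicate d 3"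
    using 0(1) 1(1) 2(1) by simp
  then have "js = index_list (\<lambda>i. if i = 0 then a else if i = 1 then b else if i = 2 then c else d)"
    unfolding index_list_def by simp
  then show ?thesis by blast
qed

lemma schwartz_iff:
  "f \<in> schwartz \<longleftrightarrow> smooth f \<and> (\<forall>k \<alpha>. \<exists>B. \<forall>p. (1 + norm p) ^ k * cmod (multi_deriv \<alpha> f p) \<le> B)"
  unfolding schwartz_def bdd_above_def by auto

lemma schwartz_smooth: "f \<in> schwartz \<Longrightarrow> smooth f"
  unfolding schwartz_def by auto

lemma test_functions_schwartz: "test_functions \<subseteq> schwartz"
proof
  fix f assume "f \<in> test_functions"
  then obtain R where f: "smooth f" "\<And>p. R < norm p \<Longrightarrow> f p = 0" unfolding test_functions_iff by auto
  then have "\<exists>B. \<forall>p. (1 + norm p) ^ k * cmod (multi_deriv \<alpha> f p) \<le> B" for k \<alpha>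
    unfolding multi_deriv_foldr
    by (intro continuous_bounded_support_bounded[where R = R] foldr_partial_vanishes
        smooth_continuous smooth_foldr_partial)
  then show "f \<in> schwartz" using f unfolding schwartz_iff by blast
qed

section \<open>Linearity and the Schwartz seminorms\<close>

lemma multi_deriv_add: "smooth f \<Longrightarrow> smooth g \<Longrightarrow>
    multi_deriv \<alpha> (\<lambda>p. f p + g p) = (\<lambda>p. multi_deriv \<alpha> f p + multi_deriv \<alpha> g p)"
  unfolding multi_deriv_foldr by (rule foldr_partial_add)

lemma multi_deriv_cmult: "smooth f \<Longrightarrow> multi_deriv \<alpha> (\<lambda>p. c * f p) = (\<lambda>p. c * multi_deriv \<alpha> f p)"
  unfolding multi_deriv_foldr by (rule foldr_partial_cmult)

lemma multi_deriv_zero: "multi_deriv (\<lambda>_. 0) f = f"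
  unfolding multi_deriv_def by simp

lemma schwartz_seminorm_upper:
  "f \<in> schwartz \<Longrightarrow> (1 + norm p) ^ k * cmod (multi_deriv \<alpha> f p) \<le> schwartz_seminorm k \<alpha> f"
  unfolding schwartz_seminorm_def by (rule cSUP_upper) (auto simp: schwartz_def)

lemma schwartz_seminorm_least:
  "(\<And>p. (1 + norm p) ^ k * cmod (multi_deriv \<alpha> f p) \<le> B) \<Longrightarrow> schwartz_seminorm k \<alpha> f \<le> B"
  unfolding schwartz_seminorm_def by (rule cSUP_least) auto

lemma schwartz_seminorm_nonneg: "f \<in> schwartz \<Longrightarrow> 0 \<le> schwartz_seminorm k \<alpha> f"
  by (rule order_trans[OF _ schwartz_seminorm_upper[of f 0]]) auto

lemma schwartz_add:
  assumes f: "f \<in> schwartz" and g: "g \<in> schwartz"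
  shows "(\<lambda>p. f p + g p) \<in> schwartz"
    and "schwartz_seminorm k \<alpha> (\<lambda>p. f p + g p) \<le> schwartz_seminorm k \<alpha> f + schwartz_seminorm k \<alpha> g"
proof -
  have sm: "smooth f" "smooth g" using f g schwartz_smooth by auto
  have *: "(1 + norm p) ^ k * cmod (multi_deriv \<alpha> (\<lambda>p. f p + g p) p)
      \<le> schwartz_seminorm k \<alpha> f + schwartz_seminorm k \<alpha> g" for k \<alpha> p
  proof -
    have "(1 + norm p) ^ k * cmod (multi_deriv \<alpha> (\<lambda>p. f p + g p) p)
        \<le> (1 + norm p) ^ k * (cmod (multi_deriv \<alpha> f p) + cmod (multi_deriv \<alpha> g p))"
      unfolding multi_deriv_add[OF sm] by (intro mult_left_mono norm_triangle_ineq) auto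
    also have "\<dots> \<le> schwartz_seminorm k \<alpha> f + schwartz_seminorm k \<alpha> g"
      unfolding distrib_left using f g by (intro add_mono schwartz_seminorm_upper)
    finally show ?thesis .
  qed
  show "(\<lambda>p. f p + g p) \<in> schwartz" unfolding schwartz_iff using smooth_add[OF sm] * by blast
  show "schwartz_seminorm k \<alpha> (\<lambda>p. f p + g p) \<le> schwartz_seminorm k \<alpha> f + schwartz_seminorm k \<alpha> g"
    by (rule schwartz_seminorm_least) (rule *)
qed

lemma schwartz_cmult:
  assumes f: "f \<in> schwartz"
  shows "(\<lambda>p. c * f p) \<in> schwartz"
    and "schwartz_seminorm k \<alpha> (\<lambda>p. c * f p) \<le> cmod c * schwartz_seminorm k \<alpha> f"
proof -
  have sm: "smooth f" using f schwartz_smooth by auto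
  have *: "(1 + norm p) ^ k * cmod (multi_deriv \<alpha> (\<lambda>p. c * f p) p) \<le> cmod c * schwartz_seminorm k \<alpha> f" for k \<alpha> p
    using mult_left_mono[OF schwartz_seminorm_upper[OF f, of p k \<alpha>], of "cmod c"]
    unfolding multi_deriv_cmult[OF sm] by (simp add: norm_mult mult_ac)
  show "(\<lambda>p. c * f p) \<in> schwartz"
    unfolding schwartz_iff using smooth_mult[OF smooth_const sm] * by blast
  show "schwartz_seminorm k \<alpha> (\<lambda>p. c * f p) \<le> cmod c * schwartz_seminorm k \<alpha> f"
    by (rule schwartz_seminorm_least) (rule *)
qed

lemma zero_schwartz: "(\<lambda>p. 0) \<in> schwartz"
  using test_functions_schwartz by (auto simp: test_functions_iff smooth_const)

text \<open>
  Only subsequences of \<open>is\<close> are differentiated, so no symmetry of mixed partial derivatives is needed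
  to stay within the derivatives \<^const>\<open>multi_deriv\<close> controlled by the Schwartz seminorms.
\<close>

lemma leibniz_bound:
  assumes "smooth f" "\<And>n. smooth (\<phi> n)" "\<And>n. 0 \<le> c n"
    and "\<And>js k. subseq js is \<Longrightarrow> \<exists>B. \<forall>p. (1 + norm p) ^ k * cmod (foldr partial js f p) \<le> B"
    and "\<And>js. \<exists>B. \<forall>n p. cmod (foldr partial js (\<phi> n) p) \<le> B * c n * (1 + norm p)"
  shows "\<exists>B. \<forall>n p. (1 + norm p) ^ k * cmod (foldr partial is (\<lambda>p. \<phi> n p * f p) p) \<le> B * c n"
  using assms
proof (induction "is" arbitrary: f \<phi> rule: rev_induct)
  case Nil
  \<comment> \<open>One extra power of the weight pays for the growth \<open>1 + norm p\<close>
    allowed to \<open>\<phi> n\<close>.\<close>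
  obtain A where A: "\<And>p. (1 + norm p) ^ Suc k * cmod (f p) \<le> A"
    using Nil(4)[of "[]" "Suc k"] by auto
  obtain B where B: "\<And>n p. cmod (\<phi> n p) \<le> B * c n * (1 + norm p)"
    using Nil(5)[of "[]"] by auto
  have "(1 + norm p) ^ k * cmod (\<phi> n p * f p) \<le> \<bar>B\<bar> * A * c n" for n p
  proof -
    have "cmod (\<phi> n p) \<le> \<bar>B\<bar> * c n * (1 + norm p)"
      using B[of n p] mult_right_mono[OF abs_ge_self[of B], of "c n * (1 + norm p)"] Nil(3)[of n]
      by (simp add: mult.assoc)
    then have "(1 + norm p) ^ k * cmod (\<phi> n p * f p)
        \<le> (1 + norm p) ^ k * ((\<bar>B\<bar> * c n * (1 + norm p)) * cmod (f p))"
      unfolding norm_mult by (intro mult_left_mono mult_right_mono) auto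
    also have "\<dots> = (\<bar>B\<bar> * c n) * ((1 + norm p) ^ Suc k * cmod (f p))" by simp
    also have "\<dots> \<le> (\<bar>B\<bar> * c n) * A" using A[of p] Nil(3)[of n] by (intro mult_left_mono) auto
    finally show ?thesis by (simp add: mult_ac)
  qed
  then show ?case by auto
next
  case (snoc i "is")
  \<comment> \<open>In \<open>foldr\<close> the last index acts first, so the product rule for
    \<open>i\<close> is applied innermost. The hypothesis, general in both factors, then treats the
    two products; only the one with \<open>partial i f\<close> keeps \<open>i\<close> in the lists
    for \<open>f\<close>.\<close>
  have "\<exists>B. \<forall>n p. (1 + norm p) ^ k * cmod (foldr partial is (\<lambda>p. partial i (\<phi> n) p * f p) p) \<le> B * c n"
  proof (rule snoc.IH)
    fix js k assume "subseq js is"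
    then have "subseq js (is @ [i])" by (rule subseq_order.order_trans) auto
    then show "\<exists>B. \<forall>p. (1 + norm p) ^ k * cmod (foldr partial js f p) \<le> B" by (rule snoc.prems(4))
  next
    fix js show "\<exists>B. \<forall>n p. cmod (foldr partial js (partial i (\<phi> n)) p) \<le> B * c n * (1 + norm p)"
      using snoc.prems(5)[of "js @ [i]"] by simp
  qed (use snoc.prems smooth_partial in auto)
  then obtain B1 where B1: "\<And>n p. (1 + norm p) ^ k * cmod (foldr partial is (\<lambda>p. partial i (\<phi> n) p * f p) p) \<le> B1 * c n"
    by blast
  have "\<exists>B. \<forall>n p. (1 + norm p) ^ k * cmod (foldr partial is (\<lambda>p. \<phi> n p * partial i f p) p) \<le> B * c n"
  proof (rule snoc.IH)
    fix js k assume "subseq js is"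
    then have "subseq (js @ [i]) (is @ [i])" by simp
    from snoc.prems(4)[OF this, of k]
    show "\<exists>B. \<forall>p. (1 + norm p) ^ k * cmod (foldr partial js (partial i f) p) \<le> B" by simp
  qed (use snoc.prems smooth_partial in auto)
  then obtain B2 where B2: "\<And>n p. (1 + norm p) ^ k * cmod (foldr partial is (\<lambda>p. \<phi> n p * partial i f p) p) \<le> B2 * c n"
    by blast
  have "(1 + norm p) ^ k * cmod (foldr partial (is @ [i]) (\<lambda>p. \<phi> n p * f p) p) \<le> (B1 + B2) * c n" for n p
  proof -
    have "foldr partial (is @ [i]) (\<lambda>p. \<phi> n p * f p) p
        = foldr partial is (\<lambda>p. partial i (\<phi> n) p * f p) p + foldr partial is (\<lambda>p. \<phi> n p * partial i f p) p"
      using snoc.prems(1,2)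
      by (simp add: partial_mult foldr_partial_add smooth_mult smooth_partial)
    then have "(1 + norm p) ^ k * cmod (foldr partial (is @ [i]) (\<lambda>p. \<phi> n p * f p) p)
      \<le> (1 + norm p) ^ k * (cmod (foldr partial is (\<lambda>p. partial i (\<phi> n) p * f p) p)
         + cmod (foldr partial is (\<lambda>p. \<phi> n p * partial i f p) p))"
      by (intro mult_left_mono) (auto intro: norm_triangle_ineq)
    also have "\<dots> \<le> (B1 + B2) * c n" using B1[of p n] B2[of p n] by (simp add: algebra_simps)
    finally show ?thesis .
  qed
  then show ?case by blast
qed

text \<open>The scale \<open>n + 1\<close> is never zero: the function is 1 on the ball of that
  radius and 0 outside twice the radius.\<close>

definition dilated_bump :: "nat \<Rightarrow> mink \<Rightarrow> complex" where
  "dilated_bump n p = of_real (bump (inverse (real (Suc n)) *\<^sub>R p))"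

lemma smooth_dilated_bump: "smooth (dilated_bump n)"
  unfolding dilated_bump_def[abs_def] by (rule smooth_dilate[OF smooth_bump])

lemma dilated_bump_eq_0: "2 * real (Suc n) \<le> norm p \<Longrightarrow> dilated_bump n p = 0"
  unfolding dilated_bump_def by (subst bump_eq_0) (auto simp: field_simps)

lemma dilated_bump_eq_1: "norm p \<le> real (Suc n) \<Longrightarrow> dilated_bump n p = 1"
  unfolding dilated_bump_def by (subst bump_eq_1) (auto simp: field_simps)

lemma dilated_bump_norm: "cmod (dilated_bump n p) \<le> 1" "cmod (1 - dilated_bump n p) \<le> 1"
proof -
  show "cmod (dilated_bump n p) \<le> 1" unfolding dilated_bump_def using bump_range by simp
  have "1 - dilated_bump n p = of_real (1 - bump (inverse (real (Suc n)) *\<^sub>R p))"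
    unfolding dilated_bump_def by simp
  then show "cmod (1 - dilated_bump n p) \<le> 1" using bump_range by (simp only: norm_of_real) simp
qed

lemma dilated_bump_test_function:
  assumes "smooth f" shows "(\<lambda>p. dilated_bump n p * f p) \<in> test_functions"
  unfolding test_functions_iff using smooth_mult[OF smooth_dilated_bump assms] dilated_bump_eq_0[of n]
  by (auto intro!: exI[of _ "2 * real (Suc n)"])

text \<open>Without derivatives, the function vanishes up to radius \<open>n + 1\<close>, and beyond
  it the factor \<open>1 + norm p\<close> outweighs \<open>n + 1\<close>. With derivatives, each one
  brings a factor \<open>1 / (n + 1)\<close> by dilation, of which a single one is kept.\<close>

lemma one_minus_dilated_bump_derivs:
  "\<exists>B. \<forall>n p. cmod (foldr partial js (\<lambda>p. 1 + - 1 * dilated_bump n p) p) \<le> B * inverse (real (Suc n)) * (1 + norm p)"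
proof (cases "js = []")
  case True
  have "cmod (1 - dilated_bump n p) \<le> inverse (real (Suc n)) * (1 + norm p)" for n p
  proof (cases "norm p \<le> real (Suc n)")
    case False
    then have "1 \<le> inverse (real (Suc n)) * (1 + norm p)" by (simp add: field_simps)
    then show ?thesis using dilated_bump_norm(2) by (rule order_trans[rotated])
  qed (simp add: dilated_bump_eq_1)
  then show ?thesis using True by (intro exI[of _ 1]) simp
next
  case False
  obtain B where B: "\<And>p. cmod (foldr partial js (\<lambda>p. of_real (bump p)) p) \<le> B"
    using continuous_bounded_support_bounded[of "foldr partial js (\<lambda>p. of_real (bump p))" 2 0]
      smooth_continuous[OF smooth_foldr_partial[OF smooth_bump]]
      foldr_partial_vanishes[of 2 "\<lambda>p. of_real (bump p)"] bump_eq_0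
    by (auto simp: less_imp_le)
  have "cmod (foldr partial js (\<lambda>p. 1 + - 1 * dilated_bump n p) p) \<le> B * inverse (real (Suc n)) * (1 + norm p)" for n p
  proof -
    have "foldr partial js (\<lambda>p. 1 + - 1 * dilated_bump n p) p = - foldr partial js (dilated_bump n) p"
      using foldr_partial_add[OF smooth_const smooth_mult[OF smooth_const smooth_dilated_bump], of js 1 "- 1" n]
        foldr_partial_cmult[OF smooth_dilated_bump, of js "-1" n] foldr_partial_const[OF False, of 1]
      by (simp add: fun_eq_iff)
    also have "cmod \<dots> = inverse (real (Suc n)) ^ length js
        * cmod (foldr partial js (\<lambda>p. of_real (bump p)) (inverse (real (Suc n)) *\<^sub>R p))"
      unfolding dilated_bump_def[abs_def] norm_minus_cancel
        foldr_partial_dilate[OF smooth_bump] norm_mult norm_power norm_of_real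
      by (simp add: abs_of_nonneg)
    also have "\<dots> \<le> inverse (real (Suc n)) ^ 1 * B"
      using False by (intro mult_mono B power_decreasing) (auto simp: Suc_le_eq inverse_le_1_iff)
    also have "\<dots> \<le> (B * inverse (real (Suc n))) * (1 + norm p)"
      using order_trans[OF norm_ge_zero B] by (simp add: divide_right_mono distrib_left)
    finally show ?thesis .
  qed
  then show ?thesis by blast
qed

text \<open>The Leibniz bound with \<open>c n = 1 / (n + 1)\<close>; a growth of order one in
  \<open>p\<close> is harmless because \<open>f\<close> decays faster than every power.\<close>

lemma cutoff_error_schwartz:
  assumes f: "f \<in> schwartz"
  shows "(\<lambda>p. (1 + - 1 * dilated_bump n p) * f p) \<in> schwartz"
    and "\<exists>B. \<forall>n. schwartz_seminorm k \<alpha> (\<lambda>p. (1 + - 1 * dilated_bump n p) * f p) \<le> B * inverse (real (Suc n))"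
proof -
  have sm: "smooth (\<lambda>p. 1 + - 1 * dilated_bump n p)" for n
    by (intro smooth_add smooth_mult smooth_const smooth_dilated_bump)
  have *: "\<exists>B. \<forall>n p. (1 + norm p) ^ k * cmod (multi_deriv \<alpha> (\<lambda>p. (1 + - 1 * dilated_bump n p) * f p) p)
      \<le> B * inverse (real (Suc n))" for k \<alpha>
    unfolding multi_deriv_foldr
  proof (rule leibniz_bound[OF schwartz_smooth[OF f] sm _ _ one_minus_dilated_bump_derivs])
    fix js k assume "subseq js (index_list \<alpha>)"
    then obtain \<beta> where "js = index_list \<beta>" using subseq_index_list by blast
    then show "\<exists>B. \<forall>p. (1 + norm p) ^ k * cmod (foldr partial js f p) \<le> B"
      using f unfolding schwartz_iff multi_deriv_foldr by blast
  qed simp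
  show "(\<lambda>p. (1 + - 1 * dilated_bump n p) * f p) \<in> schwartz"
    unfolding schwartz_iff using smooth_mult[OF sm schwartz_smooth[OF f]] * by blast
  show "\<exists>B. \<forall>n. schwartz_seminorm k \<alpha> (\<lambda>p. (1 + - 1 * dilated_bump n p) * f p) \<le> B * inverse (real (Suc n))"
    using *[of k \<alpha>] by (meson schwartz_seminorm_least)
qed


section \<open>Integration against complex measures\<close>

text \<open>\<open>measure_of\<close> returns the given set function or zero, so the bound is
  available before the supremum is known to be countably additive.\<close>

lemma emeasure_positive_part_le:
  assumes "\<And>F. F \<in> sets M \<Longrightarrow> \<nu> F \<le> K"
  shows "emeasure (positive_part M \<nu>) A \<le> ennreal K"
proof -
  have "(SUP F\<in>{F\<in>sets M. F \<subseteq> A}. ennreal (\<nu> F)) \<le> ennreal K"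
    using assms by (intro SUP_least ennreal_leI) auto
  then show ?thesis
    unfolding positive_part_def by (subst emeasure_measure_of_conv) auto
qed

lemma finite_positive_part:
  assumes "\<And>F. F \<in> sets M \<Longrightarrow> \<nu> F \<le> K"
  shows "finite_measure (positive_part M \<nu>)"
proof (rule finite_measureI)
  have "emeasure (positive_part M \<nu>) (space (positive_part M \<nu>)) \<le> ennreal K"
    by (rule emeasure_positive_part_le) (rule assms)
  then show "emeasure (positive_part M \<nu>) (space (positive_part M \<nu>)) \<noteq> \<infinity>" by (auto simp: top_unique)
qed

lemma space_positive_part [simp]: "space (positive_part M \<nu>) = space M"
  and sets_positive_part [simp]: "sets (positive_part M \<nu>) = sets M"
  unfolding positive_part_def by (auto intro: sets.space_closed)

text \<open>A non-integrable function has integral 0 by convention, so the bound holds for it as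
  well.\<close>

lemma (in finite_measure) norm_integral_le:
  fixes f :: "'a \<Rightarrow> complex"
  assumes "\<And>x. cmod (f x) \<le> B" "0 \<le> B"
  shows "cmod (integral\<^sup>L M f) \<le> B * measure M (space M)"
proof (cases "integrable M f")
  case True
  have "cmod (integral\<^sup>L M f) \<le> (\<integral>x. cmod (f x) \<partial>M)" by (rule integral_norm_bound)
  also have "\<dots> \<le> (\<integral>x. B \<partial>M)" using True assms by (intro integral_mono) auto
  finally show ?thesis by (simp add: mult.commute)
qed (use assms in \<open>simp add: not_integrable_integral_eq\<close>)

text \<open>The variation runs over infinite sequences, so the partition into \<open>F\<close> and
  its complement is padded with empty sets.\<close>

lemma complex_measure_le_total_variation:
  assumes "F \<in> sets M"
  shows "ennreal (cmod (\<mu> F)) \<le> total_variation M \<mu> (space M)"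
proof -
  define A where "A n = (if n = 0 then F else if n = 1 then space M - F else {})" for n :: nat
  have "range A \<subseteq> sets M" "disjoint_family A" "(\<Union>i. A i) = space M"
    using assms sets.sets_into_space[OF assms] unfolding A_def disjoint_family_on_def
    by (auto split: if_splits)
  then have "(\<Sum>i. ennreal (cmod (\<mu> (A i)))) \<le> total_variation M \<mu> (space M)"
    unfolding total_variation_def by (intro SUP_upper) auto
  moreover have "ennreal (cmod (\<mu> (A 0))) \<le> (\<Sum>i. ennreal (cmod (\<mu> (A i))))"
  proof -
    have "(\<Sum>i\<in>{0}. ennreal (cmod (\<mu> (A i)))) \<le> (\<Sum>i. ennreal (cmod (\<mu> (A i))))"
      by (intro sum_le_suminf summableI) simp_all
    then show ?thesis by simp
  qed
  ultimately show ?thesis by (simp add: A_def)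
qed

lemma complex_measure_integral_bounded:
  assumes "total_variation M \<mu> (space M) < \<infinity>"
  shows "\<exists>C. \<forall>f B. 0 \<le> B \<longrightarrow> (\<forall>x. cmod (f x) \<le> B) \<longrightarrow> cmod (complex_measure_integral M \<mu> f) \<le> C * B"
proof -
  define K where "K = enn2real (total_variation M \<mu> (space M))"
  have K: "cmod (\<mu> F) \<le> K" if "F \<in> sets M" for F
    using complex_measure_le_total_variation[OF that, of \<mu>] assms unfolding K_def
    by (metis enn2real_mono enn2real_ennreal norm_ge_zero infinity_ennreal_def)
  have "Re (\<mu> F) \<le> K" "- Re (\<mu> F) \<le> K" "Im (\<mu> F) \<le> K" "- Im (\<mu> F) \<le> K" if "F \<in> sets M" for F
    using K[OF that] abs_Re_le_cmod[of "\<mu> F"] abs_Im_le_cmod[of "\<mu> F"] by linarith+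
  note fin = this[THEN finite_positive_part]
  let ?m = "\<lambda>\<nu>. measure (positive_part M \<nu>) (space M)"
  let ?I = "\<lambda>\<nu> f. integral\<^sup>L (positive_part M \<nu>) f"
  define C where "C = ?m (\<lambda>E. Re (\<mu> E)) + ?m (\<lambda>E. - Re (\<mu> E)) + (?m (\<lambda>E. Im (\<mu> E)) + ?m (\<lambda>E. - Im (\<mu> E)))"
  have "cmod (complex_measure_integral M \<mu> f) \<le> C * B" if B: "0 \<le> B" "\<forall>x. cmod (f x) \<le> B" for f B
  proof -
    have b: "cmod (?I \<nu> f) \<le> B * ?m \<nu>" if "finite_measure (positive_part M \<nu>)" for \<nu>
      using finite_measure.norm_integral_le[OF that, of f B] B by simp
    have "cmod (complex_measure_integral M \<mu> f)
      \<le> (cmod (?I (\<lambda>E. Re (\<mu> E)) f) + cmod (?I (\<lambda>E. - Re (\<mu> E)) f))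
        + (cmod (?I (\<lambda>E. Im (\<mu> E)) f) + cmod (?I (\<lambda>E. - Im (\<mu> E)) f))"
      unfolding complex_measure_integral_def
      by (rule order_trans[OF norm_triangle_ineq add_mono]) (simp_all add: norm_mult norm_triangle_ineq4)
    also have "\<dots> \<le> (B * ?m (\<lambda>E. Re (\<mu> E)) + B * ?m (\<lambda>E. - Re (\<mu> E)))
        + (B * ?m (\<lambda>E. Im (\<mu> E)) + B * ?m (\<lambda>E. - Im (\<mu> E)))"
      by (intro add_mono b fin)
    also have "\<dots> = C * B" unfolding C_def by (simp add: algebra_simps)
    finally show ?thesis .
  qed
  then show ?thesis by blast
qed

text \<open>The relation \<open>P - Q = M - N\<close>, written with sums because subtraction is
  unsuitable for \<open>ennreal\<close> values. In this form it passes through the induction on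
  measurable functions, including monotone limits.\<close>

lemma nn_integral_sum_eq:
  assumes [measurable_cong, simp]: "sets M = sets B" "sets N = sets B" "sets P = sets B" "sets Q = sets B"
    and eq: "\<And>E. E \<in> sets B \<Longrightarrow> emeasure P E + emeasure N E = emeasure Q E + emeasure M E"
    and f: "f \<in> borel_measurable B"
  shows "nn_integral P f + nn_integral N f = nn_integral Q f + nn_integral M f"
  using f
proof induction
  case (cong f g)
  have sp: "space M = space B" "space N = space B" "space P = space B" "space Q = space B"
    using assms(1-4)[THEN sets_eq_imp_space_eq] by simp_all
  have "nn_integral R f = nn_integral R g" if "space R = space B" for R
    using cong(3) that by (intro nn_integral_cong) auto
  then show ?case using cong(4) sp by metis
next
  case (set A)
  then show ?case using eq by simp
next
  case (mult u c)
  then have [measurable]: "u \<in> borel_measurable B" by simp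
  show ?case using mult by (simp add: nn_integral_cmult distrib_left[symmetric])
next
  case (add u v)
  then have [measurable]: "u \<in> borel_measurable B" "v \<in> borel_measurable B" by auto
  show ?case using add by (simp add: nn_integral_add) (metis (no_types, lifting) add.assoc add.commute)
next
  case (seq U)
  then have [measurable]: "\<And>i. U i \<in> borel_measurable B" by auto
  have *: "nn_integral R (\<lambda>x. SUP i. U i x) = (SUP i. nn_integral R (U i))" if [measurable_cong]: "sets R = sets B" for R
    using seq by (intro nn_integral_monotone_convergence_SUP) auto
  have inc: "incseq (\<lambda>i. nn_integral R (U i))" for R
    using seq(3) by (auto simp: incseq_def le_fun_def intro!: nn_integral_mono)
  have "(SUP i. U i) = (\<lambda>x. SUP i. U i x)" by (auto simp: fun_eq_iff image_image)
  then show ?case using seq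
    by (simp add: * ennreal_SUP_add[OF inc inc, symmetric])
qed

lemma integral_sum_eq:
  fixes f :: "'a \<Rightarrow> complex"
  assumes sets [measurable_cong, simp]: "sets M = sets B" "sets N = sets B" "sets P = sets B" "sets Q = sets B"
    and fin: "finite_measure M" "finite_measure N" "finite_measure P" "finite_measure Q"
    and eq: "\<And>E. E \<in> sets B \<Longrightarrow> emeasure P E + emeasure N E = emeasure Q E + emeasure M E"
    and f [measurable]: "f \<in> borel_measurable B" and bd: "\<And>x. cmod (f x) \<le> K"
  shows "integral\<^sup>L P f - integral\<^sup>L Q f = integral\<^sup>L M f - integral\<^sup>L N f"
proof -
  have int: "integrable R g" if "finite_measure R" "sets R = sets B" "g \<in> borel_measurable B" "\<And>x. norm (g x) \<le> k"
    for R k and g :: "'a \<Rightarrow> 'c::{banach, second_countable_topology}"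
  proof -
    interpret finite_measure R by fact
    have "g \<in> borel_measurable R" using that(3) by (subst measurable_cong_sets[OF that(2) refl])
    then show ?thesis using that(4) by (intro integrable_const_bound[of _ k]) auto
  qed
  have nonneg: "integral\<^sup>L P g + integral\<^sup>L N g = integral\<^sup>L Q g + integral\<^sup>L M g"
    if g: "g \<in> borel_measurable B" "\<And>x. 0 \<le> g x" "\<And>x. g x \<le> k" for g :: "'a \<Rightarrow> real" and k
  proof -
    have g': "norm (g x) \<le> k" for x using g(2,3)[of x] by simp
    have nn: "nn_integral R (\<lambda>x. ennreal (g x)) = ennreal (integral\<^sup>L R g)" "0 \<le> integral\<^sup>L R g"
      if "finite_measure R" "sets R = sets B" for R
      using int[OF that g(1) g'] g(2) by (auto intro!: nn_integral_eq_integral)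
    have "(\<lambda>x. ennreal (g x)) \<in> borel_measurable B" using g(1) by simp
    from nn_integral_sum_eq[OF sets eq this] show ?thesis
      using fin by (simp add: nn ennreal_plus[symmetric] del: ennreal_plus)
  qed
  \<comment> \<open>Adding the bound \<open>k\<close> makes \<open>g\<close> nonnegative; the
    identity for the constant \<open>k\<close> then cancels, all integrals being finite.\<close>
  have real: "integral\<^sup>L P g - integral\<^sup>L Q g = integral\<^sup>L M g - integral\<^sup>L N g"
    if g: "g \<in> borel_measurable B" "\<And>x. norm (g x) \<le> k" for g :: "'a \<Rightarrow> real" and k
  proof -
    have k: "- k \<le> g x" "g x \<le> k" for x using g(2)[of x] by auto
    then have "0 \<le> k" using order_trans[OF norm_ge_zero g(2)] by simp
    have "integral\<^sup>L R (\<lambda>x. g x + k) = integral\<^sup>L R g + integral\<^sup>L R (\<lambda>x. k)"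
      if "finite_measure R" "sets R = sets B" for R
      using int[OF that g] int[OF that, of "\<lambda>x. k" "\<bar>k\<bar>"] by (intro Bochner_Integration.integral_add) auto
    note this[OF fin(1) sets(1)] this[OF fin(2) sets(2)] this[OF fin(3) sets(3)] this[OF fin(4) sets(4)]
    moreover have "integral\<^sup>L P (\<lambda>x. g x + k) + integral\<^sup>L N (\<lambda>x. g x + k)
        = integral\<^sup>L Q (\<lambda>x. g x + k) + integral\<^sup>L M (\<lambda>x. g x + k)"
    proof (rule nonneg)
      show "0 \<le> g x + k" "g x + k \<le> 2 * k" for x using k[of x] by auto
    qed (use g(1) in simp)
    moreover have "integral\<^sup>L P (\<lambda>x. k) + integral\<^sup>L N (\<lambda>x. k) = integral\<^sup>L Q (\<lambda>x. k) + integral\<^sup>L M (\<lambda>x. k)"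
      using \<open>0 \<le> k\<close> by (intro nonneg[of _ k]) auto
    ultimately show ?thesis by linarith
  qed
  have "norm (Re (f x)) \<le> K" "norm (Im (f x)) \<le> K" for x
    using bd[of x] abs_Re_le_cmod[of "f x"] abs_Im_le_cmod[of "f x"] by auto
  from real[OF _ this(1)] real[OF _ this(2)]
  have "integral\<^sup>L P (\<lambda>x. Re (f x)) - integral\<^sup>L Q (\<lambda>x. Re (f x)) = integral\<^sup>L M (\<lambda>x. Re (f x)) - integral\<^sup>L N (\<lambda>x. Re (f x))"
    "integral\<^sup>L P (\<lambda>x. Im (f x)) - integral\<^sup>L Q (\<lambda>x. Im (f x)) = integral\<^sup>L M (\<lambda>x. Im (f x)) - integral\<^sup>L N (\<lambda>x. Im (f x))"
    by auto
  then show ?thesis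
    using int[OF fin(1) sets(1) f bd] int[OF fin(2) sets(2) f bd] int[OF fin(3) sets(3) f bd] int[OF fin(4) sets(4) f bd]
    by (simp add: complex_eq_iff)
qed

text \<open>On a Hahn set \<open>Y\<close> the supremum is attained at \<open>E \<inter> Y\<close>:
  dropping the part of \<open>F\<close> outside \<open>Y\<close> and adding the rest of
  \<open>E \<inter> Y\<close> cannot lower the value. Countable additivity is then that of the
  difference restricted to \<open>Y\<close>.\<close>

lemma emeasure_positive_part_diff:
  assumes "finite_measure M" "finite_measure N" and sets: "sets M = sets B" "sets N = sets B"
    and Y: "Y \<in> sets B" "\<And>X. X \<in> sets B \<Longrightarrow> X \<subseteq> Y \<Longrightarrow> measure N X \<le> measure M X"
      "\<And>X. X \<in> sets B \<Longrightarrow> X \<inter> Y = {} \<Longrightarrow> measure M X \<le> measure N X"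
    and E: "E \<in> sets B"
  shows "emeasure (positive_part B (\<lambda>E. measure M E - measure N E)) E
    = ennreal (measure M (E \<inter> Y) - measure N (E \<inter> Y))"
proof -
  interpret M: finite_measure M by fact
  interpret N: finite_measure N by fact
  define \<nu> where "\<nu> E = measure M E - measure N E" for E
  define g where "g E = (SUP F\<in>{F\<in>sets B. F \<subseteq> E}. ennreal (\<nu> F))" for E
  have split: "\<nu> F = \<nu> (F \<inter> Y) + \<nu> (F - Y)" if "F \<in> sets B" for F
    using that Y(1) M.finite_measure_Union[of "F \<inter> Y" "F - Y"] N.finite_measure_Union[of "F \<inter> Y" "F - Y"]
    by (simp add: \<nu>_def sets Int_Diff_Un Int_Diff_disjoint)
  have le: "\<nu> F \<le> \<nu> (E \<inter> Y)" if F: "F \<in> sets B" "F \<subseteq> E" and E: "E \<in> sets B" for E F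
  proof -
    have "\<nu> (F - Y) \<le> 0" using Y(1) Y(3)[of "F - Y"] F unfolding \<nu>_def by auto
    moreover have "\<nu> (E \<inter> Y) = \<nu> (F \<inter> Y) + \<nu> (E \<inter> Y - F)"
    proof -
      have "(F \<inter> Y) \<union> (E \<inter> Y - F) = E \<inter> Y" "(F \<inter> Y) \<inter> (E \<inter> Y - F) = {}" using F by auto
      then show ?thesis
        using F E Y(1) M.finite_measure_Union[of "F \<inter> Y" "E \<inter> Y - F"] N.finite_measure_Union[of "F \<inter> Y" "E \<inter> Y - F"]
        by (simp add: \<nu>_def sets)
    qed
    moreover have "0 \<le> \<nu> (E \<inter> Y - F)" using Y(1) Y(2)[of "E \<inter> Y - F"] F E unfolding \<nu>_def by auto
    ultimately show ?thesis using split[OF F(1)] by linarith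
  qed
  have g: "g E = ennreal (\<nu> (E \<inter> Y))" if "E \<in> sets B" for E
    unfolding g_def using that Y(1) le[OF _ _ that]
    by (intro antisym SUP_least SUP_upper2[of "E \<inter> Y"] ennreal_leI) auto
  have nn: "0 \<le> \<nu> (E \<inter> Y)" if "E \<in> sets B" for E using Y(1) Y(2)[of "E \<inter> Y"] that unfolding \<nu>_def by auto
  have "emeasure (measure_of (space B) (sets B) g) E = g E"
  proof (rule emeasure_measure_of_sigma)
    show "sigma_algebra (space B) (sets B)" by (rule sets.sigma_algebra_axioms)
    show "positive (sets B) g" unfolding positive_def by (auto simp: g \<nu>_def)
    show "countably_additive (sets B) g"
    proof (rule countably_additiveI)
      fix A :: "nat \<Rightarrow> 'a set" assume A: "range A \<subseteq> sets B" "disjoint_family A" "(\<Union>i. A i) \<in> sets B"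
      have A': "range (\<lambda>i. A i \<inter> Y) \<subseteq> sets B" "disjoint_family (\<lambda>i. A i \<inter> Y)"
        using A Y(1) by (auto simp: disjoint_family_on_def)
      have "(\<lambda>i. \<nu> (A i \<inter> Y)) sums \<nu> (\<Union>i. A i \<inter> Y)"
        unfolding \<nu>_def using A' by (intro sums_diff M.finite_measure_UNION N.finite_measure_UNION) (auto simp: sets)
      then have "(\<lambda>i. \<nu> (A i \<inter> Y)) sums \<nu> ((\<Union>i. A i) \<inter> Y)" by simp
      then have "(\<lambda>i. ennreal (\<nu> (A i \<inter> Y))) sums ennreal (\<nu> ((\<Union>i. A i) \<inter> Y))"
        using A nn by (subst sums_ennreal) auto
      then show "(\<Sum>i. g (A i)) = g (\<Union>i. A i)"
        using A by (simp add: g range_subsetD sums_unique[symmetric])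
    qed
  qed fact
  then show ?thesis using g[OF E] unfolding positive_part_def \<nu>_def g_def[abs_def] by simp
qed

text \<open>Two measures that may overlap can differ from the Jordan parts of their difference, but
  only by a common summand. Hence \<open>?P + N = ?Q + M\<close> on sets, which follows by splitting
  along the Hahn set \<open>Y\<close> and its complement \<open>Z\<close>.\<close>

lemma integral_positive_part_diff:
  fixes f :: "'a \<Rightarrow> complex"
  assumes M: "finite_measure M" and N: "finite_measure N" and sets: "sets M = sets B" "sets N = sets B"
    and f: "f \<in> borel_measurable B" "\<And>x. cmod (f x) \<le> K"
  shows "integral\<^sup>L (positive_part B (\<lambda>E. measure M E - measure N E)) f
     - integral\<^sup>L (positive_part B (\<lambda>E. - (measure M E - measure N E))) f
     = integral\<^sup>L M f - integral\<^sup>L N f"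
proof -
  interpret M: finite_measure M by fact
  interpret N: finite_measure N by fact
  let ?P = "positive_part B (\<lambda>E. measure M E - measure N E)"
  let ?Q = "positive_part B (\<lambda>E. - (measure M E - measure N E))"
  have swap: "(\<lambda>E. - (measure M E - measure N E)) = (\<lambda>E. measure N E - measure M E)" by auto
  obtain Y where Y: "Y \<in> sets B" "\<And>X. X \<in> sets B \<Longrightarrow> X \<subseteq> Y \<Longrightarrow> measure N X \<le> measure M X"
      "\<And>X. X \<in> sets B \<Longrightarrow> X \<inter> Y = {} \<Longrightarrow> measure M X \<le> measure N X"
    using finite_unsigned_Hahn_decomposition[OF M N] sets
    by (auto simp: M.emeasure_eq_measure N.emeasure_eq_measure)
  define Z where "Z = space B - Y"
  have Z: "Z \<in> sets B" "\<And>X. X \<in> sets B \<Longrightarrow> X \<subseteq> Z \<Longrightarrow> measure M X \<le> measure N X"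
      "\<And>X. X \<in> sets B \<Longrightarrow> X \<inter> Z = {} \<Longrightarrow> measure N X \<le> measure M X"
  proof -
    show "Z \<in> sets B" unfolding Z_def using Y(1) by simp
    show "measure M X \<le> measure N X" if "X \<in> sets B" "X \<subseteq> Z" for X
      using that unfolding Z_def by (intro Y(3)) auto
    show "measure N X \<le> measure M X" if "X \<in> sets B" "X \<inter> Z = {}" for X
      using that sets.sets_into_space[OF that(1)] unfolding Z_def by (intro Y(2)) auto
  qed
  show ?thesis
  proof (rule integral_sum_eq[where B = B])
    show "finite_measure ?P"
      by (rule finite_positive_part[where K = "measure M (space M)"])
         (metis M.bounded_measure diff_le_eq le_add_same_cancel1 measure_nonneg order_trans)
    show "finite_measure ?Q"
      by (rule finite_positive_part[where K = "measure N (space N)"])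
         (smt (verit) N.bounded_measure measure_nonneg)
    fix E assume E: "E \<in> sets B"
    have EY: "E - Y = E \<inter> Z" using sets.sets_into_space[OF E] unfolding Z_def by auto
    have split: "measure R E = measure R (E \<inter> Y) + measure R (E \<inter> Z)" if "finite_measure R" "sets R = sets B" for R
      using E Y(1) finite_measure.finite_measure_Union[OF that(1), of "E \<inter> Y" "E - Y"]
      by (simp add: that(2) EY[symmetric] Int_Diff_Un Int_Diff_disjoint)
    have p: "emeasure ?P E = ennreal (measure M (E \<inter> Y) - measure N (E \<inter> Y))"
      by (rule emeasure_positive_part_diff[OF M N sets Y E])
    have q: "emeasure ?Q E = ennreal (measure N (E \<inter> Z) - measure M (E \<inter> Z))"
      unfolding swap by (rule emeasure_positive_part_diff[OF N M sets(2,1) Z E])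
    have "0 \<le> measure M (E \<inter> Y) - measure N (E \<inter> Y)" "0 \<le> measure N (E \<inter> Z) - measure M (E \<inter> Z)"
      using Y(2)[of "E \<inter> Y"] Z(2)[of "E \<inter> Z"] Y(1) Z(1) E by auto
    then show "emeasure ?P E + emeasure N E = emeasure ?Q E + emeasure M E"
      unfolding p q M.emeasure_eq_measure N.emeasure_eq_measure
      using split[OF M sets(1)] split[OF N sets(2)]
      by (simp add: ennreal_plus[symmetric] del: ennreal_plus)
  qed (use assms in auto)
qed


section \<open>Regularity of dominated complex measures\<close>

lemma total_variation_le:
  assumes "sets L = sets M" "\<And>E. E \<in> sets M \<Longrightarrow> ennreal (cmod (\<mu> E)) \<le> emeasure L E" "E \<in> sets M"
  shows "total_variation M \<mu> E \<le> emeasure L E"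
  unfolding total_variation_def
proof (rule SUP_least, clarify)
  fix A :: "nat \<Rightarrow> 'a set" assume A: "range A \<subseteq> sets M" "disjoint_family A"
  have "(\<Sum>i. ennreal (cmod (\<mu> (A i)))) \<le> (\<Sum>i. emeasure L (A i))"
    using A assms by (intro suminf_le) auto
  also have "\<dots> = emeasure L (\<Union>i. A i)" using A assms by (intro suminf_emeasure) auto
  finally show "(\<Sum>i. ennreal (cmod (\<mu> (A i)))) \<le> emeasure L (\<Union>i. A i)" .
qed

lemma total_variation_mono:
  assumes "E \<in> sets M" "F \<in> sets M" "F \<subseteq> E"
  shows "total_variation M \<mu> F \<le> total_variation M \<mu> E"
  unfolding total_variation_def[of M \<mu> F]
proof (rule SUP_least, clarify)
  fix A :: "nat \<Rightarrow> 'a set" assume A: "range A \<subseteq> sets M" "disjoint_family A" "F = (\<Union>i. A i)"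
  \<comment> \<open>A partition of \<open>F\<close> becomes one of \<open>E\<close> when
    \<open>E - F\<close> is put in front.\<close>
  define A' where "A' n = (case n of 0 \<Rightarrow> E - F | Suc n \<Rightarrow> A n)" for n
  have "range A' \<subseteq> sets M" using A assms unfolding A'_def by (auto split: nat.split)
  moreover have "disjoint_family A'"
    unfolding disjoint_family_on_def
  proof (intro ballI impI)
    fix m n :: nat assume "m \<noteq> n"
    then show "A' m \<inter> A' n = {}"
      using A(2) unfolding A'_def A(3) disjoint_family_on_def by (cases m; cases n) auto
  qed
  moreover have "(\<Union>i. A' i) = E"
  proof -
    have "(\<Union>i. A' i) = A' 0 \<union> (\<Union>i. A' (Suc i))" by (auto, metis nat.exhaust)
    then show ?thesis using A(3) assms(3) unfolding A'_def by auto
  qed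
  ultimately have "(\<Sum>i. ennreal (cmod (\<mu> (A' i)))) \<le> total_variation M \<mu> E"
    unfolding total_variation_def by (intro SUP_upper) auto
  moreover have "(\<Sum>i. ennreal (cmod (\<mu> (A i)))) \<le> (\<Sum>i. ennreal (cmod (\<mu> (A' i))))"
  proof -
    have "(\<lambda>i. ennreal (cmod (\<mu> (A' (Suc i))))) sums (\<Sum>i. ennreal (cmod (\<mu> (A i))))"
      unfolding A'_def by (simp add: summable_sums summableI)
    from sums_Suc[OF this] show ?thesis by (simp add: sums_iff)
  qed
  ultimately show "(\<Sum>i. ennreal (cmod (\<mu> (A i)))) \<le> total_variation M \<mu> E" by (rule order_trans[rotated])
qed

text \<open>Cut every piece of a partition of \<open>E\<close> along \<open>F\<close>.\<close>

lemma total_variation_subadditive: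
  assumes "E \<in> sets M" "F \<in> sets M" "F \<subseteq> E"
    and add: "\<And>A B. A \<in> sets M \<Longrightarrow> B \<in> sets M \<Longrightarrow> A \<inter> B = {} \<Longrightarrow> \<mu> (A \<union> B) = \<mu> A + \<mu> B"
  shows "total_variation M \<mu> E \<le> total_variation M \<mu> F + total_variation M \<mu> (E - F)"
  unfolding total_variation_def[of M \<mu> E]
proof (rule SUP_least, clarify)
  fix A :: "nat \<Rightarrow> 'a set" assume A: "range A \<subseteq> sets M" "disjoint_family A" "E = (\<Union>i. A i)"
  have "(\<Sum>i. ennreal (cmod (\<mu> (A i)))) \<le> (\<Sum>i. ennreal (cmod (\<mu> (A i \<inter> F))) + ennreal (cmod (\<mu> (A i - F))))"
  proof (rule suminf_le)
    fix i
    have "\<mu> (A i) = \<mu> (A i \<inter> F) + \<mu> (A i - F)"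
      using add[of "A i \<inter> F" "A i - F"] A(1) assms(2) by (simp add: Int_Diff_Un range_subsetD Int_Diff_disjoint)
    then show "ennreal (cmod (\<mu> (A i))) \<le> ennreal (cmod (\<mu> (A i \<inter> F))) + ennreal (cmod (\<mu> (A i - F)))"
      by (simp add: ennreal_plus[symmetric] norm_triangle_ineq del: ennreal_plus)
  qed auto
  also have "\<dots> = (\<Sum>i. ennreal (cmod (\<mu> (A i \<inter> F)))) + (\<Sum>i. ennreal (cmod (\<mu> (A i - F))))"
    by (rule suminf_add[symmetric]) auto
  also have "\<dots> \<le> total_variation M \<mu> F + total_variation M \<mu> (E - F)"
    unfolding total_variation_def using A assms
    by (intro add_mono SUP_upper) (auto simp: disjoint_family_on_def)
  finally show "(\<Sum>i. ennreal (cmod (\<mu> (A i)))) \<le> total_variation M \<mu> F + total_variation M \<mu> ((\<Union>i. A i) - F)"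
    unfolding A(3) .
qed

text \<open>The variation inherits regularity from the finite measure \<open>L\<close>, which is
  regular on a complete separable metric space. If \<open>F\<close> approximates \<open>E\<close>
  from inside up to \<open>e\<close> in \<open>L\<close>, the variation of \<open>E - F\<close> is
  at most \<open>e\<close> too; this is \<open>near\<close>, used for outer and inner approximation
  alike.\<close>

lemma dominated_complex_measure_regular:
  fixes \<mu> :: "'a::{second_countable_topology, complete_space} set \<Rightarrow> complex"
  assumes \<mu>: "complex_measure borel \<mu>"
    and add: "\<And>A B. A \<in> sets borel \<Longrightarrow> B \<in> sets borel \<Longrightarrow> A \<inter> B = {} \<Longrightarrow> \<mu> (A \<union> B) = \<mu> A + \<mu> B"
    and L: "finite_measure L" "sets L = sets borel"
    and dom: "\<And>E. E \<in> sets borel \<Longrightarrow> cmod (\<mu> E) \<le> measure L E"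
  shows "finite_regular_complex_borel_measure \<mu>"
proof -
  interpret L: finite_measure L by fact
  let ?V = "total_variation borel \<mu>"
  have V: "?V E \<le> emeasure L E" if "E \<in> sets borel" for E
    using dom that L(2) by (intro total_variation_le) (auto simp: L.emeasure_eq_measure intro: ennreal_leI)
  have spL: "space L = UNIV" using L(2) by (metis sets_eq_imp_space_eq space_borel)
  have Lfin: "emeasure L A \<noteq> \<infinity>" for A by simp
  have near: "?V E \<le> ?V F + ennreal e"
    if "E \<in> sets borel" "F \<in> sets borel" "F \<subseteq> E" "emeasure L E \<le> emeasure L F + ennreal e" for E F e
  proof -
    have "emeasure L (E - F) \<le> ennreal e"
      using that L(2) Lfin by (subst emeasure_Diff) (auto simp: ennreal_minus_le_iff add.commute)
    then have "?V (E - F) \<le> ennreal e" using V[of "E - F"] that by auto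
    then show ?thesis using total_variation_subadditive[OF that(1-3) add] by (meson add_left_mono order_trans)
  qed
  have "?V E = (INF U\<in>{U. open U \<and> E \<subseteq> U}. ?V U) \<and> ?V E = (SUP K\<in>{K. compact K \<and> K \<subseteq> E}. ?V K)"
    if E: "E \<in> sets borel" for E
  proof
    show "?V E = (INF U\<in>{U. open U \<and> E \<subseteq> U}. ?V U)"
    proof (rule ennreal_approx_INF)
      fix e :: real assume "0 < e"
      have "emeasure L E < emeasure L E + ennreal e" using Lfin[of E] \<open>0 < e\<close> by (simp add: L.emeasure_eq_measure ennreal_plus[symmetric] ennreal_less_iff del: ennreal_plus)
      then obtain U where "open U" "E \<subseteq> U" "emeasure L U < emeasure L E + ennreal e"
        using outer_regular[OF L(2) Lfin E] by (auto simp: INF_less_iff)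
      then show "\<exists>U\<in>{U. open U \<and> E \<subseteq> U}. ?V U \<le> ?V E + ennreal e"
        using near[of U E e] E by (intro bexI[of _ U]) auto
    qed (use E in \<open>auto intro: total_variation_mono\<close>)
    show "?V E = (SUP K\<in>{K. compact K \<and> K \<subseteq> E}. ?V K)"
    proof (rule ennreal_approx_SUP)
      fix e :: real assume "0 < e"
      have "\<exists>K. compact K \<and> K \<subseteq> E \<and> emeasure L E \<le> emeasure L K + ennreal e"
      \<comment> \<open>For \<open>measure L E \<le> e\<close> the number
        \<open>measure L E - e\<close> is truncated to 0 in \<open>ennreal\<close>, and no strict
        inequality can be expected; the empty set serves instead.\<close>
      proof (cases "measure L E \<le> e")
        case True
        then show ?thesis by (intro exI[of _ "{}"]) (simp add: L.emeasure_eq_measure ennreal_leI)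
      next
        case False
        then have "ennreal (measure L E - e) < emeasure L E"
          using \<open>0 < e\<close> by (simp add: L.emeasure_eq_measure ennreal_less_iff)
        then obtain K where K: "compact K" "K \<subseteq> E" "ennreal (measure L E - e) < emeasure L K"
          using inner_regular[OF L(2) Lfin E] by (auto simp: less_SUP_iff)
        then have "measure L E \<le> measure L K + e"
          using False by (simp add: L.emeasure_eq_measure ennreal_less_iff)
        then have "ennreal (measure L E) \<le> ennreal (measure L K + e)" by (rule ennreal_leI)
        then show ?thesis
          using K \<open>0 < e\<close> by (intro exI[of _ K]) (simp add: L.emeasure_eq_measure)
      qed
      then obtain K where "compact K" "K \<subseteq> E" "emeasure L E \<le> emeasure L K + ennreal e" by blast
      then show "\<exists>K\<in>{K. compact K \<and> K \<subseteq> E}. ?V E \<le> ?V K + ennreal e"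
        using near[of E K e] E by (intro bexI[of _ K]) (auto intro: borel_compact)
    qed (use E V Lfin in \<open>auto intro: total_variation_mono borel_compact simp: top_unique\<close>)
  qed
  moreover have "?V UNIV < \<infinity>"
    using V[of UNIV] Lfin[of UNIV] by (auto simp: less_top[symmetric] top_unique)
  ultimately show ?thesis unfolding finite_regular_complex_borel_measure_def using \<mu> by blast
qed

lemma sum_measure_exists:
  assumes "finite_measure M" "finite_measure N" "sets M = sets B" "sets N = sets B"
  shows "\<exists>L. finite_measure L \<and> sets L = sets B \<and> (\<forall>E\<in>sets B. measure L E = measure M E + measure N E)"
proof -
  interpret M: finite_measure M by fact
  interpret N: finite_measure N by fact
  define L where "L = measure_of (space B) (sets B) (\<lambda>E. emeasure M E + emeasure N E)"
  have L: "emeasure L E = emeasure M E + emeasure N E" if "E \<in> sets B" for E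
    unfolding L_def
  proof (rule emeasure_measure_of_sigma)
    show "countably_additive (sets B) (\<lambda>E. emeasure M E + emeasure N E)"
      using assms by (intro countably_additiveI) (auto simp: suminf_add[symmetric] suminf_emeasure)
  qed (auto simp: positive_def sets.sigma_algebra_axioms that)
  have s: "sets L = sets B" unfolding L_def by (simp add: sets.space_closed)
  have "finite_measure L"
  proof (rule finite_measureI)
    have "space L \<in> sets B" using sets.top[of L] s by simp
    then show "emeasure L (space L) \<noteq> \<infinity>" using L by simp
  qed
  moreover have "measure L E = measure M E + measure N E" if "E \<in> sets B" for E
    using L[OF that] unfolding measure_def
    by (simp add: enn2real_plus M.emeasure_eq_measure N.emeasure_eq_measure less_top[symmetric])
  ultimately show ?thesis using s by blast
qed

theorem complex_measure_of_finite_measures: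
  fixes M1 N1 M2 N2 :: "'a::{second_countable_topology, complete_space} measure"
  assumes fin: "finite_measure M1" "finite_measure N1" "finite_measure M2" "finite_measure N2"
    and sets: "sets M1 = sets borel" "sets N1 = sets borel" "sets M2 = sets borel" "sets N2 = sets borel"
  defines "\<mu> \<equiv> \<lambda>E. Complex (measure M1 E - measure N1 E) (measure M2 E - measure N2 E)"
  shows "finite_regular_complex_borel_measure \<mu>"
    and "f \<in> borel_measurable borel \<Longrightarrow> (\<And>x. cmod (f x) \<le> K) \<Longrightarrow> complex_measure_integral borel \<mu> f
      = integral\<^sup>L M1 f - integral\<^sup>L N1 f + \<i> * (integral\<^sup>L M2 f - integral\<^sup>L N2 f)"
proof -
  note sums = finite_measure.finite_measure_UNION
  obtain L1 where L1: "finite_measure L1" "sets L1 = sets borel"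
      "\<And>E. E \<in> sets borel \<Longrightarrow> measure L1 E = measure M1 E + measure N1 E"
    using sum_measure_exists[OF fin(1,2) sets(1,2)] by blast
  obtain L2 where L2: "finite_measure L2" "sets L2 = sets borel"
      "\<And>E. E \<in> sets borel \<Longrightarrow> measure L2 E = measure M2 E + measure N2 E"
    using sum_measure_exists[OF fin(3,4) sets(3,4)] by blast
  \<comment> \<open>The sum of all four measures dominates the modulus of the complex
    measure.\<close>
  obtain L where L: "finite_measure L" "sets L = sets borel"
      "\<And>E. E \<in> sets borel \<Longrightarrow> measure L E = measure L1 E + measure L2 E"
    using sum_measure_exists[OF L1(1) L2(1) L1(2) L2(2)] by blast
  show "finite_regular_complex_borel_measure \<mu>"
  proof (rule dominated_complex_measure_regular[OF _ _ L(1,2)])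
    show "complex_measure borel \<mu>"
      unfolding complex_measure_def \<mu>_def sums_complex_iff complex.sel
      by (intro allI impI conjI sums_diff sums[OF fin(1)] sums[OF fin(2)] sums[OF fin(3)] sums[OF fin(4)])
         (auto simp: sets)
    show "\<mu> (A \<union> B) = \<mu> A + \<mu> B" if "A \<in> sets borel" "B \<in> sets borel" "A \<inter> B = {}" for A B
      using that finite_measure.finite_measure_Union[OF fin(1), of A B] finite_measure.finite_measure_Union[OF fin(2), of A B]
        finite_measure.finite_measure_Union[OF fin(3), of A B] finite_measure.finite_measure_Union[OF fin(4), of A B]
      by (simp add: \<mu>_def sets complex_eq_iff)
    show "cmod (\<mu> E) \<le> measure L E" if "E \<in> sets borel" for E
    proof -
      have "cmod (\<mu> E) \<le> \<bar>measure M1 E - measure N1 E\<bar> + \<bar>measure M2 E - measure N2 E\<bar>"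
        using cmod_le[of "\<mu> E"] by (simp add: \<mu>_def)
      also have "\<dots> \<le> (measure M1 E + measure N1 E) + (measure M2 E + measure N2 E)"
        by (intro add_mono) (simp_all add: abs_le_iff)
      finally show ?thesis using L(3) L1(3) L2(3) that by simp
    qed
  qed
  assume f: "f \<in> borel_measurable borel" "\<And>x. cmod (f x) \<le> K"
  show "complex_measure_integral borel \<mu> f
      = integral\<^sup>L M1 f - integral\<^sup>L N1 f + \<i> * (integral\<^sup>L M2 f - integral\<^sup>L N2 f)"
    unfolding complex_measure_integral_def \<mu>_def complex.sel
    using integral_positive_part_diff[OF fin(1,2) sets(1,2) f] integral_positive_part_diff[OF fin(3,4) sets(3,4) f]
    by simp
qed


section \<open>Continuity and order of tempered distributions\<close>

lemma tempered_add:
  "tempered_distribution T \<Longrightarrow> f \<in> schwartz \<Longrightarrow> g \<in> schwartz \<Longrightarrow> T (\<lambda>p. f p + g p) = T f + T g"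
  unfolding tempered_distribution_def by blast

lemma tempered_cmult:
  "tempered_distribution T \<Longrightarrow> f \<in> schwartz \<Longrightarrow> T (\<lambda>p. c * f p) = c * T f"
  unfolding tempered_distribution_def by blast

lemma schwartz_seminorm_mono:
  assumes "f \<in> schwartz" "k \<le> l"
  shows "schwartz_seminorm k \<alpha> f \<le> schwartz_seminorm l \<alpha> f"
proof (rule schwartz_seminorm_least)
  fix p
  have "(1 + norm p) ^ k * cmod (multi_deriv \<alpha> f p) \<le> (1 + norm p) ^ l * cmod (multi_deriv \<alpha> f p)"
    using assms(2) by (intro mult_right_mono power_increasing) auto
  also have "\<dots> \<le> schwartz_seminorm l \<alpha> f" by (rule schwartz_seminorm_upper[OF assms(1)])
  finally show "(1 + norm p) ^ k * cmod (multi_deriv \<alpha> f p) \<le> schwartz_seminorm l \<alpha> f" .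
qed

lemma finite_multi_indices: "finite {\<alpha> :: 4 \<Rightarrow> nat. (\<Sum>i\<in>UNIV. \<alpha> i) \<le> N}"
proof (rule finite_subset)
  have "\<alpha> i \<le> N" if "(\<Sum>i\<in>UNIV. \<alpha> i) \<le> N" for \<alpha> :: "4 \<Rightarrow> nat" and i
    using member_le_sum[of i UNIV \<alpha>] that by simp
  then show "{\<alpha> :: 4 \<Rightarrow> nat. (\<Sum>i\<in>UNIV. \<alpha> i) \<le> N} \<subseteq> PiE UNIV (\<lambda>_. {..N})" by auto
qed (intro finite_PiE; simp)

text \<open>One number bounds the weight exponent and the number of derivatives, matching
  \<open>order_bound\<close>.\<close>

definition seminorm_ball :: "nat \<Rightarrow> real \<Rightarrow> (mink \<Rightarrow> complex) set" where
  "seminorm_ball N e = {g \<in> schwartz. \<forall>\<alpha>. (\<Sum>i\<in>UNIV. \<alpha> i) \<le> N \<longrightarrow> schwartz_seminorm N \<alpha> g < e}"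

lemma seminorm_ball_mono: "M \<le> N \<Longrightarrow> d \<le> e \<Longrightarrow> seminorm_ball N d \<subseteq> seminorm_ball M e"
  unfolding seminorm_ball_def
  by (auto intro: le_less_trans[OF schwartz_seminorm_mono] dest: order_trans intro: less_le_trans)

text \<open>Subbasic sets are centred at arbitrary \<open>f\<close>. By the triangle inequality, the
  slack left at 0 is a radius for a ball about 0.\<close>

lemma subbasic_seminorm_ball:
  assumes f: "f \<in> schwartz" and e: "schwartz_seminorm k \<alpha> (\<lambda>p. 0 - f p) < e"
  shows "\<exists>N d. 0 < d \<and> seminorm_ball N d \<subseteq> {g \<in> schwartz. schwartz_seminorm k \<alpha> (\<lambda>p. g p - f p) < e}"
proof (intro exI conjI)
  define d where "d = e - schwartz_seminorm k \<alpha> (\<lambda>p. 0 - f p)"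
  show "0 < d" unfolding d_def using e by simp
  let ?N = "max k (\<Sum>i\<in>UNIV. \<alpha> i)"
  have f': "(\<lambda>p. 0 - f p) \<in> schwartz" using schwartz_cmult(1)[OF f, of "-1"] by simp
  show "seminorm_ball ?N d \<subseteq> {g \<in> schwartz. schwartz_seminorm k \<alpha> (\<lambda>p. g p - f p) < e}"
  proof
    fix g assume "g \<in> seminorm_ball ?N d"
    then have g: "g \<in> schwartz" "schwartz_seminorm ?N \<alpha> g < d" unfolding seminorm_ball_def by auto
    have "schwartz_seminorm k \<alpha> (\<lambda>p. g p + (0 - f p)) \<le> schwartz_seminorm k \<alpha> g + schwartz_seminorm k \<alpha> (\<lambda>p. 0 - f p)"
      by (rule schwartz_add(2)[OF g(1) f'])
    moreover have "schwartz_seminorm k \<alpha> g < d"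
      using schwartz_seminorm_mono[OF g(1), of k ?N \<alpha>] g(2) by simp
    ultimately show "g \<in> {g \<in> schwartz. schwartz_seminorm k \<alpha> (\<lambda>p. g p - f p) < e}"
      using g(1) unfolding d_def by simp
  qed
qed

lemma zero_nhd_contains_seminorm_ball:
  assumes "openin schwartz_topology U" "(\<lambda>p. 0) \<in> U"
  shows "\<exists>N e. 0 < e \<and> seminorm_ball N e \<subseteq> U"
proof -
  have "generate_topology_on
     {{g \<in> schwartz. schwartz_seminorm k \<alpha> (\<lambda>p. g p - f p) < \<epsilon>} | k \<alpha> f \<epsilon>. f \<in> schwartz \<and> \<epsilon> > 0} U"
    using assms(1) unfolding schwartz_topology_def by (rule openin_topology_generated_by)
  then show ?thesis using assms(2)
  proof induction
    case (Int a b)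
    obtain M d where a: "0 < d" "seminorm_ball M d \<subseteq> a" using Int by auto
    obtain N e where b: "0 < e" "seminorm_ball N e \<subseteq> b" using Int by auto
    have "seminorm_ball (max M N) (min d e) \<subseteq> seminorm_ball M d" "seminorm_ball (max M N) (min d e) \<subseteq> seminorm_ball N e"
      by (intro seminorm_ball_mono; simp)+
    then have "seminorm_ball (max M N) (min d e) \<subseteq> a \<inter> b" using a(2) b(2) by blast
    moreover have "0 < min d e" using a(1) b(1) by simp
    ultimately show ?case by blast
  next
    case (UN K)
    then obtain k where k: "k \<in> K" "(\<lambda>p. 0) \<in> k" by blast
    from UN.IH[OF this] obtain N e where "0 < e" "seminorm_ball N e \<subseteq> k" by blast
    then show ?case using k(1) by blast
  next
    case (Basis s)
    then obtain k \<alpha> f e where s: "s = {g \<in> schwartz. schwartz_seminorm k \<alpha> (\<lambda>p. g p - f p) < e}" "f \<in> schwartz"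
      by blast
    have "schwartz_seminorm k \<alpha> (\<lambda>p. 0 - f p) < e" using Basis.prems unfolding s(1) by simp
    from subbasic_seminorm_ball[OF s(2) this] show ?case unfolding s(1) .
  qed simp
qed

lemma topspace_schwartz: "topspace schwartz_topology = schwartz"
proof -
  have *: "f \<in> {g \<in> schwartz. schwartz_seminorm 0 (\<lambda>_. 0) (\<lambda>p. g p - f p) < 1}" if "f \<in> schwartz" for f
  proof -
    have "schwartz_seminorm 0 (\<lambda>_. 0) (\<lambda>p. f p - f p) \<le> cmod 0 * schwartz_seminorm 0 (\<lambda>_. 0) f"
      using schwartz_cmult(2)[OF that, of 0 "\<lambda>_. 0" 0] by simp
    then show ?thesis using that by auto
  qed
  show ?thesis unfolding schwartz_topology_def topology_generated_by_topspace
  proof (intro equalityI subsetI)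
    fix f assume f: "f \<in> schwartz"
    show "f \<in> \<Union>{{g \<in> schwartz. schwartz_seminorm k \<alpha> (\<lambda>p. g p - f p) < \<epsilon>} | k \<alpha> f \<epsilon>. f \<in> schwartz \<and> \<epsilon> > 0}"
      by (rule UnionI[OF _ *[OF f]], rule CollectI)
         (intro exI[of _ 0] exI[of _ "\<lambda>_. 0"] exI[of _ f] exI[of _ 1] conjI refl f zero_less_one)
  qed auto
qed

text \<open>Continuity makes \<open>T\<close> bounded by 1 on a seminorm ball about 0; scaling
  \<open>f\<close> into the ball gives the bound.\<close>

lemma tempered_order_bound:
  assumes T: "tempered_distribution T" shows "\<exists>N. order_bound T N"
proof -
  define U where "U = {f \<in> schwartz. T f \<in> ball 0 1}"
  have "continuous_map schwartz_topology euclidean T" using T unfolding tempered_distribution_def by blast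
  then have "openin schwartz_topology {f \<in> topspace schwartz_topology. T f \<in> ball 0 1}"
    by (rule openin_continuous_map_preimage) simp
  then have "openin schwartz_topology U" unfolding U_def topspace_schwartz .
  moreover have "T (\<lambda>p. 0) = 0" using tempered_cmult[OF T zero_schwartz, of 0] by simp
  then have "(\<lambda>p. 0) \<in> U" unfolding U_def using zero_schwartz by simp
  ultimately obtain N e where e: "0 < e" "seminorm_ball N e \<subseteq> U"
    using zero_nhd_contains_seminorm_ball by blast
  have "cmod (T f) \<le> (1 / e) * (\<Sum>\<alpha> | (\<Sum>i\<in>UNIV. \<alpha> i) \<le> N. schwartz_seminorm N \<alpha> f)" if f: "f \<in> schwartz" for f
  proof -
    define s where "s = (\<Sum>\<alpha> | (\<Sum>i\<in>UNIV. \<alpha> i) \<le> N. schwartz_seminorm N \<alpha> f)"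
    have s: "schwartz_seminorm N \<alpha> f \<le> s" if "(\<Sum>i\<in>UNIV. \<alpha> i) \<le> N" for \<alpha>
      unfolding s_def using that f
      by (intro member_le_sum finite_multi_indices schwartz_seminorm_nonneg) auto
    have "0 \<le> s" unfolding s_def using f by (intro sum_nonneg schwartz_seminorm_nonneg)
    have "cmod (T f) \<le> s / e + r" if "0 < r" for r
    proof -
      \<comment> \<open>The slack \<open>r\<close> covers the case \<open>s = 0\<close> and makes
        the ball condition strict; \<open>1 / c\<close> is then \<open>s / e + r\<close>, and
        \<open>r\<close> tends to 0.\<close>
      define c where "c = e / (s + r * e)"
      have pos: "0 < s + r * e" using \<open>0 \<le> s\<close> \<open>0 < r\<close> e(1) by (simp add: add_nonneg_pos)
      then have "0 < c" unfolding c_def using e(1) by simp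
      have "(\<lambda>p. of_real c * f p) \<in> seminorm_ball N e"
        unfolding seminorm_ball_def
      proof (intro CollectI conjI allI impI schwartz_cmult(1)[OF f])
        fix \<alpha> :: "4 \<Rightarrow> nat" assume "(\<Sum>i\<in>UNIV. \<alpha> i) \<le> N"
        have "schwartz_seminorm N \<alpha> (\<lambda>p. of_real c * f p) \<le> c * schwartz_seminorm N \<alpha> f"
          using schwartz_cmult(2)[OF f, of N \<alpha> "of_real c"] \<open>0 < c\<close> by simp
        also have "\<dots> \<le> c * s" using s[OF \<open>_ \<le> N\<close>] \<open>0 < c\<close> by (intro mult_left_mono) auto
        also have "\<dots> < c * (s + r * e)" using \<open>0 < c\<close> \<open>0 < r\<close> e(1) by simp
        also have "\<dots> = e" unfolding c_def using pos by simp
        finally show "schwartz_seminorm N \<alpha> (\<lambda>p. of_real c * f p) < e" .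
      qed
      then have "cmod (T (\<lambda>p. of_real c * f p)) < 1" using e(2) unfolding U_def by auto
      then have "c * cmod (T f) < 1" using tempered_cmult[OF T f] \<open>0 < c\<close> by (simp add: norm_mult)
      then have "cmod (T f) < 1 / c" using \<open>0 < c\<close> by (simp add: field_simps)
      also have "1 / c = s / e + r" unfolding c_def using e(1) pos by (simp add: field_simps)
      finally show ?thesis by simp
    qed
    then have "cmod (T f) \<le> s / e" by (rule field_le_epsilon)
    then show ?thesis unfolding s_def by simp
  qed
  then show ?thesis unfolding order_bound_def using e(1) by (intro exI[of _ N] exI[of _ "1 / e"]) auto
qed

lemma order_bound_0_iff:
  "order_bound T 0 \<longleftrightarrow> (\<exists>C>0. \<forall>f\<in>schwartz. cmod (T f) \<le> C * schwartz_seminorm 0 (\<lambda>_. 0) f)"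
proof -
  have "{\<alpha> :: 4 \<Rightarrow> nat. (\<Sum>i\<in>UNIV. \<alpha> i) \<le> 0} = {\<lambda>_. 0}" by (auto simp: fun_eq_iff)
  then show ?thesis unfolding order_bound_def by simp
qed

lemma schwartz_seminorm_0_upper: "f \<in> schwartz \<Longrightarrow> cmod (f p) \<le> schwartz_seminorm 0 (\<lambda>_. 0) f"
  using schwartz_seminorm_upper[of f p 0 "\<lambda>_. 0"] by (simp add: multi_deriv_zero)

lemma schwartz_seminorm_0_least: "(\<And>p. cmod (f p) \<le> B) \<Longrightarrow> schwartz_seminorm 0 (\<lambda>_. 0) f \<le> B"
  by (rule schwartz_seminorm_least) (simp add: multi_deriv_zero)

text \<open>The constant \<open>C\<close> survives because cutting off does not increase the
  supremum norm, while the finite-order bound of \<open>T\<close> makes the value at the error at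
  most a fixed multiple of \<open>1 / (n + 1)\<close>.\<close>

lemma tempered_bound_extends:
  assumes T: "tempered_distribution T"
    and test: "\<And>f B. f \<in> test_functions \<Longrightarrow> (\<And>p. cmod (f p) \<le> B) \<Longrightarrow> cmod (T f) \<le> C * B"
    and f: "f \<in> schwartz"
  shows "cmod (T f) \<le> C * schwartz_seminorm 0 (\<lambda>_. 0) f"
proof -
  define g where "g n p = (1 + - 1 * dilated_bump n p) * f p" for n p
  have g: "g n \<in> schwartz" for n unfolding g_def[abs_def] by (rule cutoff_error_schwartz(1)[OF f])
  obtain N K where "0 < K" and K: "\<And>f. f \<in> schwartz \<Longrightarrow>
      cmod (T f) \<le> K * (\<Sum>\<alpha> | (\<Sum>i\<in>UNIV. \<alpha> i) \<le> N. schwartz_seminorm N \<alpha> f)"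
    using tempered_order_bound[OF T] unfolding order_bound_def by blast
  have "\<forall>\<alpha>. \<exists>B. \<forall>n. schwartz_seminorm N \<alpha> (g n) \<le> B * inverse (real (Suc n))"
    unfolding g_def[abs_def] using cutoff_error_schwartz(2)[OF f] by blast
  then obtain B where B: "\<And>\<alpha> n. schwartz_seminorm N \<alpha> (g n) \<le> B \<alpha> * inverse (real (Suc n))" by metis
  define b where "b = K * (\<Sum>\<alpha> | (\<Sum>i\<in>UNIV. \<alpha> i) \<le> N. B \<alpha>)"
  have "cmod (T f) \<le> C * schwartz_seminorm 0 (\<lambda>_. 0) f + b * inverse (real (Suc n))" for n
  proof -
    define h where "h p = dilated_bump n p * f p" for p
    have h: "h \<in> test_functions"
      unfolding h_def[abs_def] by (rule dilated_bump_test_function[OF schwartz_smooth[OF f]])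
    have "f = (\<lambda>p. h p + g n p)" unfolding h_def g_def by (auto simp: algebra_simps)
    then have "T f = T h + T (g n)"
      using tempered_add[OF T _ g, of h n] h test_functions_schwartz by auto
    then have "cmod (T f) \<le> cmod (T h) + cmod (T (g n))" by (simp add: norm_triangle_ineq)
    also have "cmod (T h) \<le> C * schwartz_seminorm 0 (\<lambda>_. 0) f"
    proof (rule test[OF h])
      fix p
      have "cmod (h p) \<le> 1 * cmod (f p)"
        unfolding h_def norm_mult by (intro mult_right_mono dilated_bump_norm) auto
      then show "cmod (h p) \<le> schwartz_seminorm 0 (\<lambda>_. 0) f"
        using schwartz_seminorm_0_upper[OF f, of p] by simp
    qed
    also have "cmod (T (g n)) \<le> K * (\<Sum>\<alpha> | (\<Sum>i\<in>UNIV. \<alpha> i) \<le> N. B \<alpha> * inverse (real (Suc n)))"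
      using \<open>0 < K\<close> by (intro order_trans[OF K[OF g]] mult_left_mono sum_mono B) auto
    also have "\<dots> = b * inverse (real (Suc n))" unfolding b_def by (simp add: sum_distrib_right)
    finally show ?thesis by simp
  qed
  moreover have "(\<lambda>n. C * schwartz_seminorm 0 (\<lambda>_. 0) f + b * inverse (real (Suc n)))
      \<longlonglongrightarrow> C * schwartz_seminorm 0 (\<lambda>_. 0) f + b * 0"
    by (intro tendsto_intros LIMSEQ_inverse_real_of_nat)
  ultimately show ?thesis
    using LIMSEQ_le_const[of _ _ "cmod (T f)"] by (metis (no_types, lifting) add.right_neutral mult_zero_right)
qed

lemma finite_measure_imp_order_bound_0:
  assumes T: "tempered_distribution T" and "defines_finite_measure T"
  shows "order_bound T 0"
proof -
  obtain \<mu> where \<mu>: "finite_regular_complex_borel_measure \<mu>"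
    and eq: "\<And>f. f \<in> test_functions \<Longrightarrow> T f = complex_measure_integral borel \<mu> f"
    using assms(2) unfolding defines_finite_measure_def by blast
  obtain C where C: "\<And>f B. 0 \<le> B \<Longrightarrow> (\<forall>x. cmod (f x) \<le> B) \<Longrightarrow> cmod (complex_measure_integral borel \<mu> f) \<le> C * B"
  proof -
    have "total_variation borel \<mu> (space borel) < \<infinity>"
      using \<mu> unfolding finite_regular_complex_borel_measure_def space_borel by blast
    from complex_measure_integral_bounded[OF this] show ?thesis using that by blast
  qed
  have "cmod (T f) \<le> C * B" if "f \<in> test_functions" "\<And>p. cmod (f p) \<le> B" for f B
    using C[of B f] eq[OF that(1)] that(2) order_trans[OF norm_ge_zero that(2)] by auto
  from tempered_bound_extends[OF T this]
  have *: "cmod (T f) \<le> C * schwartz_seminorm 0 (\<lambda>_. 0) f" if "f \<in> schwartz" for f using that by blast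
  \<comment> \<open>\<open>order_bound\<close> asks for a positive constant, and \<open>C\<close>
    might be zero or negative.\<close>
  have "cmod (T f) \<le> (\<bar>C\<bar> + 1) * schwartz_seminorm 0 (\<lambda>_. 0) f" if "f \<in> schwartz" for f
    by (rule order_trans[OF *[OF that] mult_right_mono]) (auto intro: schwartz_seminorm_nonneg[OF that])
  then show ?thesis unfolding order_bound_0_iff by (intro exI[of _ "\<bar>C\<bar> + 1"]) auto
qed


section \<open>Distributions of order zero\<close>

definition real_test_functions :: "(mink \<Rightarrow> real) set" where
  "real_test_functions = {u. (\<lambda>p. of_real (u p)) \<in> test_functions}"

text \<open>Real-linear maps commute with partial derivatives; meant for real and imaginary
  parts.\<close>

lemma smooth_bounded_linear:
  assumes A: "bounded_linear A" and f: "smooth f" shows "smooth (\<lambda>p. A (f p))"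
proof (rule smooth_coinduct[where S = "(\<lambda>f p. A (f p)) ` Collect smooth"])
  show "(\<lambda>p. A (f p)) \<in> (\<lambda>f p. A (f p)) ` Collect smooth" using f by simp
next
  fix g assume "g \<in> (\<lambda>f p. A (f p)) ` Collect smooth"
  then obtain f where g: "g = (\<lambda>p. A (f p))" "smooth f" by (rule imageE) simp
  show "continuous_on UNIV g"
    unfolding g by (rule bounded_linear.continuous_on[OF A smooth_continuous[OF g(2)]])
  fix i
  have "has_partial i g (A (partial i f p)) p" for p
    using bounded_linear.has_vector_derivative[OF A smooth_has_partial[OF g(2), unfolded has_partial_def]]
    unfolding has_partial_def g .
  then show "\<exists>g'\<in>(\<lambda>f p. A (f p)) ` Collect smooth. \<forall>p. has_partial i g (g' p) p"
    using smooth_partial[OF g(2), of i] by (intro bexI[of _ "\<lambda>p. A (partial i f p)"]) simp_all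
qed

lemma Re_Im_test_function:
  assumes "f \<in> test_functions"
  shows "(\<lambda>p. Re (f p)) \<in> real_test_functions" "(\<lambda>p. Im (f p)) \<in> real_test_functions"
proof -
  obtain R where f: "smooth f" "\<And>p. R < norm p \<Longrightarrow> f p = 0" using assms unfolding test_functions_iff by auto
  have "bounded_linear (\<lambda>z. complex_of_real (Re z))" "bounded_linear (\<lambda>z. complex_of_real (Im z))"
    by (intro bounded_linear_compose[OF bounded_linear_of_real] bounded_linear_Re bounded_linear_Im)+
  from this[THEN smooth_bounded_linear[OF _ f(1)]] f(2)
  show "(\<lambda>p. Re (f p)) \<in> real_test_functions" "(\<lambda>p. Im (f p)) \<in> real_test_functions"
    unfolding real_test_functions_def test_functions_iff by (auto intro!: exI[of _ R])
qed

lemma real_test_functions_Cc: "real_test_functions \<subseteq> Cc"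
proof
  fix u assume "u \<in> real_test_functions"
  then obtain R where u: "smooth (\<lambda>p. of_real (u p))" "\<And>p. R < norm p \<Longrightarrow> u p = 0"
    unfolding real_test_functions_def test_functions_iff by auto
  have "continuous_on UNIV (\<lambda>p. Re (of_real (u p)))" by (intro continuous_on_Re smooth_continuous u(1))
  then show "u \<in> Cc" using u(2) by (intro CcI[where R = R]) auto
qed

lemma test_functions_add: "f \<in> test_functions \<Longrightarrow> g \<in> test_functions \<Longrightarrow> (\<lambda>p. f p + g p) \<in> test_functions"
proof -
  assume f: "f \<in> test_functions" and g: "g \<in> test_functions"
  obtain R where R: "\<And>p. R < norm p \<Longrightarrow> f p = 0" using f unfolding test_functions_iff by auto
  obtain S where S: "\<And>p. S < norm p \<Longrightarrow> g p = 0" using g unfolding test_functions_iff by auto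
  show ?thesis using f g R S unfolding test_functions_iff
    by (auto intro: smooth_add intro!: exI[of _ "max R S"])
qed

lemma test_functions_cmult: "f \<in> test_functions \<Longrightarrow> (\<lambda>p. c * f p) \<in> test_functions"
  unfolding test_functions_iff by (auto intro: smooth_mult[OF smooth_const])

text \<open>Smooth functions form an algebra in which the coordinates separate points, so
  Stone-Weierstrass gives a smooth \<open>g\<close> close to \<open>f\<close> on a ball. A dilated
  bump that is 1 where \<open>f\<close> lives and 0 outside the ball makes the support compact; the
  error becomes \<open>b * (f - g)\<close>.\<close>

lemma real_test_functions_dense:
  assumes f: "f \<in> Cc" and e: "0 < e"
  shows "\<exists>u\<in>real_test_functions. \<forall>p. \<bar>f p - u p\<bar> \<le> e"
proof -
  obtain R where R: "0 < R" "\<And>x. R < norm x \<Longrightarrow> f x = 0" using Cc_supportE[OF f] by blast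
  obtain n :: nat where "R \<le> n" using real_arch_simple by blast
  then have n: "R \<le> Suc n" by simp
  let ?K = "cball 0 (2 * real (Suc n)) :: mink set"
  have "\<exists>g. smooth (\<lambda>p. of_real (g p)) \<and> (\<forall>x\<in>?K. \<bar>f x - g x\<bar> < e)"
  proof (rule Stone_Weierstrass_HOL[where P = "\<lambda>g. smooth (\<lambda>p. of_real (g p))"])
    show "continuous_on ?K g" if "smooth (\<lambda>p. of_real (g p))" for g
    proof -
      have "continuous_on UNIV (\<lambda>p. Re (of_real (g p)))" by (intro continuous_on_Re smooth_continuous that)
      then show ?thesis by (auto intro: continuous_on_subset)
    qed
    show "\<exists>g. smooth (\<lambda>p. of_real (g p)) \<and> g x \<noteq> g y" if xy: "x \<in> ?K \<and> y \<in> ?K \<and> x \<noteq> y" for x y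
    proof -
      obtain j where "x $ j \<noteq> y $ j" using xy by (metis vec_eq_iff)
      then show ?thesis using smooth_coord by (intro exI[of _ "\<lambda>p. p $ j"]) simp
    qed
    show "continuous_on ?K f" using Cc_continuous[OF f] by (rule continuous_on_subset) simp
  qed (use e smooth_const smooth_add smooth_mult in simp_all)
  then obtain g where g: "smooth (\<lambda>p. of_real (g p))" "\<And>x. x \<in> ?K \<Longrightarrow> \<bar>f x - g x\<bar> < e" by blast
  define b where "b p = bump (inverse (real (Suc n)) *\<^sub>R p)" for p
  have b: "dilated_bump n p = of_real (b p)" for p unfolding dilated_bump_def b_def ..
  have "(\<lambda>p. dilated_bump n p * of_real (g p)) \<in> test_functions" by (rule dilated_bump_test_function[OF g(1)])
  then have "(\<lambda>p. b p * g p) \<in> real_test_functions" unfolding real_test_functions_def by (simp add: b)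
  moreover have "\<bar>f p - b p * g p\<bar> \<le> e" for p
  proof -
    have "b p * f p = f p"
      using dilated_bump_eq_1[of p n] R(2)[of p] n by (cases "R < norm p") (auto simp: b)
    then have eq: "f p - b p * g p = b p * (f p - g p)" by (simp add: algebra_simps)
    have b01: "0 \<le> b p" "b p \<le> 1" unfolding b_def by (rule bump_range)+
    show ?thesis
    proof (cases "p \<in> ?K")
      case True
      have "\<bar>b p * (f p - g p)\<bar> \<le> 1 * e"
        unfolding abs_mult using g(2)[OF True] b01 by (intro mult_mono) auto
      then show ?thesis unfolding eq by simp
    next
      case False
      then have "b p = 0" using dilated_bump_eq_0[of n p] by (auto simp: b)
      then show ?thesis unfolding eq using e by simp
    qed
  qed
  ultimately show ?thesis by (intro bexI[of _ "\<lambda>p. b p * g p"]) auto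
qed

text \<open>The Riesz theorem is real, so it is applied to the real and the imaginary part of
  \<open>T\<close> on real test functions. Complex linearity of \<open>T\<close> then reaches all
  test functions.\<close>

lemma order_bound_0_imp_finite_measure:
  assumes T: "tempered_distribution T" and "order_bound T 0"
  shows "defines_finite_measure T"
proof -
  obtain C where "0 < C" and C: "\<And>f. f \<in> schwartz \<Longrightarrow> cmod (T f) \<le> C * schwartz_seminorm 0 (\<lambda>_. 0) f"
    using assms(2) unfolding order_bound_0_iff by blast
  define L where "L u = T (\<lambda>p. of_real (u p))" for u
  let ?D = real_test_functions
  have sch: "(\<lambda>p. of_real (u p)) \<in> schwartz" if "u \<in> ?D" for u
    using that test_functions_schwartz unfolding real_test_functions_def by auto
  have D_add: "(\<lambda>x. f x + g x) \<in> ?D" if "f \<in> ?D" "g \<in> ?D" for f g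
    using that test_functions_add unfolding real_test_functions_def by simp
  have D_scale: "(\<lambda>x. c * f x) \<in> ?D" if "f \<in> ?D" for f c
    using that test_functions_cmult unfolding real_test_functions_def by simp
  have L_add: "L (\<lambda>x. f x + g x) = L f + L g" if "f \<in> ?D" "g \<in> ?D" for f g
    using tempered_add[OF T sch[OF that(1)] sch[OF that(2)]] unfolding L_def by simp
  have L_scale: "L (\<lambda>x. c * f x) = of_real c * L f" if "f \<in> ?D" for f c
    using tempered_cmult[OF T sch[OF that], of "of_real c"] unfolding L_def by simp
  have L_bound: "cmod (L f) \<le> C * r" if "f \<in> ?D" "\<And>x. \<bar>f x\<bar> \<le> r" for f r
  proof -
    have "cmod (L f) \<le> C * schwartz_seminorm 0 (\<lambda>_. 0) (\<lambda>p. of_real (f p))"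
      unfolding L_def by (rule C[OF sch[OF that(1)]])
    also have "\<dots> \<le> C * r"
      using that(2) \<open>0 < C\<close> by (intro mult_left_mono schwartz_seminorm_0_least) auto
    finally show ?thesis .
  qed
  have "\<exists>M N. finite_measure M \<and> finite_measure N \<and> sets M = sets borel \<and> sets N = sets borel \<and>
     (\<forall>f\<in>?D. Re (L f) = integral\<^sup>L M f - integral\<^sup>L N f)"
    using \<open>0 < C\<close>
    by (intro riesz_representation_dense[where C = C] real_test_functions_Cc D_add D_scale real_test_functions_dense
          order_trans[OF abs_Re_le_cmod L_bound])
       (simp_all add: L_add L_scale)
  then obtain M1 N1 where 1: "finite_measure M1" "finite_measure N1" "sets M1 = sets borel" "sets N1 = sets borel"
    "\<And>f. f \<in> ?D \<Longrightarrow> Re (L f) = integral\<^sup>L M1 f - integral\<^sup>L N1 f" by blast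
  have "\<exists>M N. finite_measure M \<and> finite_measure N \<and> sets M = sets borel \<and> sets N = sets borel \<and>
     (\<forall>f\<in>?D. Im (L f) = integral\<^sup>L M f - integral\<^sup>L N f)"
    using \<open>0 < C\<close>
    by (intro riesz_representation_dense[where C = C] real_test_functions_Cc D_add D_scale real_test_functions_dense
          order_trans[OF abs_Im_le_cmod L_bound])
       (simp_all add: L_add L_scale)
  then obtain M2 N2 where 2: "finite_measure M2" "finite_measure N2" "sets M2 = sets borel" "sets N2 = sets borel"
    "\<And>f. f \<in> ?D \<Longrightarrow> Im (L f) = integral\<^sup>L M2 f - integral\<^sup>L N2 f" by blast
  define \<mu> where "\<mu> = (\<lambda>E. Complex (measure M1 E - measure N1 E) (measure M2 E - measure N2 E))"
  note rep = complex_measure_of_finite_measures[OF 1(1,2) 2(1,2) 1(3,4) 2(3,4), folded \<mu>_def]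
  have "T f = complex_measure_integral borel \<mu> f" if f: "f \<in> test_functions" for f
  proof -
    define u where "u p = Re (f p)" for p
    define v where "v p = Im (f p)" for p
    have uv: "u \<in> ?D" "v \<in> ?D" unfolding u_def[abs_def] v_def[abs_def] by (rule Re_Im_test_function[OF f])+
    have "f = (\<lambda>p. of_real (u p) + \<i> * of_real (v p))" unfolding u_def v_def using complex_eq by auto
    then have "T f = L u + \<i> * L v"
      using tempered_add[OF T sch[OF uv(1)] schwartz_cmult(1)[OF sch[OF uv(2)]]] tempered_cmult[OF T sch[OF uv(2)]]
      unfolding L_def by metis
    moreover have "L w = Complex (integral\<^sup>L M1 w - integral\<^sup>L N1 w) (integral\<^sup>L M2 w - integral\<^sup>L N2 w)"
      if "w \<in> ?D" for w
      using 1(5)[OF that] 2(5)[OF that] by (simp add: complex_eq_iff)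
    moreover have f_meas: "f \<in> borel_measurable borel"
      using f unfolding test_functions_iff by (intro borel_measurable_continuous_onI smooth_continuous) auto
    obtain K where K: "\<And>x. cmod (f x) \<le> K"
      using f test_functions_schwartz schwartz_seminorm_0_upper by blast
    have int: "integral\<^sup>L M f = Complex (integral\<^sup>L M u) (integral\<^sup>L M v)"
      if "finite_measure M" "sets M = sets borel" for M
    proof -
      interpret finite_measure M by fact
      have "f \<in> borel_measurable M" using f_meas by (subst measurable_cong_sets[OF that(2) refl])
      then have "integrable M f" using K by (intro integrable_const_bound[of _ K]) auto
      then show ?thesis unfolding u_def v_def by (simp add: complex_eq_iff)
    qed
    ultimately show ?thesis
      using uv unfolding rep(2)[OF f_meas K] int[OF 1(1) 1(3)] int[OF 1(2) 1(4)] int[OF 2(1) 2(3)] int[OF 2(2) 2(4)]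
      by (simp add: complex_eq_iff)
  qed
  then show ?thesis unfolding defines_finite_measure_def using rep(1) by blast
qed

theorem theorem3:
  fixes T :: "((real^4) \<Rightarrow> complex) \<Rightarrow> complex" and N :: nat
  assumes "tempered_distribution T"
    and "distribution_support T \<subseteq> forward_cone"
    and "N = distribution_order T"
  shows "N = 0 \<longleftrightarrow> defines_finite_measure T"
proof
  assume "N = 0"
  \<comment> \<open>\<open>LEAST\<close> has the defining property only if some bound exists, which
    continuity of \<open>T\<close> supplies.\<close>
  have "order_bound T (LEAST N. order_bound T N)"
    using tempered_order_bound[OF assms(1)] by (rule LeastI_ex)
  then have "order_bound T 0" using \<open>N = 0\<close> assms(3) unfolding distribution_order_def by simp
  then show "defines_finite_measure T" by (rule order_bound_0_imp_finite_measure[OF assms(1)])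
next
  assume "defines_finite_measure T"
  then have "order_bound T 0" by (rule finite_measure_imp_order_bound_0[OF assms(1)])
  then have "(LEAST N. order_bound T N) \<le> 0" by (rule Least_le)
  then show "N = 0" using assms(3) unfolding distribution_order_def by simp
qed

end
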